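(* The possible character tables of noncommutative standard rank $6$ reality-based algebras with positive degree map $\delta$ (with the basis labelled so that $b_0=1_A$, $b_i^*=b_i$ for $i=1,2,3$, and $b_4^*=b_5$) are precisely those of the form $$\begin{array}{r|cccccc|l} & b_0&b_1&b_2&b_3&b_4&b_5&\text{multiplicity}\\ \hline \delta&1&\delta_1&\delta_2&\delta_3&\delta_4&\delta_4&1\\ \phi&1&\phi_1&\phi_2&\phi_3&\phi_4&\phi_4&m_\phi\\ \chi&2&\chi_1&\chi_2&\chi_3&\chi_4&\chi_4&m_\chi \end{array}$$ where all entries are real and - $\delta_i>0$ for $i=1,\dots,4$; - $1+\phi_1+\phi_2+\phi_3+2\phi_4=0$ and $\dfrac{\phi_i}{\delta_i}\ne\dfrac{\phi_4}{\delta_4}$ for some $1\le i\le3$; - $m_\phi=\dfrac{n}{\sum_{i=0}^5\phi_i^2/\delta_i}$ and $m_\chi=\dfrac{n-1-m_\phi}{2}$, where $n=1+\delta_1+\delta_2+\delta_3+2\delta_4$ (with $\delta_0=\phi_0=1$, $\delta_5=\delta_4$, $\phi_5=\phi_4$); - $\chi_i=\dfrac{-\delta_i-m_\phi\phi_i}{m_\chi}$ for $i=1,2,3,4$. Conversely, any such character table determines a noncommutative standard rank $6$ reality-based algebra up to exact isomorphism.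
   Context: A reality-based algebra (RBA) $(A,\mathbf{B})$ of rank $r$ is a finite-dimensional $\mathbb{C}$-algebra $A$ with conjugate-semilinear involution $*$ ($(\alpha x)^*=\bar\alpha x^*$, $(xy)^*=y^*x^*$) and a distinguished basis $\mathbf{B}=\{b_0,\dots,b_{r-1}\}$ such that: (1) $b_0=1_A$; (2) the structure constants $\lambda_{ijk}$ in $b_ib_j=\sum_k\lambda_{ijk}b_k$ are real; (3) $\mathbf{B}^*=\mathbf{B}$, and one writes $b_{i^*}=(b_i)^*$; (4) $\lambda_{ij0}\ne0$ if and only if $j=i^*$; (5) $\lambda_{ii^*0}=\lambda_{i^*i0}>0$. A positive degree map is a one-dimensional algebra homomorphism $\delta:A\to\mathbb{C}$ with $\delta(a^* )=\overline{\delta(a)}$ and $\delta(b_i)>0$ for all $i$. The RBA (its basis) is standard with respect to $\delta$ if $\delta(b_i)=\lambda_{ii^*0}$ for all $i$. Such an $A$ is semisimple; a noncommutative one of rank $6$ with positive degree map has exactly three irreducible characters: $\delta$, another linear character $\phi$, and $\chi$ of degree $2$. The order is $n=\sum_i\delta(b_i)$; the standard feasible trace is $\tau(\sum_i\alpha_ib_i)=n\alpha_0$; the multiplicities $m_\delta=1,m_\phi,m_\chi$ are the coefficients in $\tau=\delta+m_\phi\phi+m_\chi\chi$. The character table lists the values $\delta_i=\delta(b_i)$, $\phi_i=\phi(b_i)$, $\chi_i=\chi(b_i)$ together with the multiplicities. Two standard RBAs $(A,\mathbf{B})$ and $(C,\mathbf{D})$ are exactly isomorphic if there is a bijection $\mathbf{B}\to\mathbf{D}$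 whose linear extension is an algebra isomorphism $A\to C$. *)

theory Defs
  imports
    "HOL-Analysis.Cartesian_Space"
    "HOL-Combinatorics.Permutations"
    "Jordan_Normal_Form.Matrix"
begin

text \<open>
  Algebras are given by explicit operations on a type carrying only its additive group, so that
  several complex algebra structures may live on the same type.
\<close>

locale complex_algebra = vector_space scl
  for scl :: "complex \<Rightarrow> 'a::ab_group_add \<Rightarrow> 'a" +
  fixes mul :: "'a \<Rightarrow> 'a \<Rightarrow> 'a"
    and ident :: 'a
  assumes mul_assoc: "mul (mul x y) z = mul x (mul y z)"
    and ident_left: "mul ident x = x"
    and ident_right: "mul x ident = x"
    and mul_add_right: "mul x (y + z) = mul x y + mul x z"
    and mul_add_left: "mul (x + y) z = mul x z + mul y z"
    and mul_scl_left: "mul (scl c x) y = scl c (mul x y)"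
    and mul_scl_right: "mul x (scl c y) = scl c (mul x y)"
begin

definition algebra_hom_complex :: "('a \<Rightarrow> complex) \<Rightarrow> bool" where
  "algebra_hom_complex f \<longleftrightarrow>
     (\<forall>x y. f (x + y) = f x + f y) \<and> (\<forall>c x. f (scl c x) = c * f x) \<and>
     (\<forall>x y. f (mul x y) = f x * f y) \<and> f ident = 1"

definition matrix_rep :: "nat \<Rightarrow> ('a \<Rightarrow> complex mat) \<Rightarrow> bool" where
  "matrix_rep d X \<longleftrightarrow>
     (\<forall>x. X x \<in> carrier_mat d d) \<and>
     (\<forall>x y. X (x + y) = X x + X y) \<and> (\<forall>c x. X (scl c x) = c \<cdot>\<^sub>m X x) \<and>
     (\<forall>x y. X (mul x y) = X x * X y) \<and> X ident = 1\<^sub>m d"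

definition invariant_subspace :: "nat \<Rightarrow> ('a \<Rightarrow> complex mat) \<Rightarrow> complex Matrix.vec set \<Rightarrow> bool" where
  "invariant_subspace d X W \<longleftrightarrow>
     W \<subseteq> carrier_vec d \<and> 0\<^sub>v d \<in> W \<and>
     (\<forall>v\<in>W. \<forall>w\<in>W. v + w \<in> W) \<and> (\<forall>c. \<forall>v\<in>W. c \<cdot>\<^sub>v v \<in> W) \<and>
     (\<forall>x. \<forall>v\<in>W. X x *\<^sub>v v \<in> W)"

definition irreducible_rep :: "nat \<Rightarrow> ('a \<Rightarrow> complex mat) \<Rightarrow> bool" where
  "irreducible_rep d X \<longleftrightarrow> 0 < d \<and> matrix_rep d X \<and>
     (\<forall>W. invariant_subspace d X W \<longrightarrow> W = {0\<^sub>v d} \<or> W = carrier_vec d)"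

definition irreducible_character :: "nat \<Rightarrow> ('a \<Rightarrow> complex) \<Rightarrow> bool" where
  "irreducible_character d \<psi> \<longleftrightarrow>
     (\<exists>X. irreducible_rep d X \<and> \<psi> = (\<lambda>x. \<Sum>i<d. X x $$ (i, i)))"

end

locale based_algebra = complex_algebra scl mul ident
  for scl :: "complex \<Rightarrow> 'a::ab_group_add \<Rightarrow> 'a" and mul ident +
  fixes b :: "nat \<Rightarrow> 'a"
    and r :: nat
  assumes b_inj: "inj_on b {..<r}"
    and b_independent: "independent (b ` {..<r})"
    and b_span: "span (b ` {..<r}) = UNIV"
begin

definition coeff_of :: "'a \<Rightarrow> nat \<Rightarrow> complex" where
  "coeff_of x k = representation (b ` {..<r}) x (b k)"

definition struct_const :: "nat \<Rightarrow> nat \<Rightarrow> nat \<Rightarrow> complex" where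
  "struct_const i j k = coeff_of (mul (b i) (b j)) k"

end

text \<open>
  The index written \<open>i\<^sup>*\<close> on paper is \<open>the_inv_into {..<r} b (star (b i))\<close>; it is named
  \<open>star_index i\<close> below. Since the structure constants are real, comparing the real part with 0
  expresses positivity.
\<close>

locale reality_based_algebra = based_algebra scl mul ident b r
  for scl :: "complex \<Rightarrow> 'a::ab_group_add \<Rightarrow> 'a" and mul ident
    and star :: "'a \<Rightarrow> 'a" and b r +
  assumes star_star: "star (star x) = x"
    and star_add: "star (x + y) = star x + star y"
    and star_scl: "star (scl c x) = scl (cnj c) (star x)"
    and star_mul: "star (mul x y) = mul (star y) (star x)"
    and rank_pos: "0 < r"
    and b_0: "b 0 = ident"
    and struct_const_real:
      "i < r \<Longrightarrow> j < r \<Longrightarrow> k < r \<Longrightarrow> struct_const i j k \<in> \<real>"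
    and star_basis: "star ` (b ` {..<r}) = b ` {..<r}"
    and struct_const_0_iff:
      "i < r \<Longrightarrow> j < r \<Longrightarrow>
         struct_const i j 0 \<noteq> 0 \<longleftrightarrow> j = the_inv_into {..<r} b (star (b i))"
    and struct_const_0_sym:
      "i < r \<Longrightarrow> j = the_inv_into {..<r} b (star (b i)) \<Longrightarrow>
         struct_const i j 0 = struct_const j i 0"
    and struct_const_0_pos:
      "i < r \<Longrightarrow> j = the_inv_into {..<r} b (star (b i)) \<Longrightarrow> 0 < Re (struct_const i j 0)"
begin

definition star_index :: "nat \<Rightarrow> nat" where
  "star_index i = the_inv_into {..<r} b (star (b i))"

definition positive_degree_map :: "('a \<Rightarrow> complex) \<Rightarrow> bool" where
  "positive_degree_map \<delta> \<longleftrightarrow>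
     algebra_hom_complex \<delta> \<and> (\<forall>x. \<delta> (star x) = cnj (\<delta> x)) \<and>
     (\<forall>i<r. \<delta> (b i) \<in> \<real> \<and> 0 < Re (\<delta> (b i)))"

end

text \<open>
  The rows and the multiplicities are complex and unconstrained. Only the columns with index
  below the rank are meaningful.
\<close>

record character_table =
  row_\<delta> :: "nat \<Rightarrow> complex"
  row_\<phi> :: "nat \<Rightarrow> complex"
  row_\<chi> :: "nat \<Rightarrow> complex"
  mult_\<delta> :: complex
  mult_\<phi> :: complex
  mult_\<chi> :: complex

locale standard_rba = reality_based_algebra scl mul ident star b r
  for scl :: "complex \<Rightarrow> 'a::ab_group_add \<Rightarrow> 'a" and mul ident star b r +
  fixes \<delta> :: "'a \<Rightarrow> complex"
  assumes degree_map: "positive_degree_map \<delta>"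
    and standard: "i < r \<Longrightarrow> \<delta> (b i) = struct_const i (star_index i) 0"
begin

definition rba_order :: complex where
  "rba_order = (\<Sum>i<r. \<delta> (b i))"

definition feasible_trace :: "'a \<Rightarrow> complex" where
  "feasible_trace x = rba_order * coeff_of x 0"

text \<open>
  Character tables for algebras with exactly three irreducible characters, of degrees 1, 1 and 2.
\<close>

definition has_character_table :: "character_table \<Rightarrow> bool" where
  "has_character_table T \<longleftrightarrow>
     (\<exists>\<phi> chi. irreducible_character 1 \<phi> \<and> \<phi> \<noteq> \<delta> \<and> irreducible_character 2 chi \<and>
        {\<psi>. \<exists>d. irreducible_character d \<psi>} = {\<delta>, \<phi>, chi} \<and>
        (\<forall>i<r. row_\<delta> T i = \<delta> (b i) \<and> row_\<phi> T i = \<phi> (b i) \<and> row_\<chi> T i = chi (b i)) \<and>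
        (\<forall>x. feasible_trace x = mult_\<delta> T * \<delta> x + mult_\<phi> T * \<phi> x + mult_\<chi> T * chi x))"

end

definition noncomm_standard_rba6 ::
  "(complex \<Rightarrow> 'a::ab_group_add \<Rightarrow> 'a) \<Rightarrow> ('a \<Rightarrow> 'a \<Rightarrow> 'a) \<Rightarrow> 'a \<Rightarrow> ('a \<Rightarrow> 'a) \<Rightarrow> (nat \<Rightarrow> 'a) \<Rightarrow>
     ('a \<Rightarrow> complex) \<Rightarrow> bool" where
  "noncomm_standard_rba6 scl mul ident star b \<delta> \<longleftrightarrow>
     standard_rba scl mul ident star b 6 \<delta> \<and> (\<exists>x y. mul x y \<noteq> mul y x)"

definition labelled :: "('a \<Rightarrow> 'a) \<Rightarrow> (nat \<Rightarrow> 'a) \<Rightarrow> bool" where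
  "labelled star b \<longleftrightarrow> (\<forall>i\<in>{1..3}. star (b i) = b i) \<and> star (b 4) = b 5"

abbreviation is_character_table6 ::
  "(complex \<Rightarrow> 'a::ab_group_add \<Rightarrow> 'a) \<Rightarrow> ('a \<Rightarrow> 'a \<Rightarrow> 'a) \<Rightarrow> 'a \<Rightarrow> (nat \<Rightarrow> 'a) \<Rightarrow>
     ('a \<Rightarrow> complex) \<Rightarrow> character_table \<Rightarrow> bool" where
  "is_character_table6 scl mul ident b \<delta> T \<equiv>
     standard_rba.has_character_table scl mul ident b 6 \<delta> T"

definition exactly_isomorphic ::
  "(complex \<Rightarrow> 'a::ab_group_add \<Rightarrow> 'a) \<Rightarrow> ('a \<Rightarrow> 'a \<Rightarrow> 'a) \<Rightarrow> 'a \<Rightarrow> 'a set \<Rightarrow>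
   (complex \<Rightarrow> 'b::ab_group_add \<Rightarrow> 'b) \<Rightarrow> ('b \<Rightarrow> 'b \<Rightarrow> 'b) \<Rightarrow> 'b \<Rightarrow> 'b set \<Rightarrow> bool" where
  "exactly_isomorphic scaleA multA unitA B scaleC multC unitC D \<longleftrightarrow>
     (\<exists>f. bij_betw f B D \<and> Vector_Spaces.linear scaleA scaleC f \<and> bij f \<and>
        (\<forall>x y. f (multA x y) = multC (f x) (f y)) \<and> f unitA = unitC)"

definition admissible_table :: "character_table \<Rightarrow> bool" where
  "admissible_table T \<longleftrightarrow>
     (\<exists>(\<delta> :: nat \<Rightarrow> real) (\<phi> :: nat \<Rightarrow> real) (chi :: nat \<Rightarrow> real) (m\<^sub>\<phi> :: real) (m\<^sub>\<chi> :: real) (n :: real).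
        (\<forall>i<6. row_\<delta> T i = complex_of_real (\<delta> i) \<and>
               row_\<phi> T i = complex_of_real (\<phi> i) \<and>
               row_\<chi> T i = complex_of_real (chi i)) \<and>
        mult_\<delta> T = 1 \<and> mult_\<phi> T = complex_of_real m\<^sub>\<phi> \<and> mult_\<chi> T = complex_of_real m\<^sub>\<chi> \<and>
        \<delta> 0 = 1 \<and> \<phi> 0 = 1 \<and> chi 0 = 2 \<and>
        \<delta> 5 = \<delta> 4 \<and> \<phi> 5 = \<phi> 4 \<and> chi 5 = chi 4 \<and>
        (\<forall>i\<in>{1..4}. 0 < \<delta> i) \<and>
        1 + \<phi> 1 + \<phi> 2 + \<phi> 3 + 2 * \<phi> 4 = 0 \<and>
        (\<exists>i\<in>{1..3}. \<phi> i / \<delta> i \<noteq> \<phi> 4 / \<delta> 4) \<and>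
        n = 1 + \<delta> 1 + \<delta> 2 + \<delta> 3 + 2 * \<delta> 4 \<and>
        m\<^sub>\<phi> = n / (\<Sum>i=0..5. (\<phi> i)\<^sup>2 / \<delta> i) \<and>
        m\<^sub>\<chi> = (n - 1 - m\<^sub>\<phi>) / 2 \<and>
        (\<forall>i\<in>{1..4}. chi i = (- \<delta> i - m\<^sub>\<phi> * \<phi> i) / m\<^sub>\<chi>))"

end

theory Submission
  imports Defs
begin

text \<open>
  Let \<open>A\<close> be the algebra, \<open>tr\<close> the coefficient at \<open>b 0\<close>; \<open>tr (x * star x) > 0\<close> for \<open>x \<noteq> 0\<close>.
  On the real span of the basis, commutators of symmetric elements are skew, and a skew element orthogonal
  to all of them commutes with the symmetric elements. This rules out that \<open>star\<close> swaps no or two pairs of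
  basis elements. If it swaps exactly one pair, the commutator is an alternating form on the span of \<open>b 1, b 2, b 3\<close>
  with values in the line of \<open>b 4 - b 5\<close>; its kernel yields a central element that splits \<open>A\<close>
  as \<open>C + C + M\<^sub>2(C)\<close>. In coordinates for which the trace form is diagonal the basis
  elements form a real 6x6 matrix with orthogonal rows, and orthogonality of its columns yields
  the conditions on the character table. Conversely an admissible table gives four orthogonal columns of
  such a matrix, and two more can always be added. The freedom in this choice is a plane isometry, which
  changes the structure constants at most by exchanging \<open>b 4\<close> and \<open>b 5\<close>.
\<close>

section \<open>Coefficients, degrees and the trace\<close>

text \<open>Semisimplicity is never invoked; positivity of the trace form does the work. A nonzero
  symmetric real element has a square of positive trace, a nonzero skew one a square of negative
  trace. Hence the square roots that normalise the generators of the summands are real, and the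
  basis elements get real coordinates. The condition that some \<open>\<phi> i / \<delta> i\<close>
  differs from \<open>\<phi> 4 / \<delta> 4\<close> is the strict case of Cauchy-Schwarz: it is what
  makes \<open>m\<^sub>\<chi>\<close> positive. A structure constant is, up to the factor
  \<open>deg k\<close>, the trace of the product of \<open>b i\<close>, \<open>b j\<close> and
  \<open>star (b k)\<close>. In coordinates this is a polynomial in the table entries, in inner
  products of the coordinates that the table leaves open, and in an oriented volume of these.
  Orthogonality determines the inner products, and these determine the volume up to one common sign,
  so the arbitrary choice of the last two columns is harmless.\<close>

context based_algebra
begin

lemma coeff_add: "coeff_of (x + y) k = coeff_of x k + coeff_of y k"
  unfolding coeff_of_def
  using b_span by (subst representation_add[OF b_independent]) auto

lemma coeff_scl: "coeff_of (scl c x) k = c * coeff_of x k"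
  unfolding coeff_of_def
  using b_span by (subst representation_scale[OF b_independent]) auto

lemma coeff_zero: "coeff_of 0 k = 0"
  using coeff_scl[of 0 0 k] by simp

lemma coeff_minus: "coeff_of (- x) k = - coeff_of x k"
  using coeff_add[of x "- x" k] coeff_zero by (simp add: eq_neg_iff_add_eq_0 add.commute)

lemma coeff_diff: "coeff_of (x - y) k = coeff_of x k - coeff_of y k"
  using coeff_add[of x "- y" k] coeff_minus by simp

lemma coeff_sum: "coeff_of (sum f I) k = (\<Sum>i\<in>I. coeff_of (f i) k)"
  by (induction I rule: infinite_finite_induct) (auto simp: coeff_add coeff_zero)

lemma coeff_basis:
  assumes "i < r" "k < r"
  shows "coeff_of (b i) k = of_bool (i = k)"
proof -
  have "representation (b ` {..<r}) (b i) = (\<lambda>v. if v = b i then 1 else 0)"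
    using assms by (intro representation_basis[OF b_independent]) auto
  moreover have "b k = b i \<longleftrightarrow> i = k"
    using assms b_inj by (auto simp: inj_on_def)
  ultimately show ?thesis
    by (simp add: coeff_of_def)
qed

lemma basis_expansion: "(\<Sum>k<r. scl (coeff_of x k) (b k)) = x"
proof -
  have "(\<Sum>v\<in>b ` {..<r}. scl (representation (b ` {..<r}) x v) v) = x"
    using b_span by (intro sum_representation_eq[OF b_independent]) auto
  then show ?thesis
    using b_inj by (simp add: sum.reindex coeff_of_def)
qed

lemma coeff_unique:
  assumes "x = (\<Sum>i<r. scl (c i) (b i))" "k < r"
  shows "coeff_of x k = c k"
proof -
  have "coeff_of x k = (\<Sum>i<r. c i * of_bool (i = k))"
    unfolding assms(1) coeff_sum coeff_scl
    by (intro sum.cong) (auto simp: coeff_basis assms(2))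
  also have "\<dots> = (\<Sum>i<r. if i = k then c i else 0)"
    by (intro sum.cong) auto
  also have "\<dots> = c k"
    using assms(2) by simp
  finally show ?thesis .
qed

lemma eq_by_coeff: "(\<And>k. k < r \<Longrightarrow> coeff_of x k = coeff_of y k) \<Longrightarrow> x = y"
  by (metis (mono_tags, lifting) basis_expansion lessThan_iff sum.cong)

lemma basis_product: "mul (b i) (b j) = (\<Sum>k<r. scl (struct_const i j k) (b k))"
  unfolding struct_const_def by (simp add: basis_expansion)

end

context complex_algebra
begin

lemma mul_zero_left: "mul 0 x = 0"
  using mul_scl_left[of 0 0 x] by simp

lemma mul_zero_right: "mul x 0 = 0"
  using mul_scl_right[of x 0 0] by simp

lemma mul_minus_left: "mul (- x) y = - mul x y"
  using mul_add_left[of x "- x" y] mul_zero_left by (simp add: eq_neg_iff_add_eq_0 add.commute)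

lemma mul_minus_right: "mul x (- y) = - mul x y"
  using mul_add_right[of x y "- y"] mul_zero_right by (simp add: eq_neg_iff_add_eq_0 add.commute)

lemma mul_diff_left: "mul (x - y) z = mul x z - mul y z"
  using mul_add_left[of x "- y" z] mul_minus_left by simp

lemma mul_diff_right: "mul x (y - z) = mul x y - mul x z"
  using mul_add_right[of x y "- z"] mul_minus_right by simp

lemma mul_sum_left: "mul (sum f I) y = (\<Sum>i\<in>I. mul (f i) y)"
  by (induction I rule: infinite_finite_induct) (auto simp: mul_add_left mul_zero_left)

lemma mul_sum_right: "mul x (sum f I) = (\<Sum>i\<in>I. mul x (f i))"
  by (induction I rule: infinite_finite_induct) (auto simp: mul_add_right mul_zero_right)

lemmas mul_linear = mul_add_left mul_add_right mul_diff_left mul_diff_right mul_minus_left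
  mul_minus_right mul_scl_left mul_scl_right mul_zero_left mul_zero_right ident_left ident_right

lemma algebra_hom_zero: "algebra_hom_complex f \<Longrightarrow> f 0 = 0"
  unfolding algebra_hom_complex_def by (metis mult_zero_left scale_zero_left)

lemma algebra_hom_sum: "algebra_hom_complex f \<Longrightarrow> f (sum g I) = (\<Sum>i\<in>I. f (g i))"
proof (induction I rule: infinite_finite_induct)
  case (insert x F)
  then show ?case by (simp add: algebra_hom_complex_def)
qed (auto simp: algebra_hom_zero)

end

context reality_based_algebra
begin

lemma star_index_less: "i < r \<Longrightarrow> star_index i < r"
  and star_basis_index: "i < r \<Longrightarrow> star (b i) = b (star_index i)"
proof -
  assume "i < r"
  then have "star (b i) \<in> b ` {..<r}"
    using star_basis by blast
  then show "star_index i < r" "star (b i) = b (star_index i)"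
    unfolding star_index_def
    using the_inv_into_into[OF b_inj, of "star (b i)" "{..<r}"] f_the_inv_into_f[OF b_inj, of "star (b i)"]
    by auto
qed

lemma star_index_eq: "i < r \<Longrightarrow> j < r \<Longrightarrow> star (b i) = b j \<Longrightarrow> star_index i = j"
  unfolding star_index_def using the_inv_into_f_f[OF b_inj, of j] by simp

lemma star_index_star_index: "i < r \<Longrightarrow> star_index (star_index i) = i"
  by (intro star_index_eq star_index_less) (auto simp: star_basis_index[symmetric] star_star)

lemma star_ident: "star ident = ident"
  by (metis ident_left ident_right star_mul star_star)

lemma star_index_0: "star_index 0 = 0"
  using rank_pos by (intro star_index_eq) (auto simp: b_0 star_ident)

lemma bij_betw_star_index: "bij_betw star_index {..<r} {..<r}"
  by (rule bij_betwI[where g = star_index]) (auto simp: star_index_less star_index_star_index)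

lemma star_zero: "star 0 = 0"
  using star_scl[of 0 0] by simp

lemma star_minus: "star (- x) = - star x"
  using star_add[of x "- x"] star_zero by (simp add: eq_neg_iff_add_eq_0 add.commute)

lemma star_diff: "star (x - y) = star x - star y"
  using star_add[of x "- y"] star_minus by simp

lemma star_sum: "star (sum f I) = (\<Sum>i\<in>I. star (f i))"
  by (induction I rule: infinite_finite_induct) (auto simp: star_add star_zero)

lemma coeff_star:
  assumes "k < r"
  shows "coeff_of (star x) k = cnj (coeff_of x (star_index k))"
proof (rule coeff_unique[OF _ assms])
  have "star x = star (\<Sum>k<r. scl (coeff_of x k) (b k))"
    by (simp add: basis_expansion)
  also have "\<dots> = (\<Sum>k<r. scl (cnj (coeff_of x k)) (b (star_index k)))"
    unfolding star_sum star_scl by (intro sum.cong) (auto simp: star_basis_index)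
  also have "\<dots> = (\<Sum>k<r. scl (cnj (coeff_of x (star_index k))) (b k))"
    by (rule sum.reindex_bij_betw[OF bij_betw_star_index, symmetric, THEN trans])
      (auto intro!: sum.cong simp: star_index_star_index)
  finally show "star x = (\<Sum>k<r. scl (cnj (coeff_of x (star_index k))) (b k))" .
qed

lemma star_index_of_labelled:
  assumes "labelled star b" "6 \<le> r"
  shows "star_index 0 = 0" "star_index 1 = 1" "star_index 2 = 2" "star_index 3 = 3"
    "star_index 4 = 5" "star_index 5 = 4"
  using assms star_index_0 star_star[of "b 4"]
  by (auto simp: labelled_def intro!: star_index_eq)

definition tr :: "'a \<Rightarrow> complex" where
  "tr x = coeff_of x 0"

lemma tr_linear: "tr (x + y) = tr x + tr y" "tr (x - y) = tr x - tr y" "tr (- x) = - tr x"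
    "tr (scl c x) = c * tr x" "tr 0 = 0"
  by (simp_all add: tr_def coeff_add coeff_diff coeff_minus coeff_scl coeff_zero)

lemma tr_sum: "tr (sum f I) = (\<Sum>i\<in>I. tr (f i))"
  by (simp add: tr_def coeff_sum)

end

context standard_rba
begin

definition deg :: "nat \<Rightarrow> real" where
  "deg i = Re (\<delta> (b i))"

lemma degree_basis: "i < r \<Longrightarrow> \<delta> (b i) = complex_of_real (deg i)"
  using degree_map unfolding positive_degree_map_def deg_def by (auto simp: complex_eq_iff complex_is_Real_iff)

lemma deg_pos: "i < r \<Longrightarrow> 0 < deg i"
  using degree_map unfolding positive_degree_map_def deg_def by auto

lemma degree_hom: "algebra_hom_complex \<delta>"
  using degree_map unfolding positive_degree_map_def by auto

lemma degree_star: "\<delta> (star x) = cnj (\<delta> x)"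
  using degree_map unfolding positive_degree_map_def by auto

lemma degree_linear: "\<delta> (x + y) = \<delta> x + \<delta> y" "\<delta> (scl c x) = c * \<delta> x" "\<delta> (mul x y) = \<delta> x * \<delta> y"
    "\<delta> ident = 1" "\<delta> 0 = 0"
  using degree_hom algebra_hom_zero[of \<delta>] unfolding algebra_hom_complex_def by auto

lemma degree_minus: "\<delta> (- x) = - \<delta> x" "\<delta> (x - y) = \<delta> x - \<delta> y"
proof -
  show m: "\<delta> (- x) = - \<delta> x" for x
    using degree_linear(1)[of x "- x"] degree_linear(5) by (simp add: eq_neg_iff_add_eq_0 add.commute)
  show "\<delta> (x - y) = \<delta> x - \<delta> y"
    using degree_linear(1)[of x "- y"] m by simp
qed

lemma deg_0: "deg 0 = 1"
  by (simp add: deg_def b_0 degree_linear)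

lemma deg_star_index: "i < r \<Longrightarrow> deg (star_index i) = deg i"
  unfolding deg_def by (simp add: star_basis_index[symmetric] degree_star)

lemma tr_basis_mul:
  "i < r \<Longrightarrow> j < r \<Longrightarrow> tr (mul (b i) (b j)) = (if j = star_index i then complex_of_real (deg i) else 0)"
  using struct_const_0_iff[of i j] standard[of i] degree_basis[of i]
  unfolding star_index_def[symmetric] tr_def struct_const_def by auto

lemma tr_mul: "tr (mul x y) = (\<Sum>i<r. coeff_of x i * coeff_of y (star_index i) * complex_of_real (deg i))"
proof -
  have "tr (mul x y) = tr (mul (\<Sum>i<r. scl (coeff_of x i) (b i)) (\<Sum>i<r. scl (coeff_of y i) (b i)))"
    by (simp add: basis_expansion)
  also have "\<dots> = (\<Sum>i<r. \<Sum>j<r. coeff_of x j * (coeff_of y i * tr (mul (b j) (b i))))"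
    by (simp add: mul_sum_left mul_sum_right mul_scl_left mul_scl_right tr_linear tr_sum sum_distrib_left
        mult.left_commute)
  also have "\<dots> = (\<Sum>j<r. \<Sum>i<r. if i = star_index j then coeff_of x j * coeff_of y i * complex_of_real (deg j) else 0)"
    by (subst sum.swap) (auto intro!: sum.cong simp: tr_basis_mul)
  also have "\<dots> = (\<Sum>i<r. coeff_of x i * coeff_of y (star_index i) * complex_of_real (deg i))"
    by (intro sum.cong) (auto simp: star_index_less)
  finally show ?thesis .
qed

text \<open>The form pairs coefficient \<open>i\<close> with coefficient
  \<open>star_index i\<close>, weighted by \<open>deg i\<close>. It is symmetric because
  \<open>star_index\<close> is an involution that preserves \<open>deg\<close>.\<close>

lemma tr_commute: "tr (mul x y) = tr (mul y x)"
proof -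
  have "tr (mul x y) = (\<Sum>i<r. coeff_of x (star_index i) * coeff_of y i * complex_of_real (deg i))"
    unfolding tr_mul
    by (rule sum.reindex_bij_betw[OF bij_betw_star_index, symmetric, THEN trans])
      (auto intro!: sum.cong simp: star_index_star_index deg_star_index)
  also have "\<dots> = tr (mul y x)"
    unfolding tr_mul by (intro sum.cong) auto
  finally show ?thesis .
qed

lemma tr_mul_star: "tr (mul x (star x)) = complex_of_real (\<Sum>i<r. (cmod (coeff_of x i))\<^sup>2 * deg i)"
  unfolding tr_mul of_real_sum
  by (intro sum.cong)
    (auto simp: coeff_star star_index_less star_index_star_index complex_norm_square simp del: of_real_power)

lemma tr_mul_star_pos:
  assumes "x \<noteq> 0"
  shows "0 < Re (tr (mul x (star x)))"
proof -
  obtain k where k: "k < r" "coeff_of x k \<noteq> 0"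
    using assms eq_by_coeff[of x 0] coeff_zero by auto
  have "0 < (\<Sum>i<r. (cmod (coeff_of x i))\<^sup>2 * deg i)"
    using k deg_pos by (intro sum_pos2[of _ k]) (auto simp: less_imp_le)
  then show ?thesis
    by (simp add: tr_mul_star)
qed

text \<open>Up to the factor \<open>deg k\<close>, the elements \<open>b (star_index k)\<close> form
  the dual basis of the trace form, so coefficients can be read off from traces.\<close>

lemma tr_mul_basis_star: "k < r \<Longrightarrow> tr (mul x (b (star_index k))) = coeff_of x k * complex_of_real (deg k)"
  unfolding tr_mul
  by (subst sum.remove[of _ k])
    (auto simp: coeff_basis star_index_less star_index_star_index intro!: sum.neutral
      dest: star_index_star_index)

end

section \<open>The idempotent of the degree map, real elements and commutators\<close>

context standard_rba
begin

definition order :: real where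
  "order = (\<Sum>i<r. deg i)"

lemma order_pos: "0 < order"
  unfolding order_def using rank_pos deg_pos by (intro sum_pos) auto

lemma rba_order_eq: "rba_order = complex_of_real order"
  unfolding rba_order_def order_def of_real_sum by (intro sum.cong) (auto simp: degree_basis)

lemma feasible_trace_eq: "feasible_trace x = complex_of_real order * tr x"
  by (simp add: feasible_trace_def rba_order_eq tr_def)

definition basis_sum :: 'a where
  "basis_sum = (\<Sum>i<r. b i)"

text \<open>The central idempotent that belongs to the character \<open>\<delta>\<close>; the scalar
  is chosen so that its degree is 1.\<close>

definition e :: 'a where
  "e = scl (complex_of_real (1 / order)) basis_sum"

lemma coeff_basis_sum: "k < r \<Longrightarrow> coeff_of basis_sum k = 1"
  unfolding basis_sum_def coeff_sum
  by (subst sum.remove[of _ k]) (auto simp: coeff_basis intro!: sum.neutral)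

lemma coeff_e: "k < r \<Longrightarrow> coeff_of e k = complex_of_real (1 / order)"
  by (simp add: e_def coeff_scl coeff_basis_sum)

lemma degree_expansion: "\<delta> x = (\<Sum>i<r. coeff_of x i * complex_of_real (deg i))"
proof -
  have "\<delta> x = \<delta> (\<Sum>k<r. scl (coeff_of x k) (b k))"
    by (simp add: basis_expansion)
  also have "\<dots> = (\<Sum>i<r. coeff_of x i * complex_of_real (deg i))"
    unfolding algebra_hom_sum[OF degree_hom] by (intro sum.cong) (auto simp: degree_linear degree_basis)
  finally show ?thesis .
qed

lemma tr_mul_basis_sum: "tr (mul x basis_sum) = \<delta> x"
  unfolding tr_mul degree_expansion[of x] by (intro sum.cong) (auto simp: coeff_basis_sum star_index_less)

text \<open>Pairing with \<open>basis_sum\<close> under the trace form is \<open>\<delta>\<close>.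
  Hence the pairing of \<open>x\<close> times \<open>basis_sum\<close> with a dual basis element
  \<open>c\<close> is \<open>\<delta> c * \<delta> x\<close>, by cyclicity of the trace and
  multiplicativity of \<open>\<delta>\<close>.\<close>

lemma mul_basis_sum: "mul x basis_sum = scl (\<delta> x) basis_sum" "mul basis_sum x = scl (\<delta> x) basis_sum"
proof -
  have "coeff_of (mul x basis_sum) k * deg k = coeff_of (scl (\<delta> x) basis_sum) k * deg k"
    "coeff_of (mul basis_sum x) k * deg k = coeff_of (scl (\<delta> x) basis_sum) k * deg k" if "k < r" for k
  proof -
    let ?c = "b (star_index k)"
    have s: "star_index k < r"
      using that by (rule star_index_less)
    have "coeff_of (mul x basis_sum) k * deg k = tr (mul (mul ?c x) basis_sum)"
      by (metis mul_assoc that tr_commute tr_mul_basis_star)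
    moreover have "coeff_of (mul basis_sum x) k * deg k = tr (mul (mul x ?c) basis_sum)"
      by (metis mul_assoc that tr_commute tr_mul_basis_star)
    ultimately show "coeff_of (mul x basis_sum) k * deg k = coeff_of (scl (\<delta> x) basis_sum) k * deg k"
      "coeff_of (mul basis_sum x) k * deg k = coeff_of (scl (\<delta> x) basis_sum) k * deg k"
      by (simp_all add: tr_mul_basis_sum degree_linear degree_basis[OF s] deg_star_index[OF that]
          coeff_scl coeff_basis_sum[OF that])
  qed
  then show "mul x basis_sum = scl (\<delta> x) basis_sum" "mul basis_sum x = scl (\<delta> x) basis_sum"
    using deg_pos by (metis eq_by_coeff less_irrefl mult_cancel_right of_real_eq_0_iff)+
qed

lemma mul_e: "mul x e = scl (\<delta> x) e" "mul e x = scl (\<delta> x) e"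
  by (simp_all add: e_def mul_scl_left mul_scl_right mul_basis_sum mult.commute)

lemma degree_e: "\<delta> e = 1"
proof -
  have "\<delta> basis_sum = complex_of_real order"
    unfolding basis_sum_def algebra_hom_sum[OF degree_hom] order_def of_real_sum
    by (intro sum.cong) (auto simp: degree_basis)
  then show ?thesis
    using order_pos by (simp add: e_def degree_linear)
qed

lemma e_idem: "mul e e = e"
  by (simp add: mul_e degree_e)

lemma star_e: "star e = e"
  by (rule eq_by_coeff) (simp add: coeff_star coeff_e star_index_less)

lemma tr_e: "tr e = complex_of_real (1 / order)"
  using rank_pos by (simp add: tr_def coeff_e)

text \<open>Since the structure constants are real, the real span of the basis is a real algebra.
  There \<open>star\<close> is linear, and \<open>rsym\<close> and \<open>rskew\<close> below are
  its eigenspaces for 1 and -1.\<close>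

definition real_elt :: "'a \<Rightarrow> bool" where
  "real_elt x \<longleftrightarrow> (\<forall>k<r. coeff_of x k \<in> \<real>)"

lemma real_elt_add: "real_elt x \<Longrightarrow> real_elt y \<Longrightarrow> real_elt (x + y)"
  and real_elt_diff: "real_elt x \<Longrightarrow> real_elt y \<Longrightarrow> real_elt (x - y)"
  and real_elt_minus: "real_elt x \<Longrightarrow> real_elt (- x)"
  and real_elt_scl: "real_elt x \<Longrightarrow> real_elt (scl (complex_of_real c) x)"
  by (auto simp: real_elt_def coeff_add coeff_diff coeff_minus coeff_scl)

lemma real_elt_e: "real_elt e"
  by (simp add: real_elt_def coeff_e)

lemma real_elt_basis: "i < r \<Longrightarrow> real_elt (b i)"
  by (simp add: real_elt_def coeff_basis)

lemma real_elt_ident: "real_elt ident"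
  using real_elt_basis[of 0] rank_pos by (simp add: b_0)

lemma real_elt_mul:
  assumes "real_elt x" "real_elt y"
  shows "real_elt (mul x y)"
proof -
  have "mul x y = mul (\<Sum>i<r. scl (coeff_of x i) (b i)) (\<Sum>i<r. scl (coeff_of y i) (b i))"
    by (simp add: basis_expansion)
  also have "\<dots> = (\<Sum>i<r. \<Sum>j<r. scl (coeff_of y i) (scl (coeff_of x j) (mul (b j) (b i))))"
    by (simp add: mul_sum_left mul_sum_right mul_scl_left mul_scl_right scale_sum_right)
  finally have "coeff_of (mul x y) k
      = (\<Sum>i<r. \<Sum>j<r. coeff_of y i * (coeff_of x j * struct_const j i k))" for k
    by (simp only: coeff_sum coeff_scl struct_const_def)
  then show ?thesis
    using assms struct_const_real by (auto simp: real_elt_def intro!: sum_in_Reals Reals_mult)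
qed

lemma real_elt_tr: "real_elt x \<Longrightarrow> tr x \<in> \<real>"
  using rank_pos by (simp add: tr_def real_elt_def)

lemma real_elt_degree: "real_elt x \<Longrightarrow> \<delta> x \<in> \<real>"
  unfolding degree_expansion[of x] by (auto simp: real_elt_def intro!: sum_in_Reals Reals_mult)

definition rsym :: "'a \<Rightarrow> bool" where
  "rsym x \<longleftrightarrow> real_elt x \<and> star x = x"

definition rskew :: "'a \<Rightarrow> bool" where
  "rskew x \<longleftrightarrow> real_elt x \<and> star x = - x"

definition comm :: "'a \<Rightarrow> 'a \<Rightarrow> 'a" where
  "comm x y = mul x y - mul y x"

lemma rsym_add: "rsym x \<Longrightarrow> rsym y \<Longrightarrow> rsym (x + y)"
  and rsym_diff: "rsym x \<Longrightarrow> rsym y \<Longrightarrow> rsym (x - y)"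
  and rsym_scl: "rsym x \<Longrightarrow> rsym (scl (complex_of_real c) x)"
  and rskew_scl: "rskew x \<Longrightarrow> rskew (scl (complex_of_real c) x)"
  and rskew_add: "rskew x \<Longrightarrow> rskew y \<Longrightarrow> rskew (x + y)"
  and rskew_diff: "rskew x \<Longrightarrow> rskew y \<Longrightarrow> rskew (x - y)"
  by (auto simp: rsym_def rskew_def real_elt_add real_elt_diff real_elt_minus real_elt_scl
      star_add star_diff star_minus star_scl)

lemma rsym_e: "rsym e" and rsym_ident: "rsym ident"
  by (auto simp: rsym_def real_elt_e star_e real_elt_ident star_ident)

lemma rsym_square: "rsym x \<or> rskew x \<Longrightarrow> rsym (mul x x)"
  by (auto simp: rsym_def rskew_def real_elt_mul star_mul mul_minus_left mul_minus_right)

lemma rskew_comm_sym: "rsym x \<Longrightarrow> rsym y \<Longrightarrow> rskew (comm x y)"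
  and rsym_comm: "rskew x \<Longrightarrow> rsym y \<Longrightarrow> rsym (comm x y)"
  and rskew_comm_skew: "rskew x \<Longrightarrow> rskew y \<Longrightarrow> rskew (comm x y)"
  and rskew_anticomm: "rskew x \<Longrightarrow> rsym y \<Longrightarrow> rskew (mul x y + mul y x)"
  by (auto simp: rsym_def rskew_def comm_def real_elt_add real_elt_diff real_elt_mul star_diff star_add star_mul
      mul_minus_left mul_minus_right)

lemma rskew_mul_commuting: "rskew x \<Longrightarrow> rsym y \<Longrightarrow> comm x y = 0 \<Longrightarrow> rskew (mul x y)"
  and rsym_mul_commuting: "rsym x \<Longrightarrow> rsym y \<Longrightarrow> comm x y = 0 \<Longrightarrow> rsym (mul x y)"
  by (auto simp: rsym_def rskew_def comm_def real_elt_mul star_mul mul_minus_left mul_minus_right)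

lemma rsym_tr_square_pos:
  assumes "rsym x" "x \<noteq> 0"
  shows "0 < Re (tr (mul x x))"
  using tr_mul_star_pos[OF assms(2)] assms(1) by (simp add: rsym_def)

lemma rskew_tr_square_neg:
  assumes "rskew x" "x \<noteq> 0"
  shows "Re (tr (mul x x)) < 0"
  using tr_mul_star_pos[OF assms(2)] assms(1) by (simp add: rskew_def mul_minus_right tr_linear)

lemma tr_comm_invariant: "tr (mul (comm x y) z) = tr (mul x (comm y z))"
  using tr_commute[of y "mul x z"] by (simp add: comm_def mul_linear tr_linear mul_assoc)

lemma comm_swap: "comm y x = - comm x y"
  by (simp add: comm_def)

lemma comm_linear: "comm (x + y) z = comm x z + comm y z" "comm z (x + y) = comm z x + comm z y"
    "comm (x - y) z = comm x z - comm y z" "comm z (x - y) = comm z x - comm z y"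
    "comm (- x) z = - comm x z" "comm z (- x) = - comm z x"
    "comm (scl c x) z = scl c (comm x z)" "comm z (scl c x) = scl c (comm z x)"
    "comm ident x = 0" "comm x ident = 0" "comm e x = 0" "comm x e = 0" "comm x x = 0"
    "comm 0 x = 0" "comm x 0 = 0"
  by (simp_all add: comm_def mul_linear mul_e scale_right_diff_distrib)

lemma comm_leibniz: "comm x (mul y z) = mul (comm x y) z + mul y (comm x z)"
  by (simp add: comm_def mul_linear mul_assoc)

text \<open>Since \<open>comm \<kappa> x\<close> is again symmetric, invariance of the trace form makes it
  orthogonal to itself.\<close>

lemma skew_commutes_with_sym:
  assumes "rskew \<kappa>" "rsym x" "\<And>y. rsym y \<Longrightarrow> tr (mul \<kappa> (comm x y)) = 0"
  shows "comm \<kappa> x = 0"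
proof (rule ccontr)
  assume "comm \<kappa> x \<noteq> 0"
  moreover have "rsym (comm \<kappa> x)"
    using assms(1,2) by (rule rsym_comm)
  ultimately show False
    using rsym_tr_square_pos[of "comm \<kappa> x"] tr_comm_invariant[of \<kappa> x "comm \<kappa> x"] assms(3)[of "comm \<kappa> x"]
    by simp
qed

text \<open>Mixed commutators vanish as well, by \<open>skew_commutes_with_sym\<close> with trivial
  orthogonality condition, and every basis element is half a symmetric plus half a skew one.\<close>

lemma commutative_if_sym_commute:
  assumes sym: "\<And>x y. rsym x \<Longrightarrow> rsym y \<Longrightarrow> comm x y = 0"
    and skew: "\<And>x y. rskew x \<Longrightarrow> rskew y \<Longrightarrow> comm x y = 0"
  shows "mul x y = mul y x"
proof -
  have mixed: "comm \<kappa> x = 0" if "rskew \<kappa>" "rsym x" for \<kappa> x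
    using that sym by (intro skew_commutes_with_sym) (auto simp: mul_zero_right tr_linear)
  have double: "scl (1/2) u + scl (1/2) u = u" for u
    by (simp flip: scale_left_distrib)
  have half: "b i = scl (1/2) (b i + star (b i)) + scl (1/2) (b i - star (b i))" for i
    by (simp add: scale_right_distrib scale_right_diff_distrib double)
  have s: "rsym (b i + star (b i))" "rskew (b i - star (b i))" if "i < r" for i
    using that by (auto simp: rsym_def rskew_def star_add star_diff star_star add.commute star_basis_index
        star_index_less star_index_star_index intro!: real_elt_add real_elt_diff real_elt_basis)
  have bb: "comm (b i) (b j) = 0" if ij: "i < r" "j < r" for i j
  proof -
    have mixed': "comm x \<kappa> = 0" if "rskew \<kappa>" "rsym x" for \<kappa> x
      using mixed[OF that] comm_swap[of \<kappa> x] by simp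
    obtain s1 k1 s2 k2 where "rsym s1" "rskew k1" "b i = scl (1/2) s1 + scl (1/2) k1"
      "rsym s2" "rskew k2" "b j = scl (1/2) s2 + scl (1/2) k2"
      using half[of i] half[of j] s[OF ij(1)] s[OF ij(2)] by blast
    then show ?thesis
      by (simp add: comm_linear sym skew mixed mixed')
  qed
  have "comm x y = comm (\<Sum>i<r. scl (coeff_of x i) (b i)) (\<Sum>i<r. scl (coeff_of y i) (b i))"
    by (simp add: basis_expansion)
  also have "\<dots> = (\<Sum>i<r. scl (coeff_of y i) (\<Sum>j<r. scl (coeff_of x j) (comm (b j) (b i))))"
  proof -
    have 1: "comm (sum f I) y = (\<Sum>i\<in>I. comm (f i) y)" "comm y (sum f I) = (\<Sum>i\<in>I. comm y (f i))"
      for f :: "nat \<Rightarrow> 'a" and I y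
      by (auto simp: comm_def mul_sum_left mul_sum_right sum_subtractf)
    show ?thesis
      by (simp add: 1 comm_linear)
  qed
  also have "\<dots> = 0"
    by (auto intro!: sum.neutral simp: bb)
  finally show ?thesis
    by (simp add: comm_def)
qed

end

section \<open>The number of swapped pairs\<close>

lemma sum_lessThan_6: "(\<Sum>i<6. f i) = f 0 + f 1 + f 2 + f 3 + f 4 + (f (5::nat) :: 'a::comm_monoid_add)"
  by (simp add: eval_nat_numeral)

lemma less_6_cases:
  "i < (6::nat) \<Longrightarrow> (i = 0 \<Longrightarrow> P) \<Longrightarrow> (i = 1 \<Longrightarrow> P) \<Longrightarrow> (i = 2 \<Longrightarrow> P) \<Longrightarrow> (i = 3 \<Longrightarrow> P) \<Longrightarrow> (i = 4 \<Longrightarrow> P)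
    \<Longrightarrow> (i = 5 \<Longrightarrow> P) \<Longrightarrow> P"
  by linarith

context standard_rba
begin

lemma coeff_star_index_rsym: "rsym x \<Longrightarrow> k < r \<Longrightarrow> coeff_of x (star_index k) = coeff_of x k"
  and coeff_star_index_rskew: "rskew x \<Longrightarrow> k < r \<Longrightarrow> coeff_of x (star_index k) = - coeff_of x k"
  using coeff_star[of k x] star_index_less[of k]
  by (auto simp: rsym_def rskew_def real_elt_def coeff_minus Reals_cnj_iff)

lemma coeff_ident: "k < r \<Longrightarrow> coeff_of ident k = of_bool (k = 0)"
  using coeff_basis[of 0 k] rank_pos by (auto simp: b_0)

lemma coeff_real: "rsym x \<or> rskew x \<Longrightarrow> k < r \<Longrightarrow> complex_of_real (Re (coeff_of x k)) = coeff_of x k"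
  by (auto simp: rsym_def rskew_def real_elt_def)

lemmas coeff_linear = coeff_add coeff_diff coeff_minus coeff_scl coeff_zero

lemma degree_rskew: "rskew x \<Longrightarrow> \<delta> x = 0"
  using degree_star[of x] real_elt_degree[of x]
  by (auto simp: rskew_def degree_minus Reals_cnj_iff)

end

locale noncomm_rba6 = standard_rba scl mul ident star b 6 \<delta>
  for scl :: "complex \<Rightarrow> 'a::ab_group_add \<Rightarrow> 'a" and mul ident star b \<delta> +
  assumes noncommutative: "\<exists>x y. mul x y \<noteq> mul y x"
begin

lemma exists_noncommuting:
  assumes "\<And>x y. rskew x \<Longrightarrow> rskew y \<Longrightarrow> comm x y = 0"
  obtains x y where "rsym x" "rsym y" "comm x y \<noteq> 0"
  using noncommutative commutative_if_sym_commute[OF _ assms] by blast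

text \<open>Without a swapped pair, 0 is the only skew element, so commutators of symmetric elements
  vanish.\<close>

lemma star_index_not_trivial: "\<exists>i<6. star_index i \<noteq> i"
proof (rule ccontr)
  assume "\<not> ?thesis"
  then have *: "star_index i = i" if "i < 6" for i
    using that by auto
  have "x = 0" if "rskew x" for x
    using coeff_star_index_rskew[OF that] by (intro eq_by_coeff) (auto simp: * coeff_zero)
  then have "comm x y = 0" if "rsym x" "rsym y" for x y
    using that rskew_comm_sym by blast
  moreover have "comm x y = 0" if "rskew x" "rskew y" for x y
    using that rskew_comm_skew \<open>\<And>x. rskew x \<Longrightarrow> x = 0\<close> by blast
  ultimately show False
    using exists_noncommuting by blast
qed

end

text \<open>With two swapped pairs the skew part is a plane. It contains a central \<open>\<kappa>\<close>
  whose square is a negative multiple of \<open>ident - e\<close>, so multiplication by \<open>\<kappa>\<close>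
  would embed the three-dimensional symmetric part of \<open>(ident - e) A\<close> into that plane.\<close>

lemma (in noncomm_rba6) not_two_swapped_pairs:
  assumes "star_index 1 = 1" "star_index 2 = 3" "star_index 4 = 5"
  shows False
proof -
  have si: "star_index 3 = 2" "star_index 5 = 4"
    using star_index_star_index[of 2] star_index_star_index[of 4] assms by auto
  note si = si assms star_index_0
  define k1 where "k1 = b 2 - b 3"
  define k2 where "k2 = b 4 - b 5"
  define s1 where "s1 = b 2 + b 3"
  define s2 where "s2 = b 4 + b 5"
  note defs = k1_def k2_def s1_def s2_def
  have K: "rskew k1" "rskew k2" and S: "rsym s1" "rsym s2"
    unfolding rskew_def rsym_def defs
    by (auto intro!: real_elt_diff real_elt_add real_elt_basis simp: star_diff star_add star_basis_index si)
  have skew_form: "x = scl (complex_of_real (Re (coeff_of x 2))) k1 + scl (complex_of_real (Re (coeff_of x 4))) k2"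
    if "rskew x" for x
  proof (rule eq_by_coeff)
    fix k :: nat
    assume "k < 6"
    then show "coeff_of x k = coeff_of (scl (complex_of_real (Re (coeff_of x 2))) k1
        + scl (complex_of_real (Re (coeff_of x 4))) k2) k"
      using coeff_star_index_rskew[OF that, of 0] coeff_star_index_rskew[OF that, of 1]
        coeff_star_index_rskew[OF that, of 2] coeff_star_index_rskew[OF that, of 4]
      by (elim less_6_cases) (auto simp: si defs coeff_linear coeff_basis coeff_real that simp del: One_nat_def)
  qed
  \<comment> \<open>With \<open>e\<close> in place of \<open>b 1\<close>, two of the four spanning
    elements are central, so only \<open>s1\<close> and \<open>s2\<close> contribute to
    commutators.\<close>
  have sym_form: "\<exists>\<alpha> \<beta> c d. x = scl (complex_of_real \<alpha>) ident + scl (complex_of_real \<beta>) e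
      + scl (complex_of_real c) s1 + scl (complex_of_real d) s2" if "rsym x" for x
  proof -
    let ?c = "\<lambda>k. Re (coeff_of x k)"
    have "x = scl (complex_of_real (?c 0 - ?c 1)) ident + scl (complex_of_real (order * ?c 1)) e
      + scl (complex_of_real (?c 2 - ?c 1)) s1 + scl (complex_of_real (?c 4 - ?c 1)) s2"
    proof (rule eq_by_coeff)
      fix k :: nat
      assume "k < 6"
      then show "coeff_of x k = coeff_of (scl (complex_of_real (?c 0 - ?c 1)) ident
          + scl (complex_of_real (order * ?c 1)) e
          + scl (complex_of_real (?c 2 - ?c 1)) s1 + scl (complex_of_real (?c 4 - ?c 1)) s2) k"
        using coeff_star_index_rsym[OF that, of 2] coeff_star_index_rsym[OF that, of 4] order_pos
        by (elim less_6_cases) (auto simp: si defs coeff_linear coeff_basis coeff_e coeff_ident coeff_real that)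
    qed
    then show ?thesis by blast
  qed
  define k0 where "k0 = comm s1 s2"
  have k0: "rskew k0"
    unfolding k0_def using S by (intro rskew_comm_sym)
  have k0': "comm s2 s1 = - k0"
    unfolding k0_def by (rule comm_swap)
  have comm_S: "\<exists>c. comm x y = scl c k0" if "rsym x" "rsym y" for x y
  proof -
    from sym_form[OF that(1)] obtain \<alpha> \<beta> c d where
      x: "x = scl (complex_of_real \<alpha>) ident + scl (complex_of_real \<beta>) e
        + scl (complex_of_real c) s1 + scl (complex_of_real d) s2" by blast
    from sym_form[OF that(2)] obtain \<alpha>' \<beta>' c' d' where
      y: "y = scl (complex_of_real \<alpha>') ident + scl (complex_of_real \<beta>') e
        + scl (complex_of_real c') s1 + scl (complex_of_real d') s2" by blast
    have "comm x y = scl (complex_of_real (c * d' - d * c')) k0"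
      unfolding x y comm_linear k0' k0_def[symmetric]
      by (simp add: scale_left_diff_distrib mult.commute)
    then show ?thesis by blast
  qed
  \<comment> \<open>Invariance of the trace form makes this commutator orthogonal to
    \<open>k1\<close> and \<open>k2\<close>. It lies in their plane, so it is orthogonal to
    itself.\<close>
  have "comm k1 k2 = 0"
  proof (rule ccontr)
    let ?c = "comm k1 k2"
    assume "?c \<noteq> 0"
    moreover have c: "rskew ?c"
      using K by (intro rskew_comm_skew)
    moreover have "tr (mul ?c k2) = 0"
      by (simp add: tr_comm_invariant comm_linear mul_zero_right tr_linear)
    moreover have "tr (mul ?c k1) = 0"
      using tr_comm_invariant[of k2 k1 k1] comm_swap[of k1 k2]
      by (simp add: comm_linear mul_zero_right mul_minus_left tr_linear)
    moreover have "tr (mul ?c ?c) = tr (mul ?c (scl (complex_of_real (Re (coeff_of ?c 2))) k1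
        + scl (complex_of_real (Re (coeff_of ?c 4))) k2))"
      using skew_form[OF c] by simp
    ultimately show False
      using rskew_tr_square_neg[of ?c] by (simp add: mul_linear tr_linear)
  qed
  then have "comm k2 k1 = 0"
    using comm_swap[of k1 k2] by simp
  have comm_K: "comm x y = 0" if "rskew x" "rskew y" for x y
    by (subst skew_form[OF that(1)], subst skew_form[OF that(2)])
      (simp add: comm_linear \<open>comm k1 k2 = 0\<close> \<open>comm k2 k1 = 0\<close>)
  have "k0 \<noteq> 0"
    using comm_S exists_noncommuting comm_K by (metis scale_zero_right)
  define \<alpha> where "\<alpha> = Re (tr (mul k1 k0))"
  define \<beta> where "\<beta> = Re (tr (mul k2 k0))"
  have \<alpha>: "tr (mul k1 k0) = complex_of_real \<alpha>" and \<beta>: "tr (mul k2 k0) = complex_of_real \<beta>"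
    unfolding \<alpha>_def \<beta>_def using K k0 by (auto simp: rskew_def intro!: real_elt_tr real_elt_mul of_real_Re[symmetric])
  \<comment> \<open>The direction of the skew plane orthogonal to \<open>k0\<close>, hence to all
    commutators of symmetric elements.\<close>
  define \<kappa> where "\<kappa> = scl (complex_of_real \<beta>) k1 - scl (complex_of_real \<alpha>) k2"
  have \<kappa>: "rskew \<kappa>"
    unfolding \<kappa>_def using K by (intro rskew_diff rskew_scl)
  have ab: "\<alpha>\<^sup>2 + \<beta>\<^sup>2 \<noteq> 0"
  proof
    assume "\<alpha>\<^sup>2 + \<beta>\<^sup>2 = 0"
    then have "\<alpha> = 0" "\<beta> = 0"
      by (auto simp: sum_power2_eq_zero_iff)
    moreover have "tr (mul k0 k0) = tr (mul (scl (complex_of_real (Re (coeff_of k0 2))) k1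
        + scl (complex_of_real (Re (coeff_of k0 4))) k2) k0)"
      using skew_form[OF k0] by simp
    ultimately have "tr (mul k0 k0) = 0"
      by (simp add: mul_linear tr_linear \<alpha> \<beta>)
    then show False
      using rskew_tr_square_neg[OF k0 \<open>k0 \<noteq> 0\<close>] by simp
  qed
  have "\<kappa> \<noteq> 0"
  proof
    assume "\<kappa> = 0"
    then have "coeff_of \<kappa> 2 = 0" "coeff_of \<kappa> 4 = 0"
      by (simp_all add: coeff_zero)
    then show False
      using ab by (simp add: \<kappa>_def defs coeff_linear coeff_basis)
  qed
  have \<kappa>_S: "comm \<kappa> x = 0" if "rsym x" for x
  proof (rule skew_commutes_with_sym[OF \<kappa> that])
    fix y
    assume "rsym y"
    with comm_S[OF that] obtain c where "comm x y = scl c k0"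
      by blast
    then show "tr (mul \<kappa> (comm x y)) = 0"
      by (simp add: \<kappa>_def mul_linear tr_linear \<alpha> \<beta>)
  qed
  have S_\<kappa>: "comm x \<kappa> = 0" if "rsym x" for x
    using \<kappa>_S[OF that] comm_swap[of \<kappa> x] by simp
  \<comment> \<open>The square is symmetric and commutes with \<open>s1\<close> and
    \<open>s2\<close>, so it lies in the span of \<open>ident\<close> and \<open>e\<close>. As
    \<open>\<delta>\<close> vanishes on skew elements, only a multiple of \<open>ident - e\<close>
    remains.\<close>
  obtain \<gamma> where \<gamma>: "mul \<kappa> \<kappa> = scl (complex_of_real \<gamma>) (ident - e)" "\<gamma> \<noteq> 0"
  proof -
    obtain a0 a1 c d where sq: "mul \<kappa> \<kappa> = scl (complex_of_real a0) ident + scl (complex_of_real a1) e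
        + scl (complex_of_real c) s1 + scl (complex_of_real d) s2"
      using sym_form rsym_square \<kappa> by blast
    have "comm s1 (mul \<kappa> \<kappa>) = scl (complex_of_real d) k0" "comm s2 (mul \<kappa> \<kappa>) = - scl (complex_of_real c) k0"
      unfolding sq by (simp_all add: comm_linear k0' flip: k0_def)
    moreover have "comm x (mul \<kappa> \<kappa>) = 0" if "rsym x" for x
      by (simp add: comm_leibniz S_\<kappa>[OF that] mul_linear)
    ultimately have cd: "c = 0" "d = 0"
      using S \<open>k0 \<noteq> 0\<close> by (auto simp: scale_eq_0_iff)
    have "\<delta> (mul \<kappa> \<kappa>) = complex_of_real (a0 + a1)"
      unfolding sq by (simp add: cd degree_linear degree_e)
    then have "a1 = - a0"
      using degree_rskew[OF \<kappa>] by (simp add: degree_linear flip: of_real_add)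
    then have "mul \<kappa> \<kappa> = scl (complex_of_real a0) (ident - e)"
      using sq by (simp add: cd scale_right_diff_distrib)
    moreover have "a0 \<noteq> 0"
      using rskew_tr_square_neg[OF \<kappa> \<open>\<kappa> \<noteq> 0\<close>] calculation by (auto simp: tr_linear)
    ultimately show ?thesis
      using that by blast
  qed
  \<comment> \<open>The functional on the skew plane whose kernel is the line of
    \<open>\<kappa>\<close>.\<close>
  define L where "L x = \<alpha> * Re (coeff_of x 2) + \<beta> * Re (coeff_of x 4)" for x
  have kill: "\<exists>c. x = scl (complex_of_real c) \<kappa>" if "rskew x" "L x = 0" for x
  proof -
    let ?c = "Re (coeff_of x 2)" and ?d = "Re (coeff_of x 4)"
    define t where "t = (?c * \<beta> - ?d * \<alpha>) / (\<alpha>\<^sup>2 + \<beta>\<^sup>2)"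
    have "(\<alpha>\<^sup>2 + \<beta>\<^sup>2) * ?c = (?c * \<beta> - ?d * \<alpha>) * \<beta> + \<alpha> * L x"
      "(\<alpha>\<^sup>2 + \<beta>\<^sup>2) * ?d = - (?c * \<beta> - ?d * \<alpha>) * \<alpha> + \<beta> * L x"
      by (auto simp: L_def power2_eq_square algebra_simps)
    then have cd: "?c = t * \<beta>" "?d = - t * \<alpha>"
      unfolding t_def using ab that(2) by (auto simp: field_simps)
    have "x = scl (complex_of_real (t * \<beta>)) k1 + scl (complex_of_real (- t * \<alpha>)) k2"
      using skew_form[OF that(1)] unfolding cd .
    then have "x = scl (complex_of_real t) \<kappa>"
      by (simp add: \<kappa>_def scale_right_diff_distrib)
    then show ?thesis by blast
  qed
  have \<kappa>s: "rskew (mul \<kappa> s1)" "rskew (mul \<kappa> s2)"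
    using \<kappa> S \<kappa>_S by (auto intro!: rskew_mul_commuting)
  \<comment> \<open>One linear equation in two unknowns: some nonzero combination \<open>u\<close>
    of \<open>s1\<close> and \<open>s2\<close> is mapped by \<open>\<kappa>\<close> into the line of
    \<open>\<kappa>\<close>.\<close>
  obtain m1 m2 :: real where m: "m1 * L (mul \<kappa> s1) + m2 * L (mul \<kappa> s2) = 0" "m1 \<noteq> 0 \<or> m2 \<noteq> 0"
  proof (cases "L (mul \<kappa> s1) = 0")
    case True
    then show ?thesis using that[of 1 0] by simp
  next
    case False
    then show ?thesis using that[of "- L (mul \<kappa> s2)" "L (mul \<kappa> s1)"] by simp
  qed
  define u where "u = scl (complex_of_real m1) s1 + scl (complex_of_real m2) s2"
  have "L (mul \<kappa> u) = m1 * L (mul \<kappa> s1) + m2 * L (mul \<kappa> s2)"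
    by (simp add: u_def L_def mul_linear coeff_linear algebra_simps)
  moreover have "rskew (mul \<kappa> u)"
    using \<kappa>s by (simp add: u_def mul_linear rskew_add rskew_scl)
  ultimately obtain c where c: "mul \<kappa> u = scl (complex_of_real c) \<kappa>"
    using kill m(1) by metis
  define y where "y = u - scl (complex_of_real c) ident"
  \<comment> \<open>Dividing by \<open>\<gamma>\<close> leaves \<open>y\<close> a multiple of
    \<open>e\<close>. All coefficients of \<open>e\<close> are equal, whereas that of
    \<open>y\<close> at \<open>b 1\<close> is 0, so \<open>y\<close> vanishes.\<close>
  have "mul (mul \<kappa> \<kappa>) y = 0"
    by (simp add: mul_assoc y_def mul_linear c)
  then have "y - scl (\<delta> y) e = 0"
    using \<gamma> by (simp add: mul_linear mul_e scale_eq_0_iff)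
  then have *: "coeff_of (y - scl (\<delta> y) e) k = 0" for k
    by (simp add: coeff_zero)
  have "\<delta> y = 0"
    using *[of 1] order_pos by (simp add: y_def u_def defs coeff_linear coeff_basis coeff_e coeff_ident)
  then have "m1 = 0" "m2 = 0"
    using *[of 2] *[of 4] by (simp_all add: y_def u_def defs coeff_linear coeff_basis coeff_e coeff_ident)
  then show False
    using m(2) by simp
qed

section \<open>The centre\<close>

locale labelled_rba6 = noncomm_rba6 +
  assumes labelled: "labelled star b"
begin

lemmas star_index_labelled = star_index_of_labelled[OF labelled order_refl]

definition k :: 'a where
  "k = b 4 - b 5"

lemma rskew_k: "rskew k"
  unfolding rskew_def k_def
  by (auto intro!: real_elt_diff real_elt_basis simp: star_diff star_basis_index star_index_labelled)

lemma k_nonzero: "k \<noteq> 0"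
proof
  assume "k = 0"
  then have "coeff_of k 4 = 0"
    by (simp add: coeff_zero)
  then show False
    by (simp add: k_def coeff_linear coeff_basis)
qed

lemma rsym_basis: "i \<in> {1..3} \<Longrightarrow> rsym (b i)"
  using labelled by (auto simp: rsym_def labelled_def intro!: real_elt_basis)

lemma rskew_form:
  assumes "rskew x"
  obtains c :: real where "x = scl (complex_of_real c) k"
proof
  show "x = scl (complex_of_real (Re (coeff_of x 4))) k"
  proof (rule eq_by_coeff)
    fix i :: nat
    assume "i < 6"
    then show "coeff_of x i = coeff_of (scl (complex_of_real (Re (coeff_of x 4))) k) i"
      using coeff_star_index_rskew[OF assms, of 0] coeff_star_index_rskew[OF assms, of 1]
        coeff_star_index_rskew[OF assms, of 2] coeff_star_index_rskew[OF assms, of 3]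
        coeff_star_index_rskew[OF assms, of 4]
      by (elim less_6_cases)
        (auto simp: star_index_labelled k_def coeff_linear coeff_basis coeff_real assms simp del: One_nat_def)
  qed
qed

text \<open>Here \<open>e\<close> takes the place of \<open>b 4 + b 5\<close>. As
  \<open>ident\<close> and \<open>e\<close> are central, commutators see only the three remaining
  coefficients.\<close>

lemma rsym_form:
  assumes "rsym x"
  obtains \<alpha> \<beta> c1 c2 c3 :: real where "x = scl (complex_of_real \<alpha>) ident + scl (complex_of_real \<beta>) e
      + scl (complex_of_real c1) (b 1) + scl (complex_of_real c2) (b 2) + scl (complex_of_real c3) (b 3)"
proof
  let ?c = "\<lambda>i. Re (coeff_of x i)"
  show "x = scl (complex_of_real (?c 0 - ?c 4)) ident + scl (complex_of_real (order * ?c 4)) e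
      + scl (complex_of_real (?c 1 - ?c 4)) (b 1) + scl (complex_of_real (?c 2 - ?c 4)) (b 2)
      + scl (complex_of_real (?c 3 - ?c 4)) (b 3)" (is "x = ?y")
  proof (rule eq_by_coeff)
    fix i :: nat
    assume "i < 6"
    then show "coeff_of x i = coeff_of ?y i"
      using coeff_star_index_rsym[OF assms, of 4] order_pos
      by (elim less_6_cases)
        (auto simp: star_index_labelled coeff_linear coeff_basis coeff_e coeff_ident coeff_real assms)
  qed
qed

text \<open>Symmetric elements are real by definition; over the complex numbers they span the whole
  algebra together with \<open>k\<close>. This carries linear statements from the real parts to
  arbitrary elements.\<close>

lemma rsym_k_induct:
  assumes sym: "\<And>x. rsym x \<Longrightarrow> P x" and k: "P k"
    and add: "\<And>x y. P x \<Longrightarrow> P y \<Longrightarrow> P (x + y)" and scl: "\<And>c x. P x \<Longrightarrow> P (scl c x)"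
  shows "P x"
proof -
  have "x = scl (coeff_of x 0) ident + scl (coeff_of x 1) (b 1) + scl (coeff_of x 2) (b 2)
      + scl (coeff_of x 3) (b 3) + scl ((coeff_of x 4 + coeff_of x 5) / 2) (b 4 + b 5)
      + scl ((coeff_of x 4 - coeff_of x 5) / 2) k" (is "x = ?y")
  proof (rule eq_by_coeff)
    fix i :: nat
    assume "i < 6"
    then show "coeff_of x i = coeff_of ?y i"
      by (elim less_6_cases) (auto simp: coeff_linear coeff_basis coeff_ident k_def field_simps)
  qed
  moreover have "rsym (b 4 + b 5)"
    by (auto simp: rsym_def star_add star_basis_index star_index_labelled intro!: real_elt_add real_elt_basis)
  ultimately show ?thesis
    using sym k add scl rsym_ident rsym_basis
    by (metis atLeastAtMost_iff numeral_le_iff one_le_numeral order_refl semiring_norm(69) semiring_norm(72))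
qed

lemma comm_skew: "rskew x \<Longrightarrow> rskew y \<Longrightarrow> comm x y = 0"
  using rskew_form[of x] rskew_form[of y] by (metis comm_linear(7,8,13) scale_zero_right)

text \<open>The identity of the complementary ideal of \<open>e\<close>, which is the kernel of
  \<open>\<delta>\<close>.\<close>

definition h :: 'a where
  "h = ident - e"

lemma h: "rsym h" "mul h h = h" "mul h x = x - scl (\<delta> x) e" "mul x h = x - scl (\<delta> x) e"
    "comm x h = 0" "comm h x = 0"
  by (auto simp: h_def rsym_diff rsym_ident rsym_e mul_linear mul_e e_idem comm_linear degree_e degree_minus degree_linear)

lemma degree_h: "\<delta> h = 0"
  by (simp add: h_def degree_minus degree_linear degree_e)

text \<open>The \<open>w12, w13, w23\<close> below are an alternating form of rank two on the span of \<open>b 1, b 2, b 3\<close>;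
  its kernel yields a third central direction besides \<open>ident\<close> and \<open>e\<close>.\<close>

lemma exists_central_sym:
  obtains z where "rsym z" "\<And>x. rsym x \<Longrightarrow> comm x z = 0" "\<And>\<alpha> \<beta>. z \<noteq> scl \<alpha> ident + scl \<beta> e"
    "\<And>x. rsym x \<Longrightarrow> (\<And>i. i \<in> {1..3} \<Longrightarrow> comm (b i) x = 0) \<Longrightarrow>
      \<exists>\<alpha> \<beta> \<gamma>. x = scl (complex_of_real \<alpha>) ident + scl (complex_of_real \<beta>) e + scl (complex_of_real \<gamma>) z"
proof -
  have "rskew (comm (b 1) (b 2))" "rskew (comm (b 1) (b 3))" "rskew (comm (b 2) (b 3))"
    by (auto intro!: rskew_comm_sym rsym_basis)
  then obtain w12 w13 w23 where w: "comm (b 1) (b 2) = scl (complex_of_real w12) k"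
    "comm (b 1) (b 3) = scl (complex_of_real w13) k" "comm (b 2) (b 3) = scl (complex_of_real w23) k"
    by (metis rskew_form)
  have w': "comm (b 2) (b 1) = - scl (complex_of_real w12) k"
    "comm (b 3) (b 1) = - scl (complex_of_real w13) k" "comm (b 3) (b 2) = - scl (complex_of_real w23) k"
    unfolding w[symmetric] by (rule comm_swap)+
  note w = w w'
  \<comment> \<open>The three values of the form are the coordinates of its kernel vector up to
    sign, as for a cross product.\<close>
  define z where "z = scl (complex_of_real w23) (b 1) - scl (complex_of_real w13) (b 2)
    + scl (complex_of_real w12) (b 3)"
  have zb: "comm (b 1) z = 0" "comm (b 2) z = 0" "comm (b 3) z = 0"
    by (simp_all add: z_def comm_linear w mult.commute del: One_nat_def)
  have "rsym z"
    unfolding z_def by (intro rsym_add rsym_diff rsym_scl rsym_basis) auto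
  moreover have "comm x z = 0" if "rsym x" for x
    by (rule rsym_form[OF that]) (simp add: comm_linear zb del: One_nat_def)
  moreover have w0: "w12\<^sup>2 + w13\<^sup>2 + w23\<^sup>2 \<noteq> 0"
  proof
    assume "w12\<^sup>2 + w13\<^sup>2 + w23\<^sup>2 = 0"
    then have "w12 = 0" "w13 = 0" "w23 = 0"
      by (auto simp: add_nonneg_eq_0_iff)
    then have "comm x y = 0" if "rsym x" "rsym y" for x y
      by (rule_tac rsym_form[OF that(1)], rule_tac rsym_form[OF that(2)]) (simp add: comm_linear w del: One_nat_def)
    then show False
      using exists_noncommuting comm_skew by metis
  qed
  moreover have "z \<noteq> scl \<alpha> ident + scl \<beta> e" for \<alpha> \<beta>
  proof
    assume z: "z = scl \<alpha> ident + scl \<beta> e"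
    have *: "coeff_of z i = coeff_of (scl \<alpha> ident + scl \<beta> e) i" for i
      using z by simp
    have "\<beta> = 0"
      using *[of 4] order_pos by (simp add: z_def coeff_linear coeff_basis coeff_ident coeff_e)
    then show False
      using *[of 1] *[of 2] *[of 3] w0 by (simp add: z_def coeff_linear coeff_basis coeff_ident)
  qed
  moreover have "\<exists>\<alpha> \<beta> \<gamma>. x = scl (complex_of_real \<alpha>) ident + scl (complex_of_real \<beta>) e + scl (complex_of_real \<gamma>) z"
    if x: "rsym x" and c: "\<And>i. i \<in> {1..3} \<Longrightarrow> comm (b i) x = 0" for x
  proof -
    from x obtain \<alpha> \<beta> c1 c2 c3 where xf: "x = scl (complex_of_real \<alpha>) ident + scl (complex_of_real \<beta>) e
      + scl (complex_of_real c1) (b 1) + scl (complex_of_real c2) (b 2) + scl (complex_of_real c3) (b 3)"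
      by (rule rsym_form)
    have "comm (b 1) x = scl (complex_of_real (c2 * w12 + c3 * w13)) k"
      "comm (b 2) x = scl (complex_of_real (c3 * w23 - c1 * w12)) k"
      "comm (b 3) x = scl (complex_of_real (- c1 * w13 - c2 * w23)) k"
      unfolding xf by (simp_all add: comm_linear w scale_left_distrib scale_left_diff_distrib del: One_nat_def)
    then have "scl (complex_of_real (c2 * w12 + c3 * w13)) k = 0"
      "scl (complex_of_real (c3 * w23 - c1 * w12)) k = 0"
      "scl (complex_of_real (- c1 * w13 - c2 * w23)) k = 0"
      using c[of 1] c[of 2] c[of 3] by simp_all
    then have cw: "c2 * w12 + c3 * w13 = 0" "c3 * w23 - c1 * w12 = 0" "- c1 * w13 - c2 * w23 = 0"
      unfolding scale_eq_0_iff of_real_eq_0_iff using k_nonzero by blast+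
    \<comment> \<open>The coefficient of the orthogonal projection of \<open>(c1, c2, c3)\<close> to
      the direction of \<open>z\<close>. The identities below express the triple by this projection
      and the three expressions that vanish by \<open>cw\<close>.\<close>
    define \<gamma> where "\<gamma> = (c1 * w23 - c2 * w13 + c3 * w12) / (w12\<^sup>2 + w13\<^sup>2 + w23\<^sup>2)"
    let ?N = "w12\<^sup>2 + w13\<^sup>2 + w23\<^sup>2" and ?L = "c1 * w23 - c2 * w13 + c3 * w12"
    have "c1 * ?N = ?L * w23 - w12 * (c3 * w23 - c1 * w12) - w13 * (- c1 * w13 - c2 * w23)"
      "c2 * ?N = - ?L * w13 + w12 * (c2 * w12 + c3 * w13) - w23 * (- c1 * w13 - c2 * w23)"
      "c3 * ?N = ?L * w12 + w13 * (c2 * w12 + c3 * w13) + w23 * (c3 * w23 - c1 * w12)"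
      by (simp_all add: algebra_simps power2_eq_square)
    then have "c1 * ?N = ?L * w23" "c2 * ?N = - ?L * w13" "c3 * ?N = ?L * w12"
      unfolding cw by simp_all
    then have "c1 = \<gamma> * w23" "c2 = - \<gamma> * w13" "c3 = \<gamma> * w12"
      unfolding \<gamma>_def using w0 by (metis nonzero_mult_div_cancel_right times_divide_eq_left mult_minus_left minus_divide_left)+
    then have "x = scl (complex_of_real \<alpha>) ident + scl (complex_of_real \<beta>) e + scl (complex_of_real \<gamma>) z"
      unfolding xf z_def by (simp add: scale_right_distrib scale_right_diff_distrib)
    then show ?thesis by blast
  qed
  ultimately show ?thesis
    using that by blast
qed

text \<open>The element \<open>y\<close> is to be 1 on the second linear summand and -1 on the
  matrix summand. It arises from the central element \<open>z\<close> by removing the degree,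
  completing the square and rescaling. The sign is fixed by its action on \<open>k\<close>, which
  lies in the matrix summand.\<close>

lemma exists_central_involution:
  obtains y where "rsym y" "\<And>x. comm x y = 0" "mul y y = h" "mul y k = - k" "\<delta> y = 0" "y \<noteq> - h"
    "\<And>x. rsym x \<Longrightarrow> (\<And>i. i \<in> {1..3} \<Longrightarrow> comm (b i) x = 0) \<Longrightarrow>
      \<exists>\<alpha> \<beta> \<gamma>. x = scl \<alpha> ident + scl \<beta> e + scl \<gamma> y"
proof -
  obtain z where z: "rsym z" "\<And>x. rsym x \<Longrightarrow> comm x z = 0" "\<And>\<alpha> \<beta>. z \<noteq> scl \<alpha> ident + scl \<beta> e"
    "\<And>x. rsym x \<Longrightarrow> (\<And>i. i \<in> {1..3} \<Longrightarrow> comm (b i) x = 0) \<Longrightarrow>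
      \<exists>\<alpha> \<beta> \<gamma>. x = scl (complex_of_real \<alpha>) ident + scl (complex_of_real \<beta>) e + scl (complex_of_real \<gamma>) z"
    using exists_central_sym by blast
  define d where "d = Re (\<delta> z)"
  have d: "\<delta> z = complex_of_real d"
    unfolding d_def using real_elt_degree[of z] z(1) by (auto simp: rsym_def)
  define y0 where "y0 = z - scl (complex_of_real d) e"
  have y0: "rsym y0" "\<And>x. rsym x \<Longrightarrow> comm x y0 = 0" "\<delta> y0 = 0"
    unfolding y0_def using z by (auto intro!: rsym_diff rsym_scl rsym_e
        simp: comm_linear d degree_minus degree_linear degree_e)
  have "rsym (mul y0 y0)"
    using y0 by (auto intro!: rsym_square)
  moreover have "comm x (mul y0 y0) = 0" if "rsym x" for x
    by (simp add: comm_leibniz y0 that mul_linear)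
  ultimately obtain \<alpha> \<beta> \<gamma> where sq: "mul y0 y0 = scl (complex_of_real \<alpha>) ident
      + scl (complex_of_real \<beta>) e + scl (complex_of_real \<gamma>) z"
    using z(4)[of "mul y0 y0"] rsym_basis by auto
  \<comment> \<open>Degree 0 forces the parts along \<open>ident\<close>, \<open>e\<close> and
    \<open>z\<close> to combine to multiples of \<open>h\<close> and \<open>y0\<close>.\<close>
  have "\<delta> (mul y0 y0) = complex_of_real (\<alpha> + \<beta> + \<gamma> * d)"
    unfolding sq by (simp add: degree_linear degree_e d)
  then have \<beta>: "\<beta> = - \<alpha> - \<gamma> * d"
    using y0(3) by (simp add: degree_linear flip: of_real_add of_real_mult)
  have sq: "mul y0 y0 = scl (complex_of_real \<alpha>) h + scl (complex_of_real \<gamma>) y0"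
  proof -
    have "scl (complex_of_real \<alpha>) ident + scl (complex_of_real \<beta>) e + scl (complex_of_real \<gamma>) z
        = scl (complex_of_real \<alpha>) h + scl (complex_of_real \<gamma>) y0"
      unfolding h_def y0_def \<beta> by (simp add: scale_right_diff_distrib scale_left_diff_distrib)
    then show ?thesis
      using sq by simp
  qed
  \<comment> \<open>Completing the square in the quadratic equation of \<open>y0\<close> over
    \<open>h\<close>.\<close>
  define y1 where "y1 = y0 - scl (complex_of_real (\<gamma> / 2)) h"
  have y1: "rsym y1" "\<And>x. rsym x \<Longrightarrow> comm x y1 = 0" "\<delta> y1 = 0"
    unfolding y1_def using y0 h(5) degree_h
    by (auto intro!: rsym_diff y0 rsym_scl[OF h(1)]
        simp: comm_linear degree_minus degree_linear simp del: of_real_divide)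
  define \<mu> where "\<mu> = \<alpha> + \<gamma>\<^sup>2 / 4"
  have y0h: "mul y0 h = y0" "mul h y0 = y0"
    by (simp_all add: h y0)
  have sq1: "mul y1 y1 = scl (complex_of_real \<mu>) h"
    unfolding y1_def \<mu>_def
    by (simp add: mul_linear sq y0h h(2) scale_right_diff_distrib scale_left_distrib power2_eq_square)
      (simp flip: scale_left_diff_distrib)
  have y1_indep: "y1 \<noteq> scl c h" for c
  proof
    assume "y1 = scl c h"
    then have "z = scl (c + complex_of_real (\<gamma> / 2)) ident
        + scl (complex_of_real d - (c + complex_of_real (\<gamma> / 2))) e"
      unfolding y1_def y0_def h_def
      by (simp add: scale_right_diff_distrib scale_left_diff_distrib scale_left_distrib algebra_simps)
    then show False
      using z(3) by blast
  qed
  have "y1 \<noteq> 0"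
    using y1_indep[of 0] by simp
  moreover have "h \<noteq> 0"
    using sq1 rsym_tr_square_pos[OF y1(1) \<open>y1 \<noteq> 0\<close>] by (auto simp: tr_linear)
  \<comment> \<open>By \<open>sq1\<close> the first trace is \<open>\<mu>\<close> times the second
    one, so \<open>\<mu>\<close> is positive and has a real square root.\<close>
  ultimately have "0 < Re (tr (mul y1 y1))" "0 < Re (tr (mul h h))"
    using \<open>y1 \<noteq> 0\<close> y1(1) h(1) rsym_tr_square_pos by blast+
  then have "0 < \<mu>"
    by (auto simp: sq1 tr_linear h(2) zero_less_mult_iff)
  define y2 where "y2 = scl (complex_of_real (1 / sqrt \<mu>)) y1"
  have y2: "rsym y2" "\<And>x. rsym x \<Longrightarrow> comm x y2 = 0" "\<delta> y2 = 0"
    unfolding y2_def using y1 by (auto intro!: rsym_scl simp: comm_linear degree_linear simp del: of_real_divide)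
  have sq2: "mul y2 y2 = h"
    using \<open>0 < \<mu>\<close> by (simp add: y2_def mul_linear sq1 flip: of_real_mult)
  have indep2: "y2 \<noteq> scl c h" for c
  proof
    assume "y2 = scl c h"
    then have "scl (complex_of_real (sqrt \<mu>)) y2 = scl (complex_of_real (sqrt \<mu>) * c) h"
      by simp
    then have "y1 = scl (complex_of_real (sqrt \<mu>) * c) h"
      using \<open>0 < \<mu>\<close> by (simp add: y2_def flip: of_real_mult)
    then show False
      using y1_indep by blast
  qed
  have "comm k y2 = 0"
    using rskew_k y2 by (intro skew_commutes_with_sym) (auto simp: comm_swap[of _ y2] mul_linear tr_linear)
  then have y2_central: "comm x y2 = 0" for x
    by (induction x rule: rsym_k_induct) (auto simp: y2 comm_linear)
  have "rskew (mul k y2)"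
    using rskew_k y2 \<open>comm k y2 = 0\<close> by (intro rskew_mul_commuting)
  then obtain c where c: "mul k y2 = scl (complex_of_real c) k"
    by (rule rskew_form)
  have "mul (mul k y2) y2 = k"
    by (simp add: mul_assoc sq2 h degree_rskew[OF rskew_k])
  then have "scl (complex_of_real (c * c)) k = scl 1 k"
    by (simp add: c mul_linear)
  then have "complex_of_real (c * c) = 1"
    using k_nonzero by (simp only: scale_cancel_right) simp
  then have "c * c = 1"
    using of_real_eq_1_iff by blast
  then have c1: "c = 1 \<or> c = -1"
    by (simp add: square_eq_1_iff)
  \<comment> \<open>The skew part is a line, so \<open>y2\<close> acts on \<open>k\<close> by a
    scalar \<open>c\<close> with \<open>c * c = 1\<close>; the factor \<open>- c\<close> turns this
    scalar into -1.\<close>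
  define y where "y = scl (complex_of_real (- c)) y2"
  have "rsym y"
    unfolding y_def using y2 by (intro rsym_scl)
  moreover have "comm x y = 0" for x
    by (simp add: y_def comm_linear y2_central)
  moreover have "mul y y = h"
    using c1 by (auto simp: y_def mul_linear sq2)
  moreover have "mul y k = - k"
  proof -
    have "mul y2 k = scl (complex_of_real c) k"
      using \<open>comm k y2 = 0\<close> c by (simp add: comm_def)
    then show ?thesis
      by (simp add: y_def mul_linear \<open>c * c = 1\<close> flip: of_real_mult)
  qed
  moreover have "\<delta> y = 0"
    by (simp add: y_def degree_linear degree_minus y2)
  moreover have "y \<noteq> - h"
    using c1 indep2[of 1] indep2[of "- 1"] by (elim disjE) (simp_all add: y_def)
  moreover have "\<exists>\<alpha> \<beta> \<gamma>. x = scl \<alpha> ident + scl \<beta> e + scl \<gamma> y"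
    if x: "rsym x" "\<And>i. i \<in> {1..3} \<Longrightarrow> comm (b i) x = 0" for x
  proof -
    obtain \<alpha> \<beta> \<gamma>' where xz: "x = scl (complex_of_real \<alpha>) ident + scl (complex_of_real \<beta>) e
        + scl (complex_of_real \<gamma>') z"
      using z(4) x by blast
    have "y1 = scl (complex_of_real (- c * sqrt \<mu>)) y"
      using c1 \<open>0 < \<mu>\<close> by (auto simp: y_def y2_def simp flip: of_real_mult of_real_minus)
    then have "z = scl (complex_of_real (- c * sqrt \<mu>)) y + scl (complex_of_real (\<gamma> / 2)) ident
        + scl (complex_of_real (d - \<gamma> / 2)) e"
      unfolding y1_def y0_def h_def
      by (simp add: scale_right_diff_distrib scale_left_diff_distrib algebra_simps)
    then have "x = scl (complex_of_real \<alpha> + complex_of_real \<gamma>' * complex_of_real (\<gamma> / 2)) ident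
        + scl (complex_of_real \<beta> + complex_of_real \<gamma>' * complex_of_real (d - \<gamma> / 2)) e
        + scl (complex_of_real \<gamma>' * complex_of_real (- c * sqrt \<mu>)) y"
      unfolding xz by (simp only: scale_right_distrib scale_left_distrib scale_scale ac_simps)
    then show ?thesis by blast
  qed
  ultimately show ?thesis
    using that by blast
qed

end

section \<open>The splitting\<close>

no_notation vec_index (infixl "$" 100)

lemma exhaust_6: "i = 0 \<or> i = 1 \<or> i = 2 \<or> i = 3 \<or> i = 4 \<or> i = (5 :: 6)"
proof (induct i)
  case (of_int z)
  then have "z = 0 \<or> z = 1 \<or> z = 2 \<or> z = 3 \<or> z = 4 \<or> z = 5" by fastforce
  then show ?case by auto
qed

lemma UNIV_6: "(UNIV :: 6 set) = {0, 1, 2, 3, 4, 5}"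
  using exhaust_6 by auto

lemma sum_6: "sum f (UNIV :: 6 set) = f 0 + f 1 + f 2 + f 3 + f 4 + f 5"
  unfolding UNIV_6 by (simp add: ac_simps)

lemma forall_6: "(\<forall>i :: 6. P i) \<longleftrightarrow> P 0 \<and> P 1 \<and> P 2 \<and> P 3 \<and> P 4 \<and> P 5"
proof -
  have "(\<forall>i. P i) \<longleftrightarrow> (\<forall>i\<in>{0, 1, 2, 3, 4, 5}. P i)"
    unfolding UNIV_6[symmetric] by simp
  then show ?thesis by simp
qed

lemma vec6_eq_iff: "x = (y :: 'a^6) \<longleftrightarrow> x $ 0 = y $ 0 \<and> x $ 1 = y $ 1 \<and> x $ 2 = y $ 2
    \<and> x $ 3 = y $ 3 \<and> x $ 4 = y $ 4 \<and> x $ 5 = y $ 5"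
  by (simp add: Finite_Cartesian_Product.vec_eq_iff forall_6)

definition vec6 :: "'a \<Rightarrow> 'a \<Rightarrow> 'a \<Rightarrow> 'a \<Rightarrow> 'a \<Rightarrow> 'a \<Rightarrow> 'a^6" where
  "vec6 x0 x1 x2 x3 x4 x5 = (\<chi> i. if i = 0 then x0 else if i = 1 then x1 else if i = 2 then x2
     else if i = 3 then x3 else if i = 4 then x4 else x5)"

lemma vec6_nth [simp]: "vec6 x0 x1 x2 x3 x4 x5 $ 0 = x0" "vec6 x0 x1 x2 x3 x4 x5 $ 1 = x1"
  "vec6 x0 x1 x2 x3 x4 x5 $ 2 = x2" "vec6 x0 x1 x2 x3 x4 x5 $ 3 = x3"
  "vec6 x0 x1 x2 x3 x4 x5 $ 4 = x4" "vec6 x0 x1 x2 x3 x4 x5 $ 5 = x5"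
  by (simp_all add: vec6_def)

text \<open>The coordinates \<open>x $ 2, \<dots>, x $ 5\<close> stand for the matrix
  \<open>[[x $ 2 + x $ 3, x $ 4 + x $ 5], [x $ 4 - x $ 5, x $ 2 - x $ 3]]\<close>, the two others for
  one-dimensional summands. In these coordinates the trace form is diagonal.\<close>

definition split_mul :: "complex^6 \<Rightarrow> complex^6 \<Rightarrow> complex^6" where
  "split_mul x y = vec6 (x $ 0 * y $ 0) (x $ 1 * y $ 1)
     (x $ 2 * y $ 2 + x $ 3 * y $ 3 + x $ 4 * y $ 4 - x $ 5 * y $ 5)
     (x $ 2 * y $ 3 + x $ 3 * y $ 2 + x $ 5 * y $ 4 - x $ 4 * y $ 5)
     (x $ 2 * y $ 4 + x $ 4 * y $ 2 + x $ 3 * y $ 5 - x $ 5 * y $ 3)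
     (x $ 2 * y $ 5 + x $ 5 * y $ 2 + x $ 3 * y $ 4 - x $ 4 * y $ 3)"

definition split_one :: "complex^6" where
  "split_one = vec6 1 1 1 0 0 0"

text \<open>On the matrix summand this is the conjugate transpose: transposition exchanges
  \<open>x $ 4 + x $ 5\<close> and \<open>x $ 4 - x $ 5\<close>.\<close>

definition split_star :: "complex^6 \<Rightarrow> complex^6" where
  "split_star x = vec6 (cnj (x $ 0)) (cnj (x $ 1)) (cnj (x $ 2)) (cnj (x $ 3)) (cnj (x $ 4)) (- cnj (x $ 5))"

lemma complex_algebra_split: "complex_algebra (*s) split_mul split_one"
proof (unfold_locales, goal_cases)
qed (simp_all add: vec6_eq_iff split_mul_def split_one_def algebra_simps)

locale split_algebra = complex_algebra scl mul ident
  for scl :: "complex \<Rightarrow> 'a::ab_group_add \<Rightarrow> 'a" and mul ident +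
  fixes \<Psi> :: "'a \<Rightarrow> complex^6"
  assumes bij_split: "bij \<Psi>"
    and split_add: "\<Psi> (x + y) = \<Psi> x + \<Psi> y"
    and split_scl: "\<Psi> (scl c x) = c *s \<Psi> x"
    and split_mul: "\<Psi> (mul x y) = split_mul (\<Psi> x) (\<Psi> y)"
    and split_ident: "\<Psi> ident = split_one"

section \<open>An explicit basis adapted to the three summands\<close>

context labelled_rba6
begin

text \<open>The commutator is a multiple of \<open>k\<close>, and invariance of the trace form moves
  its product with \<open>k\<close> onto \<open>comm k x\<close>. As the square of \<open>k\<close>
  has nonzero trace, the multiple is 0.\<close>

lemma commutes_if_commutes_k:
  assumes "rsym x" "rsym y" "comm k x = 0"
  shows "comm y x = 0"
proof -
  obtain c where c: "comm y x = scl (complex_of_real c) k"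
    using rskew_form[OF rskew_comm_sym[OF assms(2,1)]] by blast
  have "tr (mul k (comm y x)) = tr (mul (comm k y) x)"
    by (simp add: tr_comm_invariant)
  also have "\<dots> = - tr (mul (comm y k) x)"
    by (simp add: comm_swap[of y k] mul_linear tr_linear)
  also have "\<dots> = 0"
    by (simp add: tr_comm_invariant assms mul_linear tr_linear)
  finally have "c = 0"
    using rskew_tr_square_neg[OF rskew_k k_nonzero] by (auto simp: c mul_linear tr_linear)
  then show ?thesis
    by (simp add: c)
qed

text \<open>Preimages of the six unit vectors are constructed. The units of the two linear summands
  are \<open>e\<close> and \<open>f\<close>; \<open>g\<close>, \<open>v\<close>, \<open>w\<close>,
  \<open>j\<close> correspond to the matrices \<open>[[1, 0], [0, 1]]\<close>,
  \<open>[[1, 0], [0, -1]]\<close>, \<open>[[0, 1], [1, 0]]\<close>,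
  \<open>[[0, 1], [-1, 0]]\<close>.\<close>

theorem exists_split:
  obtains \<Psi> m\<^sub>\<phi> m\<^sub>\<chi> where "split_algebra scl mul ident \<Psi>" "\<And>x. \<Psi> (star x) = split_star (\<Psi> x)"
    "\<And>x. \<Psi> x $ 0 = \<delta> x" "\<And>i a. i < 6 \<Longrightarrow> \<Psi> (b i) $ a \<in> \<real>" "0 < m\<^sub>\<phi>" "0 < m\<^sub>\<chi>"
    "\<And>x. complex_of_real order * tr x = \<Psi> x $ 0 + complex_of_real m\<^sub>\<phi> * \<Psi> x $ 1
       + 2 * complex_of_real m\<^sub>\<chi> * \<Psi> x $ 2"
proof -
  obtain y where y: "rsym y" "\<And>x. comm x y = 0" "mul y y = h" "mul y k = - k" "\<delta> y = 0" "y \<noteq> - h"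
    "\<And>x. rsym x \<Longrightarrow> (\<And>i. i \<in> {1..3} \<Longrightarrow> comm (b i) x = 0) \<Longrightarrow>
      \<exists>\<alpha> \<beta> \<gamma>. x = scl \<alpha> ident + scl \<beta> e + scl \<gamma> y"
    using exists_central_involution by blast
  \<comment> \<open>The eigenprojections of the involution \<open>y\<close>. That \<open>f\<close>
    is nonzero is the condition \<open>y \<noteq> - h\<close>; that \<open>g\<close> is nonzero
    follows from its fixing \<open>k\<close>.\<close>
  define f where "f = scl (complex_of_real (1 / 2)) (h + y)"
  define g where "g = scl (complex_of_real (1 / 2)) (h - y)"
  have double: "scl (1/2) u + scl (1/2) u = u" "scl (1/4) u + scl (1/4) u = scl (1/2) u" for u
    by (simp_all flip: scale_left_distrib)
  have hy: "mul h y = y" "mul y h = y"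
    by (simp_all add: h y)
  have fg_add: "f + g = h"
    by (simp add: f_def g_def scale_right_distrib scale_right_diff_distrib double)
  have comm_fg: "comm x f = 0" "comm x g = 0" for x
    by (simp_all add: f_def g_def comm_linear h y)
  have central: "mul x f = mul f x" "mul x g = mul g x" for x
    using comm_fg[of x] by (simp_all add: comm_def)
  have rsym_fg: "rsym f" "rsym g"
    unfolding f_def g_def by (intro rsym_scl rsym_add rsym_diff h y)+
  have products: "mul f f = f" "mul g g = g" "mul f g = 0"
    by (simp_all add: f_def g_def mul_linear y hy h(2) scale_right_distrib scale_right_diff_distrib)
      (simp_all add: algebra_simps double)
  have fk: "mul f k = 0" and gk: "mul g k = k"
    by (simp_all add: f_def g_def mul_linear y h degree_rskew[OF rskew_k] scale_right_distrib double)
  have fy: "mul f y = f" and gy: "mul g y = - g"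
    by (simp_all add: f_def g_def mul_linear y hy add.commute flip: scale_minus_right)
  have dfg: "\<delta> f = 0" "\<delta> g = 0"
    by (simp_all add: f_def g_def degree_linear degree_minus degree_h y)
  have fe: "mul f e = 0" "mul g e = 0" "mul e f = 0" "mul e g = 0"
    by (simp_all add: mul_e dfg)
  have "f \<noteq> 0"
  proof
    assume "f = 0"
    then have "scl 2 f = 0" by simp
    then have "h + y = 0" by (simp add: f_def)
    then show False
      using y(6) by (simp add: eq_neg_iff_add_eq_0 add.commute)
  qed
  have "g \<noteq> 0"
    using gk k_nonzero by (auto simp: mul_linear)
  define \<tau>f where "\<tau>f = Re (tr f)"
  define \<tau>g where "\<tau>g = Re (tr g)"
  have trf: "tr f = complex_of_real \<tau>f" "0 < \<tau>f" and trg: "tr g = complex_of_real \<tau>g" "0 < \<tau>g"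
    using rsym_tr_square_pos[OF rsym_fg(1) \<open>f \<noteq> 0\<close>] rsym_tr_square_pos[OF rsym_fg(2) \<open>g \<noteq> 0\<close>]
      real_elt_tr[of f] real_elt_tr[of g] rsym_fg
    by (auto simp: \<tau>f_def \<tau>g_def products rsym_def)
  \<comment> \<open>As \<open>f\<close> annihilates \<open>k\<close>, it annihilates all commutators
    of symmetric elements. So \<open>mul f x\<close> is central for symmetric \<open>x\<close>,
    hence in the span of \<open>ident\<close>, \<open>e\<close> and \<open>y\<close>, each of which
    \<open>f\<close> turns into a multiple of itself.\<close>
  have f_scalar: "\<exists>c. mul f x = scl c f" for x
  proof (induction x rule: rsym_k_induct)
    case (1 x)
    have "rsym (mul f x)"
      using 1 rsym_fg comm_fg comm_swap[of f x] by (intro rsym_mul_commuting) (auto simp: comm_swap[of x f])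
    moreover have "comm (b i) (mul f x) = 0" if i: "i \<in> {1..3}" for i
    proof -
      obtain c where "comm (b i) x = scl (complex_of_real c) k"
        using rskew_form[OF rskew_comm_sym[OF rsym_basis[OF i] 1]] by blast
      then show ?thesis
        by (simp add: comm_leibniz comm_fg mul_linear fk)
    qed
    ultimately obtain \<alpha> \<beta> \<gamma> where "mul f x = scl \<alpha> ident + scl \<beta> e + scl \<gamma> y"
      using y(7) by blast
    then have "mul f (mul f x) = scl (\<alpha> + \<gamma>) f"
      by (simp add: mul_linear fe fy scale_left_distrib)
    moreover have "mul f (mul f x) = mul f x"
      by (simp add: products flip: mul_assoc)
    ultimately show ?case by auto
  next
    case 2
    have "mul f k = scl 0 f" by (simp add: fk)
    then show ?case by blast
  next
    case (3 x y)
    then show ?case by (metis mul_add_right scale_left_distrib)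
  next
    case (4 c x)
    then show ?case by (metis mul_scl_right scale_scale)
  qed
  \<comment> \<open>Commuting with \<open>k\<close> makes \<open>x\<close> commute with all
    symmetric elements, so that \<open>x\<close> lies in the span of \<open>ident\<close>,
    \<open>e\<close> and \<open>y\<close>; multiplication by \<open>g\<close> leaves a multiple of
    \<open>g\<close>, which the trace determines.\<close>
  have g_scalar: "x = scl (complex_of_real (Re (tr x) / \<tau>g)) g"
    if x: "rsym x" "comm k x = 0" "mul g x = x" for x
  proof -
    obtain \<alpha> \<beta> \<gamma> where "x = scl \<alpha> ident + scl \<beta> e + scl \<gamma> y"
      using y(7)[OF x(1)] commutes_if_commutes_k[OF x(1) rsym_basis x(2)] by blast
    then have "mul g x = scl (\<alpha> - \<gamma>) g"
      by (simp add: mul_linear fe gy scale_left_diff_distrib)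
    then have xg: "x = scl (\<alpha> - \<gamma>) g"
      using x(3) by simp
    then have "tr x = (\<alpha> - \<gamma>) * complex_of_real \<tau>g"
      by (metis tr_linear(4) trg(1))
    moreover have "tr x = complex_of_real (Re (tr x))"
      using real_elt_tr[of x] x(1) by (auto simp: rsym_def)
    ultimately have "\<alpha> - \<gamma> = complex_of_real (Re (tr x) / \<tau>g)"
      using trg(2) by (metis nonzero_eq_divide_eq of_real_divide of_real_eq_0_iff less_irrefl)
    then show ?thesis
      using xg by simp
  qed

  define c where "c = Re (tr (mul k k)) / \<tau>g"
  have kk: "mul k k = scl (complex_of_real c) g"
    unfolding c_def using rskew_k
    by (intro g_scalar) (auto intro!: rsym_square simp: comm_leibniz comm_linear mul_linear gk simp flip: mul_assoc)
  have c: "c < 0"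
    unfolding c_def using rskew_tr_square_neg[OF rskew_k k_nonzero] trg(2) by (rule divide_neg_pos)
  \<comment> \<open>The square of the skew element \<open>k\<close> is a negative multiple of
    \<open>g\<close>; this factor makes it \<open>- g\<close>.\<close>
  define t where "t = 1 / sqrt (- c)"
  define j where "j = scl (complex_of_real t) k"
  have "t * t * c = - 1"
    using c by (simp add: t_def)
  then have jj: "mul j j = - g"
    by (simp add: j_def mul_linear kk flip: of_real_mult mult.assoc)
  have rskew_j: "rskew j"
    unfolding j_def by (intro rskew_scl rskew_k)
  have gj: "mul g j = j"
    by (simp add: j_def mul_linear gk)
  have tr_k: "tr k = 0"
    by (simp add: k_def tr_def coeff_linear coeff_basis)

  obtain i where i: "i \<in> {1..3}" "comm k (b i) \<noteq> 0"
  proof (rule ccontr)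
    assume no: "\<not> thesis"
    have ki: "comm k (b i) = 0" if "i \<in> {1..3}" for i
      using no \<open>\<And>i. i \<in> {1..3} \<Longrightarrow> comm k (b i) \<noteq> 0 \<Longrightarrow> thesis\<close> that by blast
    have "comm k x = 0" if "rsym x" for x
      by (rule rsym_form[OF that]) (use ki[of 1] ki[of 2] ki[of 3] in \<open>simp add: comm_linear\<close>)
    then have "comm x y = 0" if "rsym x" "rsym y" for x y
      using commutes_if_commutes_k that by blast
    then show False
      using exists_noncommuting comm_skew by metis
  qed
  \<comment> \<open>Subtracting the trace part from the \<open>g\<close>-component of a basis
    element that does not commute with \<open>k\<close> leaves an element that anticommutes with
    \<open>k\<close>.\<close>
  define c' where "c' = Re (tr (mul g (b i))) / \<tau>g"
  define v0 where "v0 = mul g (b i) - scl (complex_of_real c') g"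
  have rsym_gb: "rsym (mul g (b i))"
    using rsym_basis[OF i(1)] rsym_fg comm_fg comm_swap[of g "b i"] by (intro rsym_mul_commuting) auto
  have rsym_v0: "rsym v0"
    unfolding v0_def by (intro rsym_diff rsym_gb rsym_scl rsym_fg)
  have gv0: "mul g v0 = v0"
    by (simp add: v0_def mul_linear products flip: mul_assoc)
  have "tr (mul g (b i)) = complex_of_real (Re (tr (mul g (b i))))"
    using real_elt_tr rsym_gb by (auto simp: rsym_def)
  then have tr_v0: "tr v0 = 0"
    using trg by (simp add: v0_def tr_linear c'_def)
  have "v0 \<noteq> 0"
  proof
    assume "v0 = 0"
    then have "mul g (b i) = scl (complex_of_real c') g"
      by (simp add: v0_def)
    then have "comm k (mul g (b i)) = 0"
      by (simp add: comm_linear comm_fg)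
    moreover have "comm k (mul g (b i)) = comm k (b i)"
      unfolding comm_def by (metis central(2) gk mul_assoc)
    ultimately show False
      using i(2) by simp
  qed
  \<comment> \<open>The anticommutator is skew, hence a multiple of \<open>k\<close>. Its trace
    against \<open>k\<close> is a multiple of \<open>tr v0\<close>, because the square of
    \<open>k\<close> is a multiple of \<open>g\<close>; so it is 0.\<close>
  have "rskew (mul j v0 + mul v0 j)"
    by (intro rskew_anticomm rskew_j rsym_v0)
  then obtain d where d: "mul j v0 + mul v0 j = scl (complex_of_real d) k"
    by (rule rskew_form)
  have "tr (mul k (mul j v0 + mul v0 j)) = complex_of_real t * (tr (mul (mul k k) v0) + tr (mul k (mul v0 k)))"
    by (simp add: j_def mul_linear tr_linear algebra_simps mul_assoc)
  also have "tr (mul k (mul v0 k)) = tr (mul (mul k k) v0)"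
    by (metis mul_assoc tr_commute)
  also have "tr (mul (mul k k) v0) = 0"
    by (simp add: kk mul_linear gv0 tr_linear tr_v0)
  finally have "complex_of_real d * tr (mul k k) = 0"
    unfolding d by (simp add: mul_linear tr_linear)
  then have "d = 0"
    using rskew_tr_square_neg[OF rskew_k k_nonzero] by auto
  then have jv0: "mul j v0 = - mul v0 j"
    using d by (simp add: eq_neg_iff_add_eq_0)
  \<comment> \<open>An element that anticommutes with \<open>j\<close> has a square that commutes
    with \<open>k\<close>, so \<open>g_scalar\<close> applies.\<close>
  define c'' where "c'' = Re (tr (mul v0 v0)) / \<tau>g"
  have "k = scl (complex_of_real (sqrt (- c))) j"
    using c by (simp add: j_def t_def flip: of_real_mult)
  then have "comm k (mul v0 v0) = scl (complex_of_real (sqrt (- c))) (comm j (mul v0 v0))"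
    by (metis comm_linear(7))
  also have "comm j (mul v0 v0) = 0"
    unfolding comm_def by (metis (no_types, opaque_lifting) jv0 mul_assoc mul_minus_left mul_minus_right minus_minus right_minus_eq)
  finally have v0v0: "mul v0 v0 = scl (complex_of_real c'') g"
    unfolding c''_def using rsym_v0 gv0 by (intro g_scalar) (auto intro!: rsym_square simp flip: mul_assoc)
  have "0 < c''"
    unfolding c''_def using rsym_tr_square_pos[OF rsym_v0 \<open>v0 \<noteq> 0\<close>] trg(2) by simp
  define v where "v = scl (complex_of_real (1 / sqrt c'')) v0"
  have "1 / sqrt c'' * (1 / sqrt c'') * c'' = 1"
    using \<open>0 < c''\<close> by simp
  then have vv: "mul v v = g"
    unfolding v_def mul_linear v0v0 scale_scale of_real_mult[symmetric] by (simp add: mult.assoc)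
  have jv: "mul j v = - mul v j"
    by (simp add: v_def mul_linear jv0)
  have gv: "mul g v = v"
    by (simp add: v_def mul_linear gv0)
  have rsym_v: "rsym v"
    unfolding v_def by (intro rsym_scl rsym_v0)
  have tr_v: "tr v = 0"
    by (simp add: v_def tr_linear tr_v0)
  have tr_j: "tr j = 0"
    by (simp add: j_def tr_linear tr_k)

  define w where "w = mul v j"
  have vg: "mul v g = v" and jg: "mul j g = j"
    using central gv gj by simp_all
  have gw: "mul g w = w" "mul w g = w"
    by (simp_all add: w_def mul_assoc jg) (simp add: gv flip: mul_assoc)
  have vw: "mul v w = j" and wj: "mul w j = - v"
    by (simp_all add: w_def mul_assoc jj mul_linear vg) (simp add: vv gj flip: mul_assoc)
  have wv: "mul w v = - j"
    by (simp add: w_def mul_assoc jv mul_linear) (simp add: vv gj flip: mul_assoc)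
  have jw: "mul j w = v"
  proof -
    have "mul j w = mul (mul j v) j"
      by (simp add: w_def mul_assoc)
    also have "\<dots> = - mul w j"
      by (simp add: jv mul_linear w_def)
    finally show ?thesis by (simp add: wj)
  qed
  have ww: "mul w w = g"
  proof -
    have "mul w w = mul (mul w v) j"
      by (simp add: w_def mul_assoc)
    then show ?thesis by (simp add: wv mul_linear jj)
  qed
  have star_vwj: "star v = v" "star j = - j" "star w = w"
    using rsym_v rskew_j by (auto simp: rsym_def rskew_def w_def star_mul mul_linear jv)
  have tr_w: "tr w = 0"
  proof -
    have "tr w = - tr w"
      using tr_commute[of v j] by (simp add: w_def jv tr_linear)
    then show ?thesis by simp
  qed
  have fz: "mul f z = 0" "mul z f = 0" if "mul g z = z" for z
  proof -
    show "mul f z = 0"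
      using that products by (metis mul_assoc mul_zero_left)
    then show "mul z f = 0"
      by (simp add: central)
  qed
  have dz: "\<delta> z = 0" if "mul g z = z" for z
    using degree_linear(3)[of g z] that dfg by simp
  have ez: "mul e z = 0" "mul z e = 0" if "mul g z = z" for z
    by (simp_all add: mul_e dz that)
  note table = e_idem fe products fz[OF gv] fz[OF gw(1)] fz[OF gj] ez[OF gv] ez[OF gw(1)] ez[OF gj]
    products(3)[unfolded central(1)[of g, symmetric]]
    gv vg gw gj jg vv ww jj vw wv wj jw jv w_def[symmetric]

  \<comment> \<open>The inverse of the desired map is defined first. Traces against the six elements
    recover the coordinates, so it is injective, and equality of dimensions makes it
    bijective.\<close>
  define G where "G y = scl (y $ 0) e + scl (y $ 1) f + scl (y $ 2) g + scl (y $ 3) v + scl (y $ 4) w + scl (y $ 5) j"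
    for y :: "complex^6"
  have G_add: "G (x + y) = G x + G y" for x y
    by (simp add: G_def scale_left_distrib)
  have G_scl: "G (c *s x) = scl c (G x)" for x c
    by (simp add: G_def scale_right_distrib)
  have G_mul: "G (split_mul x y) = mul (G x) (G y)" for x y
    unfolding G_def split_mul_def vec6_nth
    by (simp add: mul_linear table scale_right_distrib scale_left_distrib scale_left_diff_distrib)
      (simp add: algebra_simps)
  have G_one: "G split_one = ident"
    using fg_add by (simp add: G_def split_one_def add.assoc) (simp add: h_def)
  have G_star: "G (split_star y) = star (G y)" for y
    using rsym_fg rsym_e by (simp add: G_def split_star_def star_add star_scl star_vwj rsym_def)
  have G_tr: "tr (mul (G y) e) = y $ 0 * tr e" "tr (mul (G y) f) = y $ 1 * tr f"
    "tr (mul (G y) g) = y $ 2 * tr g" "tr (mul (G y) v) = y $ 3 * tr g"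
    "tr (mul (G y) w) = y $ 4 * tr g" "tr (mul (G y) j) = - (y $ 5 * tr g)" for y
    by (simp_all add: G_def mul_linear table tr_linear tr_v tr_w tr_j)
  have nonzero: "tr e \<noteq> 0" "tr f \<noteq> 0" "tr g \<noteq> 0"
    using order_pos trf trg by (auto simp: tr_e)
  have "inj G"
  proof (rule injI)
    fix x y
    assume "G x = G y"
    then show "x = y"
      using G_tr[of x] G_tr[of y] nonzero by (simp add: vec6_eq_iff)
  qed
  have lin: "Vector_Spaces.linear (*s) scl G"
    by unfold_locales (auto simp: G_add G_scl)
  interpret fin: finite_dimensional_vector_space_pair "(*s) :: complex \<Rightarrow> complex^6 \<Rightarrow> _" cart_basis scl "b ` {..<6}"
    by unfold_locales (auto simp: b_independent b_span)
  have "card (b ` {..<6}) = 6"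
    using b_inj by (simp add: card_image)
  then have "surj G"
    using \<open>inj G\<close> lin by (intro fin.linear_injective_imp_surjective) (auto simp: card_cart_basis)
  define \<Psi> where "\<Psi> = inv_into UNIV G"
  have G\<Psi>: "G (\<Psi> x) = x" for x
    unfolding \<Psi>_def using \<open>surj G\<close> by (rule surj_f_inv_f)
  have \<Psi>G: "\<Psi> (G y) = y" for y
    unfolding \<Psi>_def using \<open>inj G\<close> by simp
  have bij\<Psi>: "bij \<Psi>"
    by (rule o_bij[of G]) (auto simp: G\<Psi> \<Psi>G)
  have \<Psi>I: "\<Psi> x = y" if "x = G y" for x y
    using that \<Psi>G by simp
  show ?thesis
  \<comment> \<open>The element \<open>f\<close> has character values 0, 1, 0, and \<open>g\<close>,
    the identity matrix of size two, has 0, 0, 2. Comparing with \<open>order * tr f\<close> and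
    \<open>order * tr g\<close> gives the multiplicities.\<close>
  proof (rule that[of \<Psi> "order * \<tau>f" "order * \<tau>g / 2"])
    show "split_algebra scl mul ident \<Psi>"
    proof (unfold_locales)
      show "\<Psi> (x + y) = \<Psi> x + \<Psi> y" "\<Psi> (scl c x) = c *s \<Psi> x" "\<Psi> (mul x y) = split_mul (\<Psi> x) (\<Psi> y)"
        "\<Psi> ident = split_one" for x y c
        by (intro \<Psi>I; simp add: G_add G_scl G_mul G_one G\<Psi>)+
    qed (rule bij\<Psi>)
    show "\<Psi> (star x) = split_star (\<Psi> x)" for x
      by (intro \<Psi>I) (simp add: G_star G\<Psi>)
    have "\<delta> (G y) = y $ 0" for y
      by (simp add: G_def degree_linear degree_e dfg dz gv gw gj)
    then show "\<Psi> x $ 0 = \<delta> x" for x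
      by (metis G\<Psi>)
    have "tr (G y) = y $ 0 * tr e + y $ 1 * tr f + y $ 2 * tr g" for y
      by (simp add: G_def tr_linear tr_v tr_w tr_j)
    from this[of "\<Psi> x" for x]
    show "complex_of_real order * tr x = \<Psi> x $ 0 + complex_of_real (order * \<tau>f) * \<Psi> x $ 1
       + 2 * complex_of_real (order * \<tau>g / 2) * \<Psi> x $ 2" for x
      using order_pos by (simp add: G\<Psi> tr_e trf trg algebra_simps)
    show "0 < order * \<tau>f" "0 < order * \<tau>g / 2"
      using order_pos trf trg by auto
    show "\<Psi> (b i) $ a \<in> \<real>" if "i < 6" for i a
    proof -
      have real: "tr (mul (b i) z) \<in> \<real>" "tr z \<in> \<real>" if "real_elt z" for z
        using \<open>i < 6\<close> that by (auto intro!: real_elt_tr real_elt_mul real_elt_basis)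
      have r: "real_elt e" "real_elt f" "real_elt g" "real_elt v" "real_elt j" "real_elt w"
        using rsym_e rsym_fg rsym_v rskew_j by (auto simp: rsym_def rskew_def w_def intro!: real_elt_mul)
      have "\<Psi> (b i) $ 0 = tr (mul (b i) e) / tr e" "\<Psi> (b i) $ 1 = tr (mul (b i) f) / tr f"
        "\<Psi> (b i) $ 2 = tr (mul (b i) g) / tr g" "\<Psi> (b i) $ 3 = tr (mul (b i) v) / tr g"
        "\<Psi> (b i) $ 4 = tr (mul (b i) w) / tr g" "\<Psi> (b i) $ 5 = - tr (mul (b i) j) / tr g"
        using G_tr[of "\<Psi> (b i)"] nonzero by (simp_all add: G\<Psi>)
      then have "\<forall>a. \<Psi> (b i) $ a \<in> \<real>"
        unfolding forall_6 using real r by (simp add: Reals_divide)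
      then show ?thesis by blast
    qed
  qed
qed

end

section \<open>Irreducible characters\<close>

lemma smult_mat_mult_vec:
  "A \<in> carrier_mat n m \<Longrightarrow> v \<in> carrier_vec m \<Longrightarrow> (c \<cdot>\<^sub>m A) *\<^sub>v v = c \<cdot>\<^sub>v (A *\<^sub>v v)" for c :: "'a::comm_ring"
  by (rule eq_vecI) (auto simp: scalar_prod_def sum_distrib_left mult.assoc)

lemma zero_mat_mult_vec: "v \<in> carrier_vec m \<Longrightarrow> 0\<^sub>m n m *\<^sub>v v = 0\<^sub>v n" for v :: "'a::comm_ring Matrix.vec"
  by (rule eq_vecI) (auto simp: scalar_prod_def)

lemma mat_mult_unit_vec: "A \<in> carrier_mat n m \<Longrightarrow> j < m \<Longrightarrow> A *\<^sub>v unit_vec m j = col A j"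
  for A :: "'a::comm_ring_1 mat"
  by (rule eq_vecI) auto

section \<open>Irreducible representations of an arbitrary algebra\<close>

context complex_algebra
begin

lemma matrix_rep_linear:
  assumes "matrix_rep d X"
  shows "X x \<in> carrier_mat d d" "X (x + y) = X x + X y" "X (scl c x) = c \<cdot>\<^sub>m X x"
    "X (mul x y) = X x * X y" "X ident = 1\<^sub>m d"
  using assms by (auto simp: matrix_rep_def)

lemma matrix_rep_zero: "matrix_rep d X \<Longrightarrow> X 0 = 0\<^sub>m d d"
proof -
  assume X: "matrix_rep d X"
  have "0 \<cdot>\<^sub>m X 0 = 0\<^sub>m d d"
    using matrix_rep_linear(1)[OF X, of 0] by (intro eq_matI) auto
  then show ?thesis
    using matrix_rep_linear(3)[OF X, of 0 0] by simp
qed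

lemma invariant_subspace_orbit:
  assumes X: "matrix_rep d X" and M: "M \<in> carrier_mat d d" and comm: "\<And>x. X x * M = M * X x"
  shows "invariant_subspace d X {M *\<^sub>v v | v. v \<in> carrier_vec d}"
proof -
  note car = matrix_rep_linear(1)[OF X]
  let ?W = "{M *\<^sub>v v | v. v \<in> carrier_vec d}"
  have zero: "0\<^sub>v d \<in> ?W"
    using M by (intro CollectI exI[of _ "0\<^sub>v d"] conjI eq_vecI) auto
  have add: "M *\<^sub>v v + M *\<^sub>v w = M *\<^sub>v (v + w)" if "v \<in> carrier_vec d" "w \<in> carrier_vec d" for v w
    using mult_add_distrib_mat_vec[OF M that] by simp
  have scl: "c \<cdot>\<^sub>v (M *\<^sub>v v) = M *\<^sub>v (c \<cdot>\<^sub>v v)" if "v \<in> carrier_vec d" for c v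
    using mult_mat_vec[OF M that] by simp
  have mul: "X x *\<^sub>v (M *\<^sub>v v) = M *\<^sub>v (X x *\<^sub>v v)" if "v \<in> carrier_vec d" for x v
    using comm[of x] assoc_mult_mat_vec[OF car M that] assoc_mult_mat_vec[OF M car that] by metis
  have "v + w \<in> ?W" if "v \<in> ?W" "w \<in> ?W" for v w
    using that add add_carrier_vec by blast
  moreover have "c \<cdot>\<^sub>v v \<in> ?W" if "v \<in> ?W" for c v
    using that scl smult_carrier_vec by blast
  moreover have "X x *\<^sub>v v \<in> ?W" if "v \<in> ?W" for x v
    using that mul mult_mat_vec_carrier[OF car] by blast
  moreover have "?W \<subseteq> carrier_vec d"
    using mult_mat_vec_carrier[OF M] by blast
  ultimately show ?thesis
    unfolding invariant_subspace_def using zero by simp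
qed

lemma invariant_subspace_cyclic:
  assumes X: "matrix_rep d X" and w: "w \<in> carrier_vec d"
  shows "invariant_subspace d X {X x *\<^sub>v w | x. True}"
proof -
  note car = matrix_rep_linear(1)[OF X]
  let ?W = "{X x *\<^sub>v w | x. True}"
  have "X 0 *\<^sub>v w = 0\<^sub>v d"
    using w by (simp add: matrix_rep_zero[OF X] zero_mat_mult_vec)
  then have zero: "0\<^sub>v d \<in> ?W"
    by (metis (mono_tags, lifting) mem_Collect_eq)
  have add: "X x *\<^sub>v w + X y *\<^sub>v w = X (x + y) *\<^sub>v w" for x y
    using add_mult_distrib_mat_vec[OF car car w] by (simp add: matrix_rep_linear(2)[OF X])
  have scl: "c \<cdot>\<^sub>v (X x *\<^sub>v w) = X (scl c x) *\<^sub>v w" for c x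
    using smult_mat_mult_vec[OF car w] by (simp add: matrix_rep_linear(3)[OF X])
  have mul: "X x *\<^sub>v (X y *\<^sub>v w) = X (mul x y) *\<^sub>v w" for x y
    using assoc_mult_mat_vec[OF car car w] by (simp add: matrix_rep_linear(4)[OF X])
  have "v + u \<in> ?W" if "v \<in> ?W" "u \<in> ?W" for v u
    using that add by blast
  moreover have "c \<cdot>\<^sub>v v \<in> ?W" if "v \<in> ?W" for c v
    using that scl by blast
  moreover have "X x *\<^sub>v v \<in> ?W" if "v \<in> ?W" for x v
    using that mul by blast
  moreover have "?W \<subseteq> carrier_vec d"
    using mult_mat_vec_carrier[OF car w] by blast
  ultimately show ?thesis
    unfolding invariant_subspace_def using zero by simp
qed

lemma nonzero_mat_column:
  assumes "M \<in> carrier_mat d d" "M \<noteq> 0\<^sub>m d d"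
  obtains j where "j < d" "col M j \<noteq> 0\<^sub>v d"
proof -
  obtain i j where ij: "i < d" "j < d" "M $$ (i, j) \<noteq> 0"
    using assms by (metis carrier_matD eq_matI index_zero_mat)
  then have "vec_index (col M j) i \<noteq> vec_index (0\<^sub>v d) i"
    using assms by simp
  then show ?thesis
    using that ij by metis
qed

text \<open>As in Schur's lemma, the range of \<open>X c\<close> is an invariant subspace other than
  0, hence everything, and \<open>X y\<close> annihilates it.\<close>

lemma central_acts_faithfully:
  assumes X: "irreducible_rep d X" and c: "\<And>x. mul x c = mul c x" and "X c \<noteq> 0\<^sub>m d d" and "mul y c = 0"
  shows "X y = 0\<^sub>m d d"
proof (rule ccontr)
  have rep: "matrix_rep d X"
    using X by (auto simp: irreducible_rep_def)
  note car = matrix_rep_linear(1)[OF rep]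
  let ?W = "{X c *\<^sub>v v | v. v \<in> carrier_vec d}"
  have "invariant_subspace d X ?W"
    using c by (intro invariant_subspace_orbit rep car) (simp flip: matrix_rep_linear(4)[OF rep])
  moreover obtain j where j: "j < d" "col (X c) j \<noteq> 0\<^sub>v d"
    using nonzero_mat_column[OF car assms(3)] by blast
  have "col (X c) j \<in> ?W"
    using mat_mult_unit_vec[OF car j(1), of c] unit_vec_carrier by (metis (mono_tags, lifting) mem_Collect_eq)
  ultimately have W: "?W = carrier_vec d"
    using X j unfolding irreducible_rep_def by blast
  assume "X y \<noteq> 0\<^sub>m d d"
  then obtain i where i: "i < d" "col (X y) i \<noteq> 0\<^sub>v d"
    using nonzero_mat_column[OF car] by blast
  have "unit_vec d i \<in> ?W"
    unfolding W by simp
  then obtain v where v: "v \<in> carrier_vec d" "unit_vec d i = X c *\<^sub>v v"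
    by blast
  have "col (X y) i = X y *\<^sub>v (X c *\<^sub>v v)"
    using mat_mult_unit_vec[OF car i(1), of y] v by simp
  also have "\<dots> = X (mul y c) *\<^sub>v v"
    using assoc_mult_mat_vec[OF car car v(1)] by (simp add: matrix_rep_linear(4)[OF rep])
  also have "\<dots> = 0\<^sub>v d"
    using v(1) by (simp add: assms(4) matrix_rep_zero[OF rep] zero_mat_mult_vec)
  finally show False
    using i(2) by simp
qed

text \<open>The image of such an idempotent under an irreducible representation has rank one:
  it maps each \<open>X x *\<^sub>v w\<close> into the line of \<open>w\<close>, and these vectors exhaust the module.\<close>

lemma trace_minimal_idempotent:
  assumes X: "irreducible_rep d X" and idem: "mul u u = u" and min: "\<And>x. \<exists>c. mul u (mul x u) = scl c u"
    and nz: "X u \<noteq> 0\<^sub>m d d"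
  shows "(\<Sum>i<d. X u $$ (i, i)) = 1"
proof -
  have rep: "matrix_rep d X"
    using X by (auto simp: irreducible_rep_def)
  note car = matrix_rep_linear(1)[OF rep]
  have dim: "dim_row (X x) = d" "dim_col (X x) = d" for x
    using car[of x] by auto
  obtain j0 where j0: "j0 < d" "col (X u) j0 \<noteq> 0\<^sub>v d"
    using nonzero_mat_column[OF car nz] by blast
  define w where "w = col (X u) j0"
  have w: "w \<in> carrier_vec d"
    unfolding w_def using car[of u] by auto
  have assoc: "X x *\<^sub>v (X y *\<^sub>v v) = X (mul x y) *\<^sub>v v" if "v \<in> carrier_vec d" for x y v
    using assoc_mult_mat_vec[OF car car that] by (simp add: matrix_rep_linear(4)[OF rep])
  have uw: "X u *\<^sub>v w = w"
    unfolding w_def mat_mult_unit_vec[OF car j0(1), symmetric] by (simp add: assoc idem)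
  let ?W = "{X x *\<^sub>v w | x. True}"
  have "invariant_subspace d X ?W"
    by (rule invariant_subspace_cyclic[OF rep w])
  moreover have "w \<in> ?W"
    using uw by (metis (mono_tags, lifting) mem_Collect_eq)
  ultimately have W: "?W = carrier_vec d"
    using X j0 unfolding irreducible_rep_def w_def[symmetric] by blast
  have "\<exists>c. col (X u) j = c \<cdot>\<^sub>v w" if "j < d" for j
  proof -
    have "unit_vec d j \<in> ?W"
      unfolding W by simp
    then obtain x where x: "unit_vec d j = X x *\<^sub>v w"
      by blast
    obtain c where c: "mul u (mul x u) = scl c u"
      using min by blast
    have "col (X u) j = X u *\<^sub>v (X x *\<^sub>v (X u *\<^sub>v w))"
      using mat_mult_unit_vec[OF car that, of u] x uw by simp
    also have "\<dots> = X (scl c u) *\<^sub>v w"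
      using w by (simp add: assoc mult_mat_vec_carrier[OF car] flip: c)
    also have "\<dots> = c \<cdot>\<^sub>v w"
      by (simp add: matrix_rep_linear(3)[OF rep] smult_mat_mult_vec[OF car w] uw)
    finally show ?thesis by blast
  qed
  then obtain a where a: "\<And>j. j < d \<Longrightarrow> col (X u) j = a j \<cdot>\<^sub>v w"
    by metis
  have entry: "X u $$ (i, j) = a j * vec_index w i" if "i < d" "j < d" for i j
    using arg_cong[OF a[OF that(2)], of "\<lambda>v. vec_index v i"] that w by (simp add: dim)
  obtain i where i: "i < d" "vec_index w i \<noteq> 0"
    using j0(2) w unfolding w_def[symmetric] by (metis carrier_vecD eq_vecI index_zero_vec)
  \<comment> \<open>With entries \<open>a j * vec_index w i\<close> the matrix scales
    \<open>w\<close> by its own trace, and \<open>X u\<close> fixes \<open>w\<close>.\<close>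
  have "vec_index w i = vec_index (X u *\<^sub>v w) i"
    by (simp add: uw)
  also have "\<dots> = (\<Sum>j<d. X u $$ (i, j) * vec_index w j)"
    using i w by (simp add: dim scalar_prod_def atLeast0LessThan)
  also have "\<dots> = vec_index w i * (\<Sum>j<d. a j * vec_index w j)"
    unfolding sum_distrib_left by (intro sum.cong) (auto simp: entry i)
  finally have "(\<Sum>j<d. a j * vec_index w j) = 1"
    using i by simp
  then show ?thesis
    by (simp add: entry)
qed

lemma matrix_rep_trace_commute:
  assumes X: "matrix_rep d X"
  shows "(\<Sum>i<d. X (mul x y) $$ (i, i)) = (\<Sum>i<d. X (mul y x) $$ (i, i))"
proof -
  have dim: "dim_row (X x) = d" "dim_col (X x) = d" for x
    using matrix_rep_linear(1)[OF X, of x] by auto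
  have "(\<Sum>i<d. X (mul x y) $$ (i, i)) = (\<Sum>i<d. \<Sum>j<d. X x $$ (i, j) * X y $$ (j, i))" for x y
    by (intro sum.cong) (auto simp: matrix_rep_linear(4)[OF X] dim scalar_prod_def atLeast0LessThan)
  then show ?thesis
    by (simp add: mult.commute) (rule sum.swap)
qed

lemma irreducible_character_ident: "irreducible_character d \<psi> \<Longrightarrow> \<psi> ident = of_nat d"
  by (auto simp: irreducible_character_def irreducible_rep_def matrix_rep_def)

lemma irreducible_character_linear:
  assumes "algebra_hom_complex \<psi>"
  shows "irreducible_character 1 \<psi>"
proof -
  let ?X = "\<lambda>x. mat 1 1 (\<lambda>_. \<psi> x)"
  have "matrix_rep 1 ?X"
    using assms unfolding matrix_rep_def algebra_hom_complex_def
    by (auto intro!: eq_matI simp: scalar_prod_def)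
  moreover have "W = {0\<^sub>v 1} \<or> W = carrier_vec 1" if inv: "invariant_subspace 1 ?X W" for W
  proof (cases "W = {0\<^sub>v 1}")
    case False
    then obtain w where w: "w \<in> W" "w \<noteq> 0\<^sub>v 1" "w \<in> carrier_vec 1"
      using inv unfolding invariant_subspace_def by blast
    then have w0: "vec_index w 0 \<noteq> 0"
      by (metis One_nat_def carrier_vecD eq_vecI index_zero_vec less_one)
    have "v \<in> W" if "v \<in> carrier_vec 1" for v
    proof -
      have "v = (vec_index v 0 / vec_index w 0) \<cdot>\<^sub>v w"
        using that w w0 by (intro eq_vecI) auto
      then show ?thesis
        using inv w(1) unfolding invariant_subspace_def by metis
    qed
    then show ?thesis
      using inv unfolding invariant_subspace_def by blast
  qed simp
  ultimately have "irreducible_rep 1 ?X"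
    unfolding irreducible_rep_def by blast
  moreover have "\<psi> = (\<lambda>x. \<Sum>i<1. ?X x $$ (i, i))"
    by simp
  ultimately show ?thesis
    unfolding irreducible_character_def by blast
qed

end

section \<open>The characters of a split algebra\<close>

context split_algebra
begin

definition lift :: "complex^6 \<Rightarrow> 'a" where
  "lift = inv_into UNIV \<Psi>"

lemma split_lift [simp]: "\<Psi> (lift y) = y"
  unfolding lift_def by (rule surj_f_inv_f[OF bij_is_surj[OF bij_split]])

lemma split_eq_iff: "x = y \<longleftrightarrow> \<Psi> x = \<Psi> y"
  using bij_is_inj[OF bij_split] by (auto dest: injD)

lemma split_zero: "\<Psi> 0 = 0"
  using split_scl[of 0 0] by simp

lemmas split_hom = split_add split_scl split_mul split_ident split_zero split_lift

lemmas split_simps = split_eq_iff split_hom split_mul_def split_one_def vec6_eq_iff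

lemma irreducible_character_0: "irreducible_character 1 (\<lambda>x. \<Psi> x $ 0)"
  and irreducible_character_1: "irreducible_character 1 (\<lambda>x. \<Psi> x $ 1)"
  by (rule irreducible_character_linear, simp add: algebra_hom_complex_def split_simps)+

lemma irreducible_character_2: "irreducible_character 2 (\<lambda>x. 2 * \<Psi> x $ 2)"
proof -
  let ?X = "\<lambda>x. mat 2 2 (\<lambda>(i, j). if i = 0 then if j = 0 then \<Psi> x $ 2 + \<Psi> x $ 3 else \<Psi> x $ 4 + \<Psi> x $ 5
     else if j = 0 then \<Psi> x $ 4 - \<Psi> x $ 5 else \<Psi> x $ 2 - \<Psi> x $ 3)"
  have "matrix_rep 2 ?X"
    unfolding matrix_rep_def
    by (auto intro!: eq_matI simp: scalar_prod_def split_simps less_2_cases_iff algebra_simps numeral_2_eq_2)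
  moreover have "W = {0\<^sub>v 2} \<or> W = carrier_vec 2" if inv: "invariant_subspace 2 ?X W" for W
  proof (cases "W = {0\<^sub>v 2}")
    case False
    then obtain w where w: "w \<in> W" "w \<noteq> 0\<^sub>v 2" "w \<in> carrier_vec 2"
      using inv unfolding invariant_subspace_def by blast
    then obtain i where i: "i < 2" "vec_index w i \<noteq> 0"
      by (metis carrier_vecD eq_vecI index_zero_vec)
    have "v \<in> W" if v: "v \<in> carrier_vec 2" for v
    proof -
      \<comment> \<open>The matrix whose only nonzero column is column \<open>i\<close>, scaled so
        as to send \<open>w\<close> to \<open>v\<close>; \<open>x\<close> is the element with this
        matrix.\<close>
      define M where "M k l = (if l = i then vec_index v k / vec_index w i else 0)" for k l :: nat
      define x where "x = lift (vec6 0 0 ((M 0 0 + M 1 1) / 2) ((M 0 0 - M 1 1) / 2)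
        ((M 0 1 + M 1 0) / 2) ((M 0 1 - M 1 0) / 2))"
      have x: "\<Psi> x $ 2 + \<Psi> x $ 3 = M 0 0" "\<Psi> x $ 4 + \<Psi> x $ 5 = M 0 1"
        "\<Psi> x $ 4 - \<Psi> x $ 5 = M 1 0" "\<Psi> x $ 2 - \<Psi> x $ 3 = M 1 1"
        by (simp_all add: x_def field_simps)
      have "?X x *\<^sub>v w = v"
      proof (rule eq_vecI)
        fix l
        assume "l < dim_vec v"
        then have "l = 0 \<or> l = 1" "i = 0 \<or> i = 1"
          using v i(1) by auto
        then show "vec_index (?X x *\<^sub>v w) l = vec_index v l"
          unfolding x using i(2) w(3) by (auto simp: M_def scalar_prod_def numeral_2_eq_2)
      qed (use v in auto)
      moreover have "?X x *\<^sub>v w \<in> W"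
        using inv w(1) unfolding invariant_subspace_def by blast
      ultimately show ?thesis by simp
    qed
    then show ?thesis
      using inv unfolding invariant_subspace_def by blast
  qed simp
  ultimately have "irreducible_rep 2 ?X"
    unfolding irreducible_rep_def by simp
  moreover have "(\<lambda>x. 2 * \<Psi> x $ 2) = (\<lambda>x. \<Sum>i<2. ?X x $$ (i, i))"
    by (simp add: numeral_2_eq_2)
  ultimately show ?thesis
    unfolding irreducible_character_def by blast
qed

text \<open>As a trace, \<open>\<psi>\<close> is determined by its values on the idempotents
  \<open>u0\<close>, \<open>u1\<close>, \<open>u11\<close>. The two central ones cannot both act
  nontrivially, each excludes \<open>u11\<close>, and a minimal idempotent that acts nontrivially
  has trace 1. The size of the representation does not enter.\<close>

lemma irreducible_character_cases:
  assumes "irreducible_character d \<psi>"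
  shows "\<psi> \<in> {\<lambda>x. \<Psi> x $ 0, \<lambda>x. \<Psi> x $ 1, \<lambda>x. 2 * \<Psi> x $ 2}"
proof -
  obtain X where X: "irreducible_rep d X" and \<psi>: "\<psi> = (\<lambda>x. \<Sum>i<d. X x $$ (i, i))"
    using assms by (auto simp: irreducible_character_def)
  have rep: "matrix_rep d X" and d: "0 < d"
    using X by (auto simp: irreducible_rep_def)
  have dim: "dim_row (X x) = d" "dim_col (X x) = d" for x
    using matrix_rep_linear(1)[OF rep, of x] by auto
  have \<psi>_add: "\<psi> (x + y) = \<psi> x + \<psi> y" for x y
    by (simp add: \<psi> matrix_rep_linear[OF rep] dim sum.distrib)
  have \<psi>_scl: "\<psi> (scl c x) = c * \<psi> x" for c x
    by (simp add: \<psi> matrix_rep_linear[OF rep] dim sum_distrib_left)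
  have \<psi>_comm: "\<psi> (mul x y) = \<psi> (mul y x)" for x y
    unfolding \<psi> by (rule matrix_rep_trace_commute[OF rep])
  have \<psi>_zero: "\<psi> u = 0" if "X u = 0\<^sub>m d d" for u
    using that by (simp add: \<psi>)
  \<comment> \<open>The units of the linear summands and the four matrix units, in
    coordinates.\<close>
  define u0 u1 u11 u22 u12 u21 where "u0 = lift (vec6 1 0 0 0 0 0)" and "u1 = lift (vec6 0 1 0 0 0 0)"
    and "u11 = lift (vec6 0 0 (1/2) (1/2) 0 0)" and "u22 = lift (vec6 0 0 (1/2) (- 1/2) 0 0)"
    and "u12 = lift (vec6 0 0 0 0 (1/2) (1/2))" and "u21 = lift (vec6 0 0 0 0 (1/2) (- 1/2))"
  note u = u0_def u1_def u11_def u22_def u12_def u21_def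
  have decomp: "x = mul x u0 + mul x u1 + mul x u11 + mul x u22" for x
    by (simp add: u split_simps field_simps)
  have scalar: "mul x u0 = scl (\<Psi> x $ 0) u0" "mul x u1 = scl (\<Psi> x $ 1) u1"
    "mul u11 (mul x u11) = scl (\<Psi> x $ 2 + \<Psi> x $ 3) u11"
    "mul u22 (mul x u22) = scl (\<Psi> x $ 2 - \<Psi> x $ 3) u22" for x
    by (simp_all add: u split_simps) (simp_all add: field_simps)
  have central: "mul x u0 = mul u0 x" "mul x u1 = mul u1 x" for x
    by (simp_all add: u split_simps)
  have idem: "mul u0 u0 = u0" "mul u1 u1 = u1" "mul u11 u11 = u11" "mul u22 u22 = u22"
    "mul u1 u0 = 0" "mul u11 u0 = 0" "mul u11 u1 = 0" "mul u12 u21 = u11" "mul u21 u12 = u22"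
    by (simp_all add: u split_simps)
  have mul_u: "\<psi> (mul x u11) = (\<Psi> x $ 2 + \<Psi> x $ 3) * \<psi> u11" "\<psi> (mul x u22) = (\<Psi> x $ 2 - \<Psi> x $ 3) * \<psi> u22" for x
    using \<psi>_comm[of "mul x u11" u11] \<psi>_comm[of "mul x u22" u22]
    by (simp_all add: idem scalar \<psi>_scl mul_assoc)
  have u22: "\<psi> u22 = \<psi> u11"
    using \<psi>_comm[of u12 u21] by (simp add: idem)
  have \<psi>_decomp: "\<psi> x = \<psi> (mul x u0) + \<psi> (mul x u1) + \<psi> (mul x u11) + \<psi> (mul x u22)" for x
    by (subst decomp[of x]) (simp only: \<psi>_add)
  have \<psi>_eq: "\<psi> x = \<Psi> x $ 0 * \<psi> u0 + \<Psi> x $ 1 * \<psi> u1 + 2 * \<Psi> x $ 2 * \<psi> u11" for x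
    by (subst \<psi>_decomp) (simp add: mul_u u22 scalar(1,2) \<psi>_scl algebra_simps)
  have trace1: "\<psi> u = 1" if "mul u u = u" "\<And>x. \<exists>c. mul u (mul x u) = scl c u" "X u \<noteq> 0\<^sub>m d d" for u
    unfolding \<psi> using X that by (rule trace_minimal_idempotent)
  have min: "\<exists>c. mul u0 (mul x u0) = scl c u0" "\<exists>c. mul u1 (mul x u1) = scl c u1"
    "\<exists>c. mul u11 (mul x u11) = scl c u11" for x
    using scalar(1,2)[of x] scalar(3)[of x] idem(1,2) mul_scl_right[of u0 "\<Psi> x $ 0" u0]
      mul_scl_right[of u1 "\<Psi> x $ 1" u1] by auto
  consider "X u0 \<noteq> 0\<^sub>m d d" | "X u0 = 0\<^sub>m d d" "X u1 \<noteq> 0\<^sub>m d d"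
    | "X u0 = 0\<^sub>m d d" "X u1 = 0\<^sub>m d d" by blast
  then show ?thesis
  proof cases
    case 1
    then have "\<psi> u1 = 0" "\<psi> u11 = 0"
      using central_acts_faithfully[OF X central(1) 1] idem by (blast intro!: \<psi>_zero)+
    moreover have "\<psi> u0 = 1"
      using 1 idem min by (intro trace1)
    ultimately have "\<psi> x = \<Psi> x $ 0" for x
      by (subst \<psi>_eq) simp
    then show ?thesis by blast
  next
    case 2
    then have "\<psi> u11 = 0"
      using central_acts_faithfully[OF X central(2) 2(2)] idem by (blast intro!: \<psi>_zero)
    moreover have "\<psi> u1 = 1"
      using 2 idem min by (intro trace1)
    ultimately have "\<psi> x = \<Psi> x $ 1" for x
      using \<psi>_zero[OF 2(1)] by (subst \<psi>_eq) simp
    then show ?thesis by blast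
  next
    case 3
    then have *: "\<psi> x = 2 * \<Psi> x $ 2 * \<psi> u11" for x
      using \<psi>_zero by (subst \<psi>_eq) simp
    have "\<psi> ident = of_nat d"
      using assms by (rule irreducible_character_ident)
    then have "\<psi> u11 \<noteq> 0"
      using d *[of ident] by auto
    then have "X u11 \<noteq> 0\<^sub>m d d"
      using \<psi>_zero by blast
    then have "\<psi> u11 = 1"
      using idem min by (intro trace1)
    then have "\<psi> x = 2 * \<Psi> x $ 2" for x
      by (subst *) simp
    then show ?thesis by blast
  qed
qed

lemma irreducible_characters:
  "{\<psi>. \<exists>d. irreducible_character d \<psi>} = {\<lambda>x. \<Psi> x $ 0, \<lambda>x. \<Psi> x $ 1, \<lambda>x. 2 * \<Psi> x $ 2}"
  using irreducible_character_0 irreducible_character_1 irreducible_character_2 irreducible_character_cases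
  by blast

end

locale split_rba6 = standard_rba scl mul ident star b 6 \<delta> + split_algebra scl mul ident \<Psi>
  for scl :: "complex \<Rightarrow> 'a::ab_group_add \<Rightarrow> 'a" and mul ident star b \<delta> \<Psi> +
  fixes m\<^sub>\<phi> m\<^sub>\<chi> :: real
  assumes split_star: "\<Psi> (star x) = split_star (\<Psi> x)"
    and split_degree: "\<Psi> x $ 0 = \<delta> x"
    and split_real: "i < 6 \<Longrightarrow> \<Psi> (b i) $ a \<in> \<real>"
    and m_pos: "0 < m\<^sub>\<phi>" "0 < m\<^sub>\<chi>"
    and trace_formula: "complex_of_real order * tr x = \<Psi> x $ 0 + complex_of_real m\<^sub>\<phi> * \<Psi> x $ 1
       + 2 * complex_of_real m\<^sub>\<chi> * \<Psi> x $ 2"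
begin

text \<open>The values at \<open>ident\<close> tell the degrees apart, so the characters
  \<open>\<phi>\<close> and \<open>chi\<close> are forced, and evaluation at preimages of unit
  vectors yields the multiplicities.\<close>

lemma has_character_table_iff:
  "has_character_table T \<longleftrightarrow> (\<forall>i<6. row_\<delta> T i = \<delta> (b i) \<and> row_\<phi> T i = \<Psi> (b i) $ 1 \<and> row_\<chi> T i = 2 * \<Psi> (b i) $ 2)
     \<and> mult_\<delta> T = 1 \<and> mult_\<phi> T = complex_of_real m\<^sub>\<phi> \<and> mult_\<chi> T = complex_of_real m\<^sub>\<chi>"
proof
  have \<delta>: "\<delta> = (\<lambda>x. \<Psi> x $ 0)"
    by (simp add: split_degree)
  have ft: "feasible_trace x = \<Psi> x $ 0 + complex_of_real m\<^sub>\<phi> * \<Psi> x $ 1 + 2 * complex_of_real m\<^sub>\<chi> * \<Psi> x $ 2" for x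
    by (simp add: feasible_trace_eq trace_formula)
  {
    assume "has_character_table T"
    then obtain \<phi> chi where *: "irreducible_character 1 \<phi>" "\<phi> \<noteq> \<delta>" "irreducible_character 2 chi"
      "\<forall>i<6. row_\<delta> T i = \<delta> (b i) \<and> row_\<phi> T i = \<phi> (b i) \<and> row_\<chi> T i = chi (b i)"
      "\<And>x. feasible_trace x = mult_\<delta> T * \<delta> x + mult_\<phi> T * \<phi> x + mult_\<chi> T * chi x"
      unfolding has_character_table_def by blast
    have "\<phi> ident = 1" "chi ident = 2"
      using irreducible_character_ident *(1,3) by force+
    then have "\<phi> \<noteq> (\<lambda>x. 2 * \<Psi> x $ 2)" "chi \<noteq> (\<lambda>x. \<Psi> x $ 0)" "chi \<noteq> (\<lambda>x. \<Psi> x $ 1)"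
      by (auto simp: split_simps)
    then have \<phi>: "\<phi> = (\<lambda>x. \<Psi> x $ 1)" and chi: "chi = (\<lambda>x. 2 * \<Psi> x $ 2)"
      using irreducible_character_cases[OF *(1)] irreducible_character_cases[OF *(3)] *(2) \<delta> by auto
    have eq: "\<Psi> x $ 0 + complex_of_real m\<^sub>\<phi> * \<Psi> x $ 1 + 2 * complex_of_real m\<^sub>\<chi> * \<Psi> x $ 2
        = mult_\<delta> T * \<Psi> x $ 0 + mult_\<phi> T * \<Psi> x $ 1 + mult_\<chi> T * (2 * \<Psi> x $ 2)" for x
      using *(5)[of x] by (simp only: ft \<phi> chi split_degree)
    have "mult_\<delta> T = 1" "mult_\<phi> T = complex_of_real m\<^sub>\<phi>" "mult_\<chi> T = complex_of_real m\<^sub>\<chi>"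
      using eq[of "lift (vec6 1 0 0 0 0 0)"] eq[of "lift (vec6 0 1 0 0 0 0)"] eq[of "lift (vec6 0 0 1 0 0 0)"]
      by simp_all
    then show "(\<forall>i<6. row_\<delta> T i = \<delta> (b i) \<and> row_\<phi> T i = \<Psi> (b i) $ 1 \<and> row_\<chi> T i = 2 * \<Psi> (b i) $ 2)
     \<and> mult_\<delta> T = 1 \<and> mult_\<phi> T = complex_of_real m\<^sub>\<phi> \<and> mult_\<chi> T = complex_of_real m\<^sub>\<chi>"
      using *(4) \<phi> chi by auto
  next
    assume *: "(\<forall>i<6. row_\<delta> T i = \<delta> (b i) \<and> row_\<phi> T i = \<Psi> (b i) $ 1 \<and> row_\<chi> T i = 2 * \<Psi> (b i) $ 2)
     \<and> mult_\<delta> T = 1 \<and> mult_\<phi> T = complex_of_real m\<^sub>\<phi> \<and> mult_\<chi> T = complex_of_real m\<^sub>\<chi>"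
    have "\<Psi> (lift (vec6 1 0 0 0 0 0)) $ 0 \<noteq> \<Psi> (lift (vec6 1 0 0 0 0 0)) $ 1"
      by simp
    then have "(\<lambda>x. \<Psi> x $ 1) \<noteq> \<delta>"
      unfolding \<delta> by metis
    then show "has_character_table T"
      unfolding has_character_table_def using * irreducible_character_1 irreducible_character_2 irreducible_characters
      by (intro exI[of _ "\<lambda>x. \<Psi> x $ 1"] exI[of _ "\<lambda>x. 2 * \<Psi> x $ 2"]) (auto simp: ft algebra_simps split_degree simp flip: \<delta>)
  }
qed

end

section \<open>Orthogonality relations\<close>

text \<open>A left inverse of a square matrix is a right inverse. Rows are numbered by naturals and
  columns by the type \<open>6\<close>, so a bijection between the two index sets makes the matrices
  square.\<close>

lemma orthogonality_transpose:
  fixes P R :: "nat \<Rightarrow> 6 \<Rightarrow> real"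
  shows "(\<forall>i<6. \<forall>j<6. (\<Sum>a\<in>UNIV. P i a * R j a) = of_bool (i = j))
     \<longleftrightarrow> (\<forall>a c. (\<Sum>i<6. P i a * R i c) = of_bool (a = c))"
proof -
  obtain h :: "6 \<Rightarrow> nat" where h: "bij_betw h UNIV {..<6}"
    using finite_same_card_bij[of "UNIV :: 6 set" "{..<6 :: nat}"] by auto
  let ?A = "(\<chi> i a. P (h i) a) :: real^6^6" and ?B = "(\<chi> a j. R (h j) a) :: real^6^6"
  have range: "h ` UNIV = {..<6}" and inj: "h i = h j \<longleftrightarrow> i = j" for i j
    using h by (auto simp: bij_betw_def inj_def)
  have "(\<forall>i<6. \<forall>j<6. (\<Sum>a\<in>UNIV. P i a * R j a) = of_bool (i = j))
      \<longleftrightarrow> (\<forall>i\<in>h ` UNIV. \<forall>j\<in>h ` UNIV. (\<Sum>a\<in>UNIV. P i a * R j a) = of_bool (i = j))"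
    unfolding range by blast
  also have "\<dots> \<longleftrightarrow> ?A ** ?B = Finite_Cartesian_Product.mat 1"
    by (simp add: Finite_Cartesian_Product.vec_eq_iff matrix_matrix_mult_def Finite_Cartesian_Product.mat_def inj of_bool_def)
  also have "\<dots> \<longleftrightarrow> ?B ** ?A = Finite_Cartesian_Product.mat 1"
    by (rule matrix_left_right_inverse)
  also have "\<dots> \<longleftrightarrow> (\<forall>c a. (\<Sum>i\<in>UNIV. P (h i) a * R (h i) c) = of_bool (a = c))"
    by (auto simp: Finite_Cartesian_Product.vec_eq_iff matrix_matrix_mult_def Finite_Cartesian_Product.mat_def of_bool_def mult.commute)
  also have "\<dots> \<longleftrightarrow> (\<forall>a c. (\<Sum>i<6. P i a * R i c) = of_bool (a = c))"
    using sum.reindex_bij_betw[OF h, of "\<lambda>i. P i _ * R i _"] by auto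
  finally show ?thesis .
qed

text \<open>The coefficients of the diagonal form \<open>order * tr (mul x (star y))\<close> in
  split coordinates, see \<open>tr_split\<close>. The factor 2 is the trace of the identity matrix
  of size two.\<close>

definition weight :: "real \<Rightarrow> real \<Rightarrow> 6 \<Rightarrow> real" where
  "weight m\<^sub>\<phi> m\<^sub>\<chi> a = (if a = 0 then 1 else if a = 1 then m\<^sub>\<phi> else 2 * m\<^sub>\<chi>)"

lemma weight_simps [simp]: "weight m\<^sub>\<phi> m\<^sub>\<chi> 0 = 1" "weight m\<^sub>\<phi> m\<^sub>\<chi> 1 = m\<^sub>\<phi>" "weight m\<^sub>\<phi> m\<^sub>\<chi> 2 = 2 * m\<^sub>\<chi>"
    "weight m\<^sub>\<phi> m\<^sub>\<chi> 3 = 2 * m\<^sub>\<chi>" "weight m\<^sub>\<phi> m\<^sub>\<chi> 4 = 2 * m\<^sub>\<chi>" "weight m\<^sub>\<phi> m\<^sub>\<chi> 5 = 2 * m\<^sub>\<chi>"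
  by (simp_all add: weight_def)

text \<open>Rows and columns are rescaled by \<open>weight\<close>, \<open>n\<close> and
  \<open>\<delta>\<close> until the relations say that two matrices are inverse to each
  other.\<close>

lemma orthogonality_relations_iff:
  fixes \<beta> :: "nat \<Rightarrow> real^6"
  assumes "0 < n" "0 < m\<^sub>\<phi>" "0 < m\<^sub>\<chi>" "\<And>i. i < 6 \<Longrightarrow> 0 < \<delta> i"
  shows "(\<forall>i<6. \<forall>j<6. (\<Sum>a\<in>UNIV. weight m\<^sub>\<phi> m\<^sub>\<chi> a * \<beta> i $ a * \<beta> j $ a) = (if i = j then n * \<delta> i else 0))
     \<longleftrightarrow> (\<forall>a c. (\<Sum>i<6. \<beta> i $ a * \<beta> i $ c / \<delta> i) = (if a = c then n / weight m\<^sub>\<phi> m\<^sub>\<chi> a else 0))"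
proof -
  let ?w = "weight m\<^sub>\<phi> m\<^sub>\<chi>"
  have w: "0 < ?w a" for a
    using assms by (simp add: weight_def)
  have "(\<Sum>a\<in>UNIV. (?w a * \<beta> i $ a / n) * (\<beta> j $ a / \<delta> j)) = of_bool (i = j)
    \<longleftrightarrow> (\<Sum>a\<in>UNIV. ?w a * \<beta> i $ a * \<beta> j $ a) = (if i = j then n * \<delta> i else 0)" if "i < 6" "j < 6" for i j
  proof -
    have "(\<Sum>a\<in>UNIV. (?w a * \<beta> i $ a / n) * (\<beta> j $ a / \<delta> j)) = (\<Sum>a\<in>UNIV. ?w a * \<beta> i $ a * \<beta> j $ a) / (n * \<delta> j)"
      by (simp add: sum_divide_distrib)
    then show ?thesis
      using assms(1) assms(4)[OF that(2)] by (auto simp: divide_eq_eq)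
  qed
  moreover have "(\<Sum>i<6. (?w a * \<beta> i $ a / n) * (\<beta> i $ c / \<delta> i)) = of_bool (a = c)
    \<longleftrightarrow> (\<Sum>i<6. \<beta> i $ a * \<beta> i $ c / \<delta> i) = (if a = c then n / ?w a else 0)" for a c
  proof -
    have "(\<Sum>i<6. (?w a * \<beta> i $ a / n) * (\<beta> i $ c / \<delta> i)) = (\<Sum>i<6. \<beta> i $ a * \<beta> i $ c / \<delta> i) * (?w a / n)"
      unfolding sum_distrib_right by (intro sum.cong) (auto simp: field_simps)
    then show ?thesis
      using assms(1) w[of a] by (auto simp: field_simps)
  qed
  ultimately show ?thesis
    using orthogonality_transpose[of "\<lambda>i a. ?w a * \<beta> i $ a / n" "\<lambda>j a. \<beta> j $ a / \<delta> j"] by simp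
qed

section \<open>From the algebra to the conditions on its table\<close>

context split_rba6
begin

text \<open>Row \<open>i\<close> holds the coordinates of \<open>b i\<close>. Columns 0 and 1 are
  the characters \<open>\<delta>\<close> and \<open>\<phi>\<close>, column 2 is half of
  \<open>chi\<close>, and columns 3 to 5 are what the table leaves open.\<close>

definition \<beta> :: "nat \<Rightarrow> real^6" where
  "\<beta> i = (\<chi> a. Re (\<Psi> (b i) $ a))"

lemma split_basis: "i < 6 \<Longrightarrow> \<Psi> (b i) $ a = complex_of_real (\<beta> i $ a)"
  using split_real[of i a] by (simp add: \<beta>_def)

lemma \<beta>_deg: "\<beta> i $ 0 = deg i"
  by (simp add: \<beta>_def deg_def split_degree)

lemma \<beta>_ident: "\<beta> 0 = vec6 1 1 1 0 0 0"
  by (simp add: vec6_eq_iff \<beta>_def b_0 split_ident split_one_def)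

lemma tr_split:
  "complex_of_real order * tr (mul x (star y)) = (\<Sum>a\<in>UNIV. complex_of_real (weight m\<^sub>\<phi> m\<^sub>\<chi> a) * \<Psi> x $ a * cnj (\<Psi> y $ a))"
  unfolding trace_formula split_mul split_star
  by (simp add: split_mul_def split_star_def sum_6 algebra_simps)

lemma row_orthogonality:
  assumes "i < 6" "j < 6"
  shows "(\<Sum>a\<in>UNIV. weight m\<^sub>\<phi> m\<^sub>\<chi> a * \<beta> i $ a * \<beta> j $ a) = (if i = j then order * deg i else 0)"
proof -
  have "star_index j = star_index i \<longleftrightarrow> i = j"
    using star_index_star_index assms by metis
  then have "complex_of_real order * tr (mul (b i) (star (b j))) = (if i = j then order * deg i else 0)"
    using assms by (simp add: star_basis_index star_index_less tr_basis_mul)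
  moreover have "complex_of_real order * tr (mul (b i) (star (b j)))
      = complex_of_real (\<Sum>a\<in>UNIV. weight m\<^sub>\<phi> m\<^sub>\<chi> a * \<beta> i $ a * \<beta> j $ a)"
    unfolding tr_split of_real_sum by (intro sum.cong) (auto simp: split_basis assms)
  ultimately show ?thesis
    by (simp only: of_real_eq_iff)
qed

lemma column_orthogonality:
  "(\<Sum>i<6. \<beta> i $ a * \<beta> i $ c / deg i) = (if a = c then order / weight m\<^sub>\<phi> m\<^sub>\<chi> a else 0)"
proof -
  have "\<forall>i<6. \<forall>j<6. (\<Sum>a\<in>UNIV. weight m\<^sub>\<phi> m\<^sub>\<chi> a * \<beta> i $ a * \<beta> j $ a) = (if i = j then order * deg i else 0)"
    using row_orthogonality by simp
  then show ?thesis
    by (subst (asm) orthogonality_relations_iff[OF order_pos m_pos deg_pos]) simp_all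
qed

end

locale labelled_split_rba6 = split_rba6 +
  assumes labelled: "labelled star b"
begin

lemmas star_index_labelled = star_index_of_labelled[OF labelled order_refl]

lemma \<beta>_star: "i < 6 \<Longrightarrow> \<beta> (star_index i) = vec6 (\<beta> i $ 0) (\<beta> i $ 1) (\<beta> i $ 2) (\<beta> i $ 3) (\<beta> i $ 4) (- \<beta> i $ 5)"
  by (simp add: vec6_eq_iff \<beta>_def split_star split_star_def flip: star_basis_index)

lemma \<beta>_labelled: "\<beta> 1 $ 5 = 0" "\<beta> 2 $ 5 = 0" "\<beta> 3 $ 5 = 0" "\<beta> 5 = vec6 (\<beta> 4 $ 0) (\<beta> 4 $ 1) (\<beta> 4 $ 2) (\<beta> 4 $ 3) (\<beta> 4 $ 4) (- \<beta> 4 $ 5)"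
  using \<beta>_star[of 1] \<beta>_star[of 2] \<beta>_star[of 3] \<beta>_star[of 4]
  by (simp_all add: star_index_labelled vec6_eq_iff del: One_nat_def)

lemma deg_5: "deg 5 = deg 4"
  using deg_star_index[of 4] by (simp add: star_index_labelled)

lemma table_admissible:
  assumes "has_character_table T"
  shows "admissible_table T"
proof -
  have d: "0 < deg 1" "0 < deg 2" "0 < deg 3" "0 < deg 4"
    by (auto intro!: deg_pos)
  have \<beta>5: "\<beta> 5 $ 1 = \<beta> 4 $ 1" "\<beta> 5 $ 2 = \<beta> 4 $ 2"
    by (simp_all add: \<beta>_labelled)
  have order: "order = 1 + deg 1 + deg 2 + deg 3 + 2 * deg 4"
    by (simp add: order_def sum_lessThan_6 deg_0 deg_5)
  have \<phi>_sum: "1 + \<beta> 1 $ 1 + \<beta> 2 $ 1 + \<beta> 3 $ 1 + 2 * \<beta> 4 $ 1 = 0"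
    using column_orthogonality[of 0 1] d
    by (simp add: sum_lessThan_6 \<beta>_deg deg_0 deg_5 \<beta>5 \<beta>_ident del: One_nat_def)
  \<comment> \<open>If all ratios were equal to \<open>c\<close>, orthogonality of column 2 to
    columns 0 and 1 would force \<open>c = 1\<close>. Then \<open>\<phi>\<close> would agree with
    the positive \<open>\<delta>\<close>, contrary to its sum being 0.\<close>
  have ex: "\<exists>i\<in>{1..3}. \<beta> i $ 1 / deg i \<noteq> \<beta> 4 $ 1 / deg 4"
  proof (rule ccontr)
    define c where "c = \<beta> 4 $ 1 / deg 4"
    assume "\<not> ?thesis"
    then have c: "\<beta> 1 $ 1 / deg 1 = c" "\<beta> 2 $ 1 / deg 2 = c" "\<beta> 3 $ 1 / deg 3 = c"
      by (auto simp: c_def)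
    have "1 + c * (\<beta> 1 $ 2 + \<beta> 2 $ 2 + \<beta> 3 $ 2 + 2 * \<beta> 4 $ 2) = 0"
    proof -
      have "\<beta> i $ 1 * x / deg i = (\<beta> i $ 1 / deg i) * x" for i x
        by simp
      then show ?thesis
        using column_orthogonality[of 1 2]
        by (simp only: sum_lessThan_6 \<beta>5 deg_5 c c_def[symmetric]) (simp add: deg_0 \<beta>_ident algebra_simps)
    qed
    moreover have "1 + (\<beta> 1 $ 2 + \<beta> 2 $ 2 + \<beta> 3 $ 2 + 2 * \<beta> 4 $ 2) = 0"
      using column_orthogonality[of 0 2] d
      by (simp add: sum_lessThan_6 \<beta>_deg deg_0 deg_5 \<beta>5 \<beta>_ident del: One_nat_def)
    then have "\<beta> 1 $ 2 + \<beta> 2 $ 2 + \<beta> 3 $ 2 + 2 * \<beta> 4 $ 2 = - 1"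
      by simp
    ultimately have "c = 1"
      by simp
    then have "\<beta> 1 $ 1 = deg 1" "\<beta> 2 $ 1 = deg 2" "\<beta> 3 $ 1 = deg 3" "\<beta> 4 $ 1 = deg 4"
      using c d c_def by (simp_all add: divide_eq_1_iff del: One_nat_def)
    then show False
      using \<phi>_sum d by linarith
  qed
  have sum: "(\<Sum>i=0..5. (\<beta> i $ 1)\<^sup>2 / deg i) = order / m\<^sub>\<phi>"
  proof -
    have "{0..5} = {..<6::nat}" by auto
    then show ?thesis
      using column_orthogonality[of 1 1] by (simp add: power2_eq_square)
  qed
  \<comment> \<open>Orthogonality of row \<open>i\<close> to row 0, which is supported on the
    columns 0, 1, 2. It yields the values of \<open>chi\<close>, and for \<open>i = 0\<close> the
    formula for \<open>m\<^sub>\<chi>\<close>.\<close>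
  have \<chi>: "deg i + m\<^sub>\<phi> * \<beta> i $ 1 + 2 * m\<^sub>\<chi> * \<beta> i $ 2 = (if i = 0 then order else 0)" if "i < 6" for i
    using row_orthogonality[OF that, of 0] by (simp add: sum_6 \<beta>_ident \<beta>_deg deg_0)
  have *: "(\<forall>i<6. row_\<delta> T i = \<delta> (b i) \<and> row_\<phi> T i = \<Psi> (b i) $ 1 \<and> row_\<chi> T i = 2 * \<Psi> (b i) $ 2)
     \<and> mult_\<delta> T = 1 \<and> mult_\<phi> T = complex_of_real m\<^sub>\<phi> \<and> mult_\<chi> T = complex_of_real m\<^sub>\<chi>"
    using assms unfolding has_character_table_iff .
  show ?thesis
    unfolding admissible_table_def
  proof (intro exI conjI)
    show "\<forall>i<6. row_\<delta> T i = complex_of_real (deg i) \<and> row_\<phi> T i = complex_of_real (\<beta> i $ 1) \<and>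
        row_\<chi> T i = complex_of_real (2 * \<beta> i $ 2)"
      using * by (simp add: degree_basis split_basis)
    show "mult_\<delta> T = 1" "mult_\<phi> T = complex_of_real m\<^sub>\<phi>" "mult_\<chi> T = complex_of_real m\<^sub>\<chi>"
      using * by auto
    show "\<beta> 0 $ 1 = 1" "2 * \<beta> 0 $ 2 = 2"
      by (simp_all add: \<beta>_ident)
    show "\<forall>i\<in>{1..4}. 0 < deg i"
      by (auto intro!: deg_pos)
    show "m\<^sub>\<phi> = order / (\<Sum>i = 0..5. (\<beta> i $ 1)\<^sup>2 / deg i)"
      unfolding sum using order_pos by simp
    show "m\<^sub>\<chi> = (order - 1 - m\<^sub>\<phi>) / 2"
      using \<chi>[of 0] by (simp add: \<beta>_ident deg_0)
    show "\<forall>i\<in>{1..4}. 2 * \<beta> i $ 2 = (- deg i - m\<^sub>\<phi> * \<beta> i $ 1) / m\<^sub>\<chi>"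
    proof
      fix i :: nat
      assume "i \<in> {1..4}"
      then show "2 * \<beta> i $ 2 = (- deg i - m\<^sub>\<phi> * \<beta> i $ 1) / m\<^sub>\<chi>"
        using \<chi>[of i] m_pos by (simp add: field_simps)
    qed
  qed (fact deg_0 deg_5 \<beta>5 \<phi>_sum ex order | simp add: \<beta>5)+
qed

end

section \<open>Completing a table to an orthogonal coordinate matrix\<close>

lemma sum_squares_div_gt:
  fixes x d :: "'i \<Rightarrow> real"
  assumes "finite I" "\<And>i. i \<in> I \<Longrightarrow> 0 < d i" "i \<in> I" "j \<in> I" "x i / d i \<noteq> x j / d j"
  shows "(\<Sum>i\<in>I. x i)\<^sup>2 / (\<Sum>i\<in>I. d i) < (\<Sum>i\<in>I. (x i)\<^sup>2 / d i)"
proof -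
  define N where "N = (\<Sum>i\<in>I. d i)"
  define t where "t = (\<Sum>i\<in>I. x i) / N"
  have N: "0 < N"
    unfolding N_def using assms by (intro sum_pos) auto
  have "\<exists>i\<in>I. x i / d i \<noteq> t"
    using assms by metis
  then obtain k where k: "k \<in> I" "x k / d k \<noteq> t" by blast
  \<comment> \<open>The weighted squared deviation of the ratios from their mean \<open>t\<close>;
    it is positive because two ratios differ.\<close>
  have "0 < (\<Sum>i\<in>I. d i * (x i / d i - t)\<^sup>2)"
    using assms k by (intro sum_pos2[of _ k]) (auto simp: less_imp_le)
  also have "\<dots> = (\<Sum>i\<in>I. (x i)\<^sup>2 / d i - 2 * t * x i + t\<^sup>2 * d i)"
    using assms(2) by (intro sum.cong) (force simp: power2_eq_square field_simps)+
  also have "\<dots> = (\<Sum>i\<in>I. (x i)\<^sup>2 / d i) - 2 * t * (\<Sum>i\<in>I. x i) + t\<^sup>2 * N"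
    by (simp add: sum.distrib sum_subtractf sum_distrib_left N_def)
  also have "\<dots> = (\<Sum>i\<in>I. (x i)\<^sup>2 / d i) - (\<Sum>i\<in>I. x i)\<^sup>2 / N"
    using N by (simp add: t_def power2_eq_square field_simps)
  finally show ?thesis
    by (simp add: N_def)
qed

lemma orthogonal_vector_exists:
  fixes S :: "'n::euclidean_space set"
  assumes "finite S" "card S < DIM('n)"
  obtains x where "inner x x = 1" "\<And>y. y \<in> S \<Longrightarrow> inner x y = 0"
proof -
  have "dim S < DIM('n)"
    using dim_le_card'[OF assms(1)] assms(2) by linarith
  then obtain x where x: "x \<noteq> 0" "\<And>y. y \<in> span S \<Longrightarrow> Linear_Algebra.orthogonal x y"
    using orthogonal_to_subspace_exists by blast
  show ?thesis
  proof
    show "inner (x /\<^sub>R norm x) (x /\<^sub>R norm x) = 1"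
      using x(1) by (simp add: dot_square_norm power2_eq_square)
    show "inner (x /\<^sub>R norm x) y = 0" if "y \<in> S" for y
      using x(2)[of y] that span_superset by (auto simp: Linear_Algebra.orthogonal_def)
  qed
qed

lemma inner_6: "inner x y = x $ 0 * y $ 0 + x $ 1 * y $ 1 + x $ 2 * y $ 2 + x $ 3 * y $ 3 + x $ 4 * y $ 4 + x $ 5 * y $ 5"
  for x y :: "real^6"
  by (simp add: inner_vec_def sum_6)

text \<open>The character values supply three of the six orthogonal columns. The skew column is forced,
  and the remaining two span the orthogonal complement of the others.\<close>

lemma coordinates_exist:
  fixes \<delta> \<phi> chi :: "nat \<Rightarrow> real"
  assumes \<delta>0: "\<delta> 0 = 1" "\<phi> 0 = 1" "chi 0 = 2" "\<delta> 5 = \<delta> 4" "\<phi> 5 = \<phi> 4" "chi 5 = chi 4"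
    and pos: "\<forall>i\<in>{1..4}. 0 < \<delta> i"
    and \<phi>_sum: "1 + \<phi> 1 + \<phi> 2 + \<phi> 3 + 2 * \<phi> 4 = 0"
    and ratio: "\<exists>i\<in>{1..3}. \<phi> i / \<delta> i \<noteq> \<phi> 4 / \<delta> 4"
    and n: "n = 1 + \<delta> 1 + \<delta> 2 + \<delta> 3 + 2 * \<delta> 4"
    and m\<phi>: "m\<^sub>\<phi> = n / (\<Sum>i=0..5. (\<phi> i)\<^sup>2 / \<delta> i)"
    and m\<chi>: "m\<^sub>\<chi> = (n - 1 - m\<^sub>\<phi>) / 2"
    and chi: "\<forall>i\<in>{1..4}. chi i = (- \<delta> i - m\<^sub>\<phi> * \<phi> i) / m\<^sub>\<chi>"
  obtains \<beta> :: "nat \<Rightarrow> real^6" where "0 < m\<^sub>\<phi>" "0 < m\<^sub>\<chi>"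
    "\<And>a c. (\<Sum>i<6. \<beta> i $ a * \<beta> i $ c / \<delta> i) = (if a = c then n / weight m\<^sub>\<phi> m\<^sub>\<chi> a else 0)"
    "\<And>i. \<beta> i $ 0 = \<delta> i" "\<And>i. \<beta> i $ 1 = \<phi> i" "\<And>i. \<beta> i $ 2 = chi i / 2"
    "\<beta> 0 = vec6 1 1 1 0 0 0" "\<beta> 1 $ 5 = 0" "\<beta> 2 $ 5 = 0" "\<beta> 3 $ 5 = 0"
    "\<beta> 5 = vec6 (\<beta> 4 $ 0) (\<beta> 4 $ 1) (\<beta> 4 $ 2) (\<beta> 4 $ 3) (\<beta> 4 $ 4) (- \<beta> 4 $ 5)"
proof -
  have d: "0 < \<delta> 1" "0 < \<delta> 2" "0 < \<delta> 3" "0 < \<delta> 4"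
    using pos by auto
  have "0 < n"
    using d n by simp
  define S where "S = (\<Sum>i=0..5. (\<phi> i)\<^sup>2 / \<delta> i)"
  have range: "{0..5} = {..<6::nat}" "{1..5} = {1,2,3,4,5::nat}"
    by auto
  have S: "S = 1 + (\<Sum>i=1..5. (\<phi> i)\<^sup>2 / \<delta> i)"
    unfolding S_def range sum_lessThan_6 by (simp add: \<delta>0)
  have dpos: "0 < \<delta> i" if "i \<in> {1..5}" for i
    using that d unfolding range by (auto simp: \<delta>0)
  obtain i where "i \<in> {1..3}" "\<phi> i / \<delta> i \<noteq> \<phi> 4 / \<delta> 4"
    using ratio by blast
  then have "(\<Sum>i=1..5. \<phi> i)\<^sup>2 / (\<Sum>i=1..5. \<delta> i) < (\<Sum>i=1..5. (\<phi> i)\<^sup>2 / \<delta> i)"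
    using dpos by (intro sum_squares_div_gt[where i = i and j = 4]) auto
  moreover have "(\<Sum>i=1..5. \<phi> i) = - 1" "(\<Sum>i=1..5. \<delta> i) = n - 1"
    using \<phi>_sum n unfolding range by (simp_all add: \<delta>0)
  ultimately have S_gt: "1 / (n - 1) < S - 1"
    by (simp add: S)
  have "1 < n"
    using n d by simp
  \<comment> \<open>This is \<open>0 < m\<^sub>\<chi>\<close> with the denominator \<open>S\<close>
    cleared, and the place where the condition on the ratios is used.\<close>
  then have "n < (n - 1) * S"
    using S_gt by (simp add: field_simps)
  moreover have "0 < S"
    using S_gt \<open>1 < n\<close> by (smt (verit) zero_less_divide_iff)
  ultimately have m: "0 < m\<^sub>\<phi>" "0 < m\<^sub>\<chi>"
    using \<open>0 < n\<close> unfolding m\<chi> m\<phi> S_def[symmetric] by (simp_all add: field_simps)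
  have S_eq: "S = n / m\<^sub>\<phi>"
    using \<open>0 < n\<close> \<open>0 < S\<close> unfolding m\<phi> S_def[symmetric] by simp
  \<comment> \<open>The squared norm required of each of the columns 2 to 5.\<close>
  define \<kappa> where "\<kappa> = n / (2 * m\<^sub>\<chi>)"
  have "0 < \<kappa>"
    using \<open>0 < n\<close> m by (simp add: \<kappa>_def)
  define s where "s i = sqrt (\<delta> i)" for i
  have s: "s i * s i = \<delta> i" "0 < s i" if "i < 6" for i
    using that d \<delta>0 unfolding s_def by (auto elim!: less_6_cases)
  have s5: "s 5 = s 4" and s0: "s 0 = 1"
    by (simp_all add: s_def \<delta>0)
  \<comment> \<open>Dividing column entries by \<open>s i\<close> turns the weighted product into
    the Euclidean one. \<open>A0\<close> and \<open>A1\<close> are the columns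
    \<open>\<delta>\<close> and \<open>\<phi>\<close>, and \<open>A5\<close> is the direction of the
    skew column. \<open>A2\<close> may replace the column of \<open>chi\<close>, a combination of
    \<open>A2\<close>, \<open>A0\<close> and \<open>A1\<close>; orthogonality to it also makes row 0
    vanish in the new columns.\<close>
  define A0 A1 A2 A5 :: "real^6" where "A0 = vec6 (s 0) (s 1) (s 2) (s 3) (s 4) (s 5)"
    and "A1 = vec6 (\<phi> 0 / s 0) (\<phi> 1 / s 1) (\<phi> 2 / s 2) (\<phi> 3 / s 3) (\<phi> 4 / s 4) (\<phi> 5 / s 5)"
    and "A2 = vec6 1 0 0 0 0 0" and "A5 = vec6 0 0 0 0 1 (-1)"
  note A = A0_def A1_def A2_def A5_def
  have card: "card {a, b, c, d, f} < DIM(real^6)" "card {a, b, c, d} < DIM(real^6)" for a b c d f :: "real^6"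
    by (simp_all add: card_insert_if)
  obtain x :: "real^6" where x: "inner x x = 1" "\<And>y. y \<in> {A0, A1, A2, A5} \<Longrightarrow> inner x y = 0"
    using orthogonal_vector_exists[OF _ card(2)] by blast
  obtain y :: "real^6" where y: "inner y y = 1" "\<And>z. z \<in> {A0, A1, A2, A5, x} \<Longrightarrow> inner y z = 0"
    using orthogonal_vector_exists[OF _ card(1)] by blast
  \<comment> \<open>Chosen so that the skew column, with entries \<open>r\<close> and
    \<open>- r\<close> at 4 and 5, has squared norm \<open>\<kappa>\<close>.\<close>
  define r where "r = sqrt (\<kappa> * \<delta> 4 / 2)"
  have r: "r * r = \<kappa> * \<delta> 4 / 2"
    using \<open>0 < \<kappa>\<close> d by (simp add: r_def)
  define t where "t = sqrt \<kappa>"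
  have t: "t * t = \<kappa>"
    using \<open>0 < \<kappa>\<close> by (simp add: t_def)
  define p where "p z i = t * (s i * z $ of_nat i)" for z :: "real^6" and i :: nat
  define q where "q i = (if i = 4 then r else if i = 5 then - r else 0)" for i :: nat
  define \<beta> :: "nat \<Rightarrow> real^6" where "\<beta> i = vec6 (\<delta> i) (\<phi> i) (chi i / 2) (p x i) (p y i) (q i)" for i
  define ip where "ip u v = (\<Sum>i<6. u i * v i / \<delta> i)" for u v :: "nat \<Rightarrow> real"
  have ip_commute: "ip u v = ip v u" for u v
    by (simp add: ip_def mult.commute)
  have \<delta>_nz: "\<delta> i \<noteq> 0" if "i < 6" for i
    using s[OF that] by auto
  have ip\<delta>: "ip \<delta> v = (\<Sum>i<6. v i)" for v
    unfolding ip_def using \<delta>_nz by (intro sum.cong) auto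
  have ip\<delta>\<delta>: "ip \<delta> \<delta> = n"
    unfolding ip\<delta> by (simp add: sum_lessThan_6 \<delta>0 n)
  have ip\<delta>\<phi>: "ip \<delta> \<phi> = 0"
    unfolding ip\<delta> using \<phi>_sum by (simp add: sum_lessThan_6 \<delta>0)
  have ip\<phi>\<phi>: "ip \<phi> \<phi> = n / m\<^sub>\<phi>"
    using S_eq unfolding S_def range ip_def by (simp add: power2_eq_square)
  \<comment> \<open>The indicator term extends the formula for \<open>chi\<close> to
    \<open>i = 0\<close>, where it amounts to the definition of
    \<open>m\<^sub>\<chi>\<close>.\<close>
  have chi_eq: "chi i / 2 = (n * of_bool (i = 0) - \<delta> i - m\<^sub>\<phi> * \<phi> i) / (2 * m\<^sub>\<chi>)" if "i < 6" for i
  proof -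
    have c: "chi i = (- \<delta> i - m\<^sub>\<phi> * \<phi> i) / m\<^sub>\<chi>" if "i \<in> {1..4}" for i
      using chi that by blast
    have "m\<^sub>\<chi> \<noteq> 0" "2 * m\<^sub>\<chi> = n - 1 - m\<^sub>\<phi>"
      using m(2) m\<chi> by auto
    then show ?thesis
      using that c[of 1] c[of 2] c[of 3] c[of 4] by (elim less_6_cases) (simp_all add: \<delta>0 del: One_nat_def)
  qed
  have ip_chi: "ip (\<lambda>i. chi i / 2) v = (n * v 0 - ip \<delta> v - m\<^sub>\<phi> * ip \<phi> v) / (2 * m\<^sub>\<chi>)" for v
  proof -
    have "ip (\<lambda>i. chi i / 2) v
        = (\<Sum>i<6. (n * (of_bool (i = 0) * v i / \<delta> i) - \<delta> i * v i / \<delta> i - m\<^sub>\<phi> * (\<phi> i * v i / \<delta> i)) / (2 * m\<^sub>\<chi>))"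
      unfolding ip_def
    proof (intro sum.cong refl)
      fix i :: nat
      assume "i \<in> {..<6}"
      then show "chi i / 2 * v i / \<delta> i
          = (n * (of_bool (i = 0) * v i / \<delta> i) - \<delta> i * v i / \<delta> i - m\<^sub>\<phi> * (\<phi> i * v i / \<delta> i)) / (2 * m\<^sub>\<chi>)"
        using \<delta>_nz[of i] m(2) by (subst chi_eq) (simp_all add: field_simps)
    qed
    also have "\<dots> = (n * (\<Sum>i<6. of_bool (i = 0) * v i / \<delta> i) - ip \<delta> v - m\<^sub>\<phi> * ip \<phi> v) / (2 * m\<^sub>\<chi>)"
      unfolding ip_def sum_distrib_left sum_subtractf[symmetric] sum_divide_distrib[symmetric] ..
    also have "(\<Sum>i<6. of_bool (i = 0) * v i / \<delta> i) = v 0"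
      by (simp add: sum_lessThan_6 \<delta>0)
    finally show ?thesis .
  qed
  have ip_p: "ip \<delta> (p z) = t * inner z A0" "ip \<phi> (p z) = t * inner z A1" "ip (p z) (p w) = \<kappa> * inner z w" for z w
  proof -
    have 1: "u * (t * (s i * z $ of_nat i)) / \<delta> i = t * (z $ of_nat i * (u / s i))" if "i < 6" for u i
      unfolding s(1)[OF that, symmetric] using s(2)[OF that] by simp
    have 2: "\<delta> i / s i = s i" if "i < 6" for i
      unfolding s(1)[OF that, symmetric] using s(2)[OF that] by simp
    have 3: "t * (s i * z $ of_nat i) * (t * (s i * w $ of_nat i)) / \<delta> i = t * t * (z $ of_nat i * w $ of_nat i)" if "i < 6" for i
      unfolding s(1)[OF that, symmetric] using s(2)[OF that] by simp
    have "ip \<delta> (p z) = (\<Sum>i<6. t * (z $ of_nat i * s i))"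
      unfolding ip_def p_def by (intro sum.cong) (auto simp: 1 2)
    then show "ip \<delta> (p z) = t * inner z A0"
      by (simp add: sum_lessThan_6 inner_6 A0_def distrib_left)
    have "ip \<phi> (p z) = (\<Sum>i<6. t * (z $ of_nat i * (\<phi> i / s i)))"
      unfolding ip_def p_def by (intro sum.cong) (auto simp: 1)
    then show "ip \<phi> (p z) = t * inner z A1"
      by (simp add: sum_lessThan_6 inner_6 A1_def distrib_left)
    have "ip (p z) (p w) = (\<Sum>i<6. t * t * (z $ of_nat i * w $ of_nat i))"
      unfolding ip_def p_def by (intro sum.cong) (auto simp: 3)
    then show "ip (p z) (p w) = \<kappa> * inner z w"
      by (simp add: sum_lessThan_6 inner_6 t distrib_left)
  qed
  have ip_q: "ip u q = r * (u 4 - u 5) / \<delta> 4" for u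
    by (simp add: ip_def sum_lessThan_6 q_def \<delta>0 algebra_simps diff_divide_distrib)
  have xy0: "z $ 0 = 0" "z $ 4 = z $ 5" if "inner z A2 = 0" "inner z A5 = 0" for z
    using that by (simp_all add: inner_6 A)
  have p5: "p z 0 = 0" "p z 4 = p z 5" if "inner z A2 = 0" "inner z A5 = 0" for z
    using xy0[OF that] by (simp_all add: p_def s5)
  note px = p5[OF x(2) x(2)] p5[OF y(2) y(2)]
  have ips: "ip \<delta> (p x) = 0" "ip \<delta> (p y) = 0" "ip \<phi> (p x) = 0" "ip \<phi> (p y) = 0" "ip (p x) (p x) = \<kappa>"
    "ip (p y) (p y) = \<kappa>" "ip (p x) (p y) = 0" "ip \<delta> q = 0" "ip \<phi> q = 0" "ip (p x) q = 0" "ip (p y) q = 0"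
    using x y px inner_commute[of x y]
    by (simp_all add: ip_p ip_q \<delta>0 q_def)
  have ipq: "ip q q = \<kappa>"
    using r d(4) by (simp add: ip_q q_def field_simps)
  have ips2: "ip (\<lambda>i. chi i / 2) \<delta> = 0" "ip (\<lambda>i. chi i / 2) \<phi> = 0" "ip (\<lambda>i. chi i / 2) (\<lambda>i. chi i / 2) = \<kappa>"
    "ip (\<lambda>i. chi i / 2) (p x) = 0" "ip (\<lambda>i. chi i / 2) (p y) = 0" "ip (\<lambda>i. chi i / 2) q = 0"
  proof -
    show 1: "ip (\<lambda>i. chi i / 2) \<delta> = 0" "ip (\<lambda>i. chi i / 2) \<phi> = 0"
      using m by (simp_all add: ip_chi ip\<delta>\<delta> ip\<delta>\<phi> ip\<phi>\<phi> ip_commute[of \<phi> \<delta>] \<delta>0)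
    show "ip (\<lambda>i. chi i / 2) (\<lambda>i. chi i / 2) = \<kappa>"
      using ip_chi[of "\<lambda>i. chi i / 2"] 1
      by (simp add: ip_commute[of \<phi> "\<lambda>i. chi i / 2"] ip_commute[of \<delta> "\<lambda>i. chi i / 2"] \<delta>0 \<kappa>_def)
    show "ip (\<lambda>i. chi i / 2) (p x) = 0" "ip (\<lambda>i. chi i / 2) (p y) = 0" "ip (\<lambda>i. chi i / 2) q = 0"
      using x y px by (simp_all add: ip_chi ips) (simp add: q_def)
  qed
  note all = ips ipq ips2 ip\<delta>\<delta> ip\<delta>\<phi> ip\<phi>\<phi>
  show ?thesis
  proof (rule that[OF m])
    have "(\<Sum>i<6. \<beta> i $ a * \<beta> i $ c / \<delta> i) = ip (\<lambda>i. \<beta> i $ a) (\<lambda>i. \<beta> i $ c)" for a c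
      by (simp add: ip_def)
    moreover have "\<forall>a c. ip (\<lambda>i. \<beta> i $ a) (\<lambda>i. \<beta> i $ c) = (if a = c then n / weight m\<^sub>\<phi> m\<^sub>\<chi> a else 0)"
      unfolding forall_6 \<beta>_def vec6_nth
      by (simp add: all all[THEN ip_commute[THEN trans]] \<kappa>_def)
    ultimately show "(\<Sum>i<6. \<beta> i $ a * \<beta> i $ c / \<delta> i) = (if a = c then n / weight m\<^sub>\<phi> m\<^sub>\<chi> a else 0)" for a c
      by simp
    show "\<beta> 0 = vec6 1 1 1 0 0 0" "\<beta> 5 = vec6 (\<beta> 4 $ 0) (\<beta> 4 $ 1) (\<beta> 4 $ 2) (\<beta> 4 $ 3) (\<beta> 4 $ 4) (- \<beta> 4 $ 5)"
      using px x y by (simp_all add: \<beta>_def \<delta>0 q_def)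
  qed (simp_all add: \<beta>_def q_def)
qed

section \<open>Realising admissible tables\<close>

locale rba6_coordinates =
  fixes \<beta> :: "nat \<Rightarrow> real^6" and n m\<^sub>\<phi> m\<^sub>\<chi> :: real
  assumes n_pos: "0 < n" and m_pos: "0 < m\<^sub>\<phi>" "0 < m\<^sub>\<chi>"
    and degree_pos: "i < 6 \<Longrightarrow> 0 < \<beta> i $ 0"
    and columns: "(\<Sum>i<6. \<beta> i $ a * \<beta> i $ c / \<beta> i $ 0) = (if a = c then n / weight m\<^sub>\<phi> m\<^sub>\<chi> a else 0)"
    and \<beta>_0: "\<beta> 0 = vec6 1 1 1 0 0 0"
    and \<beta>_sym: "\<beta> 1 $ 5 = 0" "\<beta> 2 $ 5 = 0" "\<beta> 3 $ 5 = 0"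
    and \<beta>_5: "\<beta> 5 = vec6 (\<beta> 4 $ 0) (\<beta> 4 $ 1) (\<beta> 4 $ 2) (\<beta> 4 $ 3) (\<beta> 4 $ 4) (- \<beta> 4 $ 5)"
begin

definition basis :: "nat \<Rightarrow> complex^6" where
  "basis i = (\<chi> a. complex_of_real (\<beta> i $ a))"

text \<open>The weighted pairing of \<open>x\<close> with \<open>basis k\<close>, divided by the
  squared norm \<open>n * \<beta> k $ 0\<close> of \<open>basis k\<close>.\<close>

definition coordinate :: "complex^6 \<Rightarrow> nat \<Rightarrow> complex" where
  "coordinate x k = (\<Sum>a\<in>UNIV. complex_of_real (weight m\<^sub>\<phi> m\<^sub>\<chi> a * \<beta> k $ a / (n * \<beta> k $ 0)) * x $ a)"

definition star_perm :: "nat \<Rightarrow> nat" where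
  "star_perm i = (if i = 4 then 5 else if i = 5 then 4 else i)"

lemma basis_nth: "basis i $ a = complex_of_real (\<beta> i $ a)"
  by (simp add: basis_def)

lemma rows:
  "i < 6 \<Longrightarrow> j < 6 \<Longrightarrow> (\<Sum>a\<in>UNIV. weight m\<^sub>\<phi> m\<^sub>\<chi> a * \<beta> i $ a * \<beta> j $ a) = (if i = j then n * \<beta> i $ 0 else 0)"
  using orthogonality_relations_iff[of n m\<^sub>\<phi> m\<^sub>\<chi> "\<lambda>i. \<beta> i $ 0" \<beta>] n_pos m_pos degree_pos columns by simp

lemma coordinate_basis:
  assumes "i < 6" "k < 6"
  shows "coordinate (basis i) k = of_bool (i = k)"
proof -
  have "coordinate (basis i) k
      = complex_of_real ((\<Sum>a\<in>UNIV. weight m\<^sub>\<phi> m\<^sub>\<chi> a * \<beta> k $ a * \<beta> i $ a) / (n * \<beta> k $ 0))"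
    by (simp add: coordinate_def basis_nth sum_divide_distrib)
  also have "\<dots> = of_bool (i = k)"
    using rows[OF assms(2,1)] n_pos degree_pos[OF assms(2)] by auto
  finally show ?thesis .
qed

lemma coordinate_linear: "coordinate (x + y) k = coordinate x k + coordinate y k"
    "coordinate (c *s x) k = c * coordinate x k"
proof -
  show "coordinate (x + y) k = coordinate x k + coordinate y k"
    by (simp only: coordinate_def vector_add_component distrib_left sum.distrib)
  show "coordinate (c *s x) k = c * coordinate x k"
    unfolding coordinate_def sum_distrib_left by (intro sum.cong) simp_all
qed

lemma coordinate_sum: "coordinate (\<Sum>i\<in>I. f i *s x i) k = (\<Sum>i\<in>I. f i * coordinate (x i) k)"
proof (induction I rule: infinite_finite_induct)
  case empty
  show ?case by (simp add: coordinate_def)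
next
  case (infinite I)
  then show ?case by (simp add: coordinate_def)
qed (simp add: coordinate_linear)

lemma coordinate_expansion: "x = (\<Sum>k<6. coordinate x k *s basis k)"
proof -
  have "(\<Sum>k<6. coordinate x k *s basis k) $ a = x $ a" for a
  proof -
    have w: "weight m\<^sub>\<phi> m\<^sub>\<chi> c \<noteq> 0" for c
      using m_pos by (simp add: weight_def)
    have "(\<Sum>k<6. coordinate x k *s basis k) $ a
        = (\<Sum>k<6. \<Sum>c\<in>UNIV. complex_of_real (weight m\<^sub>\<phi> m\<^sub>\<chi> c / n * (\<beta> k $ c * \<beta> k $ a / \<beta> k $ 0)) * x $ c)"
      unfolding sum_component vector_smult_component basis_nth coordinate_def sum_distrib_right
      by (intro sum.cong refl) simp
    also have "\<dots> = (\<Sum>c\<in>UNIV. complex_of_real (weight m\<^sub>\<phi> m\<^sub>\<chi> c / n * (\<Sum>k<6. \<beta> k $ c * \<beta> k $ a / \<beta> k $ 0)) * x $ c)"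
      by (subst sum.swap) (simp only: sum_distrib_left of_real_sum sum_distrib_right)
    also have "\<dots> = (\<Sum>c\<in>UNIV. if c = a then x $ c else 0)"
      using w n_pos by (intro sum.cong refl) (simp add: columns)
    also have "\<dots> = x $ a"
      by simp
    finally show ?thesis .
  qed
  then show ?thesis
    by (simp add: Finite_Cartesian_Product.vec_eq_iff)
qed

lemma star_perm_less: "i < 6 \<Longrightarrow> star_perm i < 6"
  and star_perm_star_perm: "star_perm (star_perm i) = i"
  by (auto simp: star_perm_def)

lemma star_perm_image: "star_perm ` {..<6} = {..<6}"
proof
  show "star_perm ` {..<6} \<subseteq> {..<6}"
    using star_perm_less by auto
  show "{..<6} \<subseteq> star_perm ` {..<6}"
    using star_perm_less star_perm_star_perm by (metis image_eqI lessThan_iff subsetI)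
qed

lemma \<beta>_star_perm: "i < 6 \<Longrightarrow> \<beta> (star_perm i) = vec6 (\<beta> i $ 0) (\<beta> i $ 1) (\<beta> i $ 2) (\<beta> i $ 3) (\<beta> i $ 4) (- \<beta> i $ 5)"
  by (elim less_6_cases) (simp_all add: star_perm_def vec6_eq_iff \<beta>_0 \<beta>_sym \<beta>_5 del: One_nat_def)

lemma split_star_basis: "i < 6 \<Longrightarrow> split_star (basis i) = basis (star_perm i)"
  by (simp add: vec6_eq_iff split_star_def basis_nth \<beta>_star_perm)

lemma inj_on_basis: "inj_on basis {..<6}"
proof (rule inj_onI)
  fix i j
  assume "i \<in> {..<6::nat}" "j \<in> {..<6::nat}" "basis i = basis j"
  then show "i = j"
    using coordinate_basis[of i j] coordinate_basis[of j j] by (auto split: if_splits)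
qed

sublocale based_algebra "(*s)" split_mul split_one basis 6
proof -
  interpret complex_algebra "(*s)" split_mul split_one
    by (rule complex_algebra_split)
  show "based_algebra (*s) split_mul split_one basis 6"
  proof
    show "inj_on basis {..<6}"
      by (rule inj_on_basis)
    show "vec.independent (basis ` {..<6})"
    proof (rule vec.independent_if_scalars_zero)
      fix f v
      assume "(\<Sum>x\<in>basis ` {..<6}. f x *s x) = 0" and v: "v \<in> basis ` {..<6}"
      then have 0: "(\<Sum>i<6. f (basis i) *s basis i) = 0"
        using inj_on_basis by (simp add: sum.reindex)
      obtain k where k: "k < 6" "v = basis k"
        using v by auto
      have "(\<Sum>i<6. f (basis i) * coordinate (basis i) k) = coordinate 0 k"
        using coordinate_sum[of "\<lambda>i. f (basis i)" basis "{..<6}" k] 0 by simp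
      moreover have "(\<Sum>i<6. f (basis i) * coordinate (basis i) k) = (\<Sum>i<6. if i = k then f (basis i) else 0)"
        using k by (intro sum.cong) (auto simp: coordinate_basis)
      ultimately show "f v = 0"
        using k by (simp add: coordinate_def)
    qed simp
    have "x \<in> vec.span (basis ` {..<6})" for x
      by (subst coordinate_expansion[of x]) (intro vec.span_sum vec.span_scale vec.span_base, auto)
    then show "vec.span (basis ` {..<6}) = UNIV"
      by blast
  qed
qed

lemma coeff_of_eq: "k < 6 \<Longrightarrow> coeff_of x k = coordinate x k"
  using coeff_unique[OF coordinate_expansion] .

text \<open>Coordinate 0 is the trace form up to the factor \<open>n\<close>, and passing from
  \<open>j\<close> to \<open>star_perm j\<close> only changes the sign in column 5. So the constant
  is an inner product of the rows \<open>i\<close> and \<open>star_perm j\<close>.\<close>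

lemma struct_const_0:
  assumes "i < 6" "j < 6"
  shows "struct_const i j 0 = (if j = star_perm i then complex_of_real (\<beta> i $ 0) else 0)"
proof -
  have "complex_of_real n * struct_const i j 0
      = complex_of_real (\<Sum>a\<in>UNIV. weight m\<^sub>\<phi> m\<^sub>\<chi> a * \<beta> i $ a * \<beta> (star_perm j) $ a)"
    using n_pos by (simp add: struct_const_def coeff_of_eq coordinate_def \<beta>_0 sum_6 split_mul_def basis_nth
        \<beta>_star_perm[OF assms(2)] field_simps)
  also have "\<dots> = complex_of_real n * (if j = star_perm i then complex_of_real (\<beta> i $ 0) else 0)"
    using rows[OF assms(1) star_perm_less[OF assms(2)]] star_perm_star_perm[of j] star_perm_star_perm[of i] by auto
  finally show ?thesis
    using n_pos by simp
qed

lemma inv_into_basis: "i < 6 \<Longrightarrow> the_inv_into {..<6} basis (split_star (basis i)) = star_perm i"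
  using the_inv_into_f_f[OF inj_on_basis] star_perm_less by (simp add: split_star_basis)

sublocale standard_rba "(*s)" split_mul split_one split_star basis 6 "\<lambda>x. x $ 0"
proof -
  interpret reality_based_algebra "(*s)" split_mul split_one split_star basis 6
  proof
    show "split_star (split_star x) = x" "split_star (x + y) = split_star x + split_star y"
      "split_star (c *s x) = cnj c *s split_star x"
      "split_star (split_mul x y) = split_mul (split_star y) (split_star x)" for x y c
      by (simp_all add: vec6_eq_iff split_star_def split_mul_def algebra_simps)
    show "basis 0 = split_one"
      by (simp add: vec6_eq_iff basis_nth \<beta>_0 split_one_def)
    show "struct_const i j k \<in> \<real>" if "i < 6" "j < 6" "k < 6" for i j k
    proof -
      have "split_mul (basis i) (basis j) $ a \<in> \<real>" for a
      proof -
        have "\<forall>a. split_mul (basis i) (basis j) $ a \<in> \<real>"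
          unfolding forall_6 by (simp add: split_mul_def basis_nth)
        then show ?thesis by blast
      qed
      then show ?thesis
        using that by (auto simp: struct_const_def coeff_of_eq coordinate_def intro!: sum_in_Reals Reals_mult)
    qed
    have "split_star ` basis ` {..<6} = basis ` star_perm ` {..<6}"
      by (auto simp: split_star_basis image_image intro!: image_cong)
    then show "split_star ` basis ` {..<6} = basis ` {..<6}"
      by (simp add: star_perm_image)
    show "struct_const i j 0 \<noteq> 0 \<longleftrightarrow> j = the_inv_into {..<6} basis (split_star (basis i))"
      if "i < 6" "j < 6" for i j
      using degree_pos[OF that(1)] by (simp add: struct_const_0 that inv_into_basis)
    show "struct_const i j 0 = struct_const j i 0" "0 < Re (struct_const i j 0)"
      if "i < 6" "j = the_inv_into {..<6} basis (split_star (basis i))" for i j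
      using that degree_pos[OF that(1)]
      by (simp_all add: inv_into_basis struct_const_0 star_perm_less star_perm_star_perm \<beta>_star_perm)
  qed simp
  show "standard_rba (*s) split_mul split_one split_star basis 6 (\<lambda>x. x $ 0)"
  proof
    show "positive_degree_map (\<lambda>x. x $ 0)"
      using degree_pos unfolding positive_degree_map_def algebra_hom_complex_def
      by (simp add: split_mul_def split_one_def split_star_def basis_nth)
    show "basis i $ 0 = struct_const i (star_index i) 0" if "i < 6" for i
      using that by (simp add: star_index_def inv_into_basis struct_const_0 star_perm_less basis_nth)
  qed
qed

lemma order_eq: "order = n"
proof -
  have "order = (\<Sum>i<6. \<beta> i $ 0)"
    by (simp add: order_def deg_def basis_nth)
  also have "\<dots> = (\<Sum>i<6. \<beta> i $ 0 * \<beta> i $ 0 / \<beta> i $ 0)"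
    using degree_pos by (intro sum.cong) (auto simp: less_imp_neq[symmetric])
  finally show ?thesis
    unfolding columns by simp
qed

sublocale split: split_rba6 "(*s)" split_mul split_one split_star basis "\<lambda>x. x $ 0" "\<lambda>x. x" m\<^sub>\<phi> m\<^sub>\<chi>
proof
  show "complex_of_real order * tr x = x $ 0 + complex_of_real m\<^sub>\<phi> * x $ 1 + 2 * complex_of_real m\<^sub>\<chi> * x $ 2" for x
    using n_pos by (simp add: order_eq tr_def coeff_of_eq coordinate_def sum_6 \<beta>_0 field_simps)
qed (use m_pos in \<open>auto simp: basis_nth bij_def inj_def surj_def\<close>)

lemma noncommutative: "split_mul (vec6 0 0 0 1 0 0) (vec6 0 0 0 0 1 0) \<noteq> split_mul (vec6 0 0 0 0 1 0) (vec6 0 0 0 1 0 0)"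
  by (simp add: vec6_eq_iff split_mul_def)

lemma labelled_basis: "labelled split_star basis"
  unfolding labelled_def by (auto simp: split_star_basis star_perm_def)

end

lemma admissible_table_realised:
  assumes "admissible_table T"
  shows "\<exists>(m :: complex^6 \<Rightarrow> complex^6 \<Rightarrow> complex^6) one star b \<delta>.
           noncomm_standard_rba6 (*s) m one star b \<delta> \<and> labelled star b \<and>
           is_character_table6 (*s) m one b \<delta> T"
proof -
  from assms obtain \<delta> \<phi> chi :: "nat \<Rightarrow> real" and m\<^sub>\<phi> m\<^sub>\<chi> n :: real where
    T: "\<forall>i<6. row_\<delta> T i = complex_of_real (\<delta> i) \<and> row_\<phi> T i = complex_of_real (\<phi> i) \<and>
               row_\<chi> T i = complex_of_real (chi i)"
      "mult_\<delta> T = 1" "mult_\<phi> T = complex_of_real m\<^sub>\<phi>" "mult_\<chi> T = complex_of_real m\<^sub>\<chi>"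
    and num: "\<delta> 0 = 1" "\<phi> 0 = 1" "chi 0 = 2" "\<delta> 5 = \<delta> 4" "\<phi> 5 = \<phi> 4" "chi 5 = chi 4"
      "\<forall>i\<in>{1..4}. 0 < \<delta> i" "1 + \<phi> 1 + \<phi> 2 + \<phi> 3 + 2 * \<phi> 4 = 0"
      "\<exists>i\<in>{1..3}. \<phi> i / \<delta> i \<noteq> \<phi> 4 / \<delta> 4" "n = 1 + \<delta> 1 + \<delta> 2 + \<delta> 3 + 2 * \<delta> 4"
      "m\<^sub>\<phi> = n / (\<Sum>i=0..5. (\<phi> i)\<^sup>2 / \<delta> i)" "m\<^sub>\<chi> = (n - 1 - m\<^sub>\<phi>) / 2"
      "\<forall>i\<in>{1..4}. chi i = (- \<delta> i - m\<^sub>\<phi> * \<phi> i) / m\<^sub>\<chi>"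
    unfolding admissible_table_def by (elim exE conjE) blast
  obtain \<beta> :: "nat \<Rightarrow> real^6" where \<beta>: "0 < m\<^sub>\<phi>" "0 < m\<^sub>\<chi>"
    "\<And>a c. (\<Sum>i<6. \<beta> i $ a * \<beta> i $ c / \<delta> i) = (if a = c then n / weight m\<^sub>\<phi> m\<^sub>\<chi> a else 0)"
    "\<And>i. \<beta> i $ 0 = \<delta> i" "\<And>i. \<beta> i $ 1 = \<phi> i" "\<And>i. \<beta> i $ 2 = chi i / 2"
    "\<beta> 0 = vec6 1 1 1 0 0 0" "\<beta> 1 $ 5 = 0" "\<beta> 2 $ 5 = 0" "\<beta> 3 $ 5 = 0"
    "\<beta> 5 = vec6 (\<beta> 4 $ 0) (\<beta> 4 $ 1) (\<beta> 4 $ 2) (\<beta> 4 $ 3) (\<beta> 4 $ 4) (- \<beta> 4 $ 5)"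
    using coordinates_exist[OF num] by blast
  have "0 < \<delta> i" if "i < 6" for i
    using that num(1,4) bspec[OF num(7), of 1] bspec[OF num(7), of 2] bspec[OF num(7), of 3] bspec[OF num(7), of 4]
    by (elim less_6_cases) simp_all
  moreover have "0 < n"
    using num(10) bspec[OF num(7), of 1] bspec[OF num(7), of 2] bspec[OF num(7), of 3] bspec[OF num(7), of 4] by simp
  ultimately interpret rba6_coordinates \<beta> n m\<^sub>\<phi> m\<^sub>\<chi>
    using \<beta> by unfold_locales simp_all
  have "noncomm_standard_rba6 (*s) split_mul split_one split_star basis (\<lambda>x. x $ 0)"
    unfolding noncomm_standard_rba6_def using standard_rba_axioms noncommutative by blast
  moreover have "is_character_table6 (*s) split_mul split_one basis (\<lambda>x. x $ 0) T"
  proof -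
    have "complex_of_real (chi i) = 2 * complex_of_real (\<beta> i $ 2)" for i
      by (simp add: \<beta>(6))
    then show ?thesis
      unfolding split.has_character_table_iff using T by (simp add: basis_nth \<beta>(4,5))
  qed
  ultimately show ?thesis
    using labelled_basis by blast
qed

section \<open>Rigidity\<close>

text \<open>A point where \<open>f\<close> is nonzero fixes the sign, and products with that point
  carry it to all others.\<close>

lemma sign_determined_by_products:
  fixes f g :: "'i \<Rightarrow> real"
  assumes "\<And>x y. x \<in> S \<Longrightarrow> y \<in> S \<Longrightarrow> f x * f y = g x * g y"
  shows "(\<forall>x\<in>S. f x = g x) \<or> (\<forall>x\<in>S. f x = - g x)"
proof (cases "\<forall>x\<in>S. f x = 0")
  case True
  then have "g x = 0" if "x \<in> S" for x
    using assms[OF that that] that by auto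
  then show ?thesis
    using True by auto
next
  case False
  then obtain x where x: "x \<in> S" "f x \<noteq> 0" by blast
  have "f x = g x \<or> f x = - g x"
    using assms[OF x(1) x(1)] by (simp add: square_eq_iff)
  then show ?thesis
  proof
    assume "f x = g x"
    then have "f y = g y" if "y \<in> S" for y
      using assms[OF x(1) that] x(2) by auto
    then show ?thesis by blast
  next
    assume "f x = - g x"
    then have "f y = - g y" if "y \<in> S" for y
    proof -
      have "g x * (f y + g y) = 0"
        using assms[OF x(1) that] \<open>f x = - g x\<close> by (simp add: distrib_left)
      then show ?thesis
        using x(2) \<open>f x = - g x\<close> by (simp add: eq_neg_iff_add_eq_0)
    qed
    then show ?thesis by blast
  qed
qed

section \<open>Invariants of the coordinates that the table leaves open\<close>

definition gram :: "(nat \<Rightarrow> real^6) \<Rightarrow> nat \<Rightarrow> nat \<Rightarrow> real" where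
  "gram \<beta> i j = \<beta> i $ 3 * \<beta> j $ 3 + \<beta> i $ 4 * \<beta> j $ 4"

text \<open>An isometry of the plane of coordinates 3 and 4 preserves \<open>gram\<close>, and it
  multiplies this determinant by 1 or -1.\<close>

definition vol :: "(nat \<Rightarrow> real^6) \<Rightarrow> nat \<Rightarrow> nat \<Rightarrow> nat \<Rightarrow> real" where
  "vol \<beta> i j k = (\<beta> i $ 3 * \<beta> j $ 4 - \<beta> i $ 4 * \<beta> j $ 3) * \<beta> k $ 5"

definition labelled_coordinates :: "(nat \<Rightarrow> real^6) \<Rightarrow> bool" where
  "labelled_coordinates \<beta> \<longleftrightarrow> \<beta> 0 $ 5 = 0 \<and> \<beta> 1 $ 5 = 0 \<and> \<beta> 2 $ 5 = 0 \<and> \<beta> 3 $ 5 = 0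
     \<and> \<beta> 5 $ 5 = - \<beta> 4 $ 5 \<and> \<beta> 5 $ 3 = \<beta> 4 $ 3 \<and> \<beta> 5 $ 4 = \<beta> 4 $ 4"

text \<open>The entries (4,4) and (4,5) have equal \<open>gram\<close> but opposite products of
  fifth coordinates, so the hypothesis separates the two summands. A product of two values of
  \<open>vol\<close> is a Gram determinant of size two times a product of fifth coordinates; hence
  all such products agree, and one common sign is left open.\<close>

lemma gram_rigidity:
  fixes \<beta> \<gamma> :: "nat \<Rightarrow> real^6"
  assumes lab: "labelled_coordinates \<beta>" "labelled_coordinates \<gamma>"
    and eq: "\<And>i j. i < 6 \<Longrightarrow> j < 6 \<Longrightarrow> gram \<beta> i j + \<beta> i $ 5 * \<beta> j $ 5 = gram \<gamma> i j + \<gamma> i $ 5 * \<gamma> j $ 5"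
  shows "\<And>i j. i < 6 \<Longrightarrow> j < 6 \<Longrightarrow> \<beta> i $ 5 * \<beta> j $ 5 = \<gamma> i $ 5 * \<gamma> j $ 5"
    and "\<And>i j. i < 6 \<Longrightarrow> j < 6 \<Longrightarrow> gram \<beta> i j = gram \<gamma> i j"
    and "(\<forall>i<6. \<forall>j<6. \<forall>k<6. vol \<beta> i j k = vol \<gamma> i j k) \<or> (\<forall>i<6. \<forall>j<6. \<forall>k<6. vol \<beta> i j k = - vol \<gamma> i j k)"
proof -
  have "\<beta> 4 $ 5 * \<beta> 4 $ 5 = \<gamma> 4 $ 5 * \<gamma> 4 $ 5"
    using eq[of 4 4] eq[of 4 5] lab by (simp add: gram_def labelled_coordinates_def)
  then show r: "\<beta> i $ 5 * \<beta> j $ 5 = \<gamma> i $ 5 * \<gamma> j $ 5" if "i < 6" "j < 6" for i j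
    using that lab unfolding labelled_coordinates_def
    by (elim less_6_cases) (simp_all del: One_nat_def)
  show G: "gram \<beta> i j = gram \<gamma> i j" if "i < 6" "j < 6" for i j
    using eq[OF that] r[OF that] by simp
  define f where "f \<beta> = (\<lambda>(i, j, k). vol \<beta> i j k)" for \<beta>
  have expand: "f \<beta> (i, j, k) * f \<beta> (i', j', k')
      = (gram \<beta> i i' * gram \<beta> j j' - gram \<beta> i j' * gram \<beta> j i') * (\<beta> k $ 5 * \<beta> k' $ 5)" for \<beta> i j k i' j' k'
    by (simp add: f_def vol_def gram_def algebra_simps)
  have "(\<forall>t\<in>{..<6} \<times> {..<6} \<times> {..<6}. f \<beta> t = f \<gamma> t) \<or> (\<forall>t\<in>{..<6} \<times> {..<6} \<times> {..<6}. f \<beta> t = - f \<gamma> t)"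
    by (rule sign_determined_by_products) (auto simp: expand r G)
  then show "(\<forall>i<6. \<forall>j<6. \<forall>k<6. vol \<beta> i j k = vol \<gamma> i j k) \<or> (\<forall>i<6. \<forall>j<6. \<forall>k<6. vol \<beta> i j k = - vol \<gamma> i j k)"
    by (auto simp: f_def)
qed

lemma (in labelled_split_rba6) labelled_coordinates: "labelled_coordinates \<beta>"
  unfolding labelled_coordinates_def by (simp add: \<beta>_ident \<beta>_labelled del: One_nat_def)

text \<open>The trace of \<open>b i\<close>, \<open>b j\<close> and \<open>star (b k)\<close>
  multiplied together. Coordinates outside the table enter only through \<open>gram\<close>,
  products of two fifth coordinates and, linearly, \<open>vol\<close>; hence the rigidity.\<close>

lemma (in split_rba6) struct_const_formula:
  assumes "i < 6" "j < 6" "k < 6"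
  shows "complex_of_real (order * deg k) * struct_const i j k = complex_of_real
    (\<beta> i $ 0 * \<beta> j $ 0 * \<beta> k $ 0 + m\<^sub>\<phi> * \<beta> i $ 1 * \<beta> j $ 1 * \<beta> k $ 1
      + 2 * m\<^sub>\<chi> * (\<beta> i $ 2 * \<beta> j $ 2 * \<beta> k $ 2 + \<beta> k $ 2 * gram \<beta> i j + \<beta> i $ 2 * gram \<beta> j k + \<beta> j $ 2 * gram \<beta> i k
        - \<beta> k $ 2 * (\<beta> i $ 5 * \<beta> j $ 5) + \<beta> i $ 2 * (\<beta> j $ 5 * \<beta> k $ 5) + \<beta> j $ 2 * (\<beta> i $ 5 * \<beta> k $ 5)
        + vol \<beta> i j k - vol \<beta> j k i + vol \<beta> i k j))"
proof -
  have "complex_of_real (order * deg k) * struct_const i j k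
      = complex_of_real order * tr (mul (mul (b i) (b j)) (star (b k)))"
    using tr_mul_basis_star[OF assms(3), of "mul (b i) (b j)"] assms
    by (simp add: struct_const_def star_basis_index)
  then show ?thesis
    unfolding tr_split split_mul
    by (simp add: sum_6 split_mul_def split_basis assms gram_def vol_def algebra_simps)
qed

section \<open>Uniqueness up to exact isomorphism\<close>

lemma exactly_isomorphic_if_struct_const_eq:
  assumes A: "based_algebra sA mA oneA a r" and C: "based_algebra sC mC oneC c r"
    and \<pi>: "bij_betw \<pi> {..<r} {..<r}" "\<pi> 0 = 0" and "0 < r" "a 0 = oneA" "c 0 = oneC"
    and sc: "\<And>i j k. i < r \<Longrightarrow> j < r \<Longrightarrow> k < r \<Longrightarrow>
      based_algebra.struct_const sA mA a r i j k = based_algebra.struct_const sC mC c r (\<pi> i) (\<pi> j) (\<pi> k)"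
  shows "exactly_isomorphic sA mA oneA (a ` {..<r}) sC mC oneC (c ` {..<r})"
proof -
  interpret A: based_algebra sA mA oneA a r by (rule A)
  interpret C: based_algebra sC mC oneC c r by (rule C)
  have \<pi>_less: "\<pi> i < r" if "i < r" for i
    using \<pi>(1) that by (auto simp: bij_betw_def)
  have \<pi>_eq: "\<pi> i = \<pi> j \<longleftrightarrow> i = j" if "i < r" "j < r" for i j
    using \<pi>(1) that by (auto simp: bij_betw_def inj_on_def)
  define f where "f x = (\<Sum>i<r. sC (A.coeff_of x i) (c (\<pi> i)))" for x
  define g where "g y = (\<Sum>i<r. sA (C.coeff_of y (\<pi> i)) (a i))" for y
  have f_add: "f (x + y) = f x + f y" for x y
    by (simp add: f_def A.coeff_add C.scale_left_distrib sum.distrib)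
  have f_scl: "f (sA t x) = sC t (f x)" for t x
    by (simp add: f_def A.coeff_scl C.scale_sum_right)
  have f_zero: "f 0 = 0"
    using f_scl[of 0 0] by simp
  have f_sum: "f (sum h I) = (\<Sum>i\<in>I. f (h i))" for h :: "nat \<Rightarrow> 'a" and I
    by (induction I rule: infinite_finite_induct) (auto simp: f_add f_zero)
  have f_basis: "f (a i) = c (\<pi> i)" if "i < r" for i
  proof -
    have "f (a i) = (\<Sum>k<r. if k = i then c (\<pi> k) else 0)"
      unfolding f_def by (intro sum.cong) (auto simp: A.coeff_basis that)
    then show ?thesis
      using that by simp
  qed
  have f_mul_basis: "f (mA (a i) (a j)) = mC (f (a i)) (f (a j))" if "i < r" "j < r" for i j
  proof -
    have "mC (c (\<pi> i)) (c (\<pi> j)) = (\<Sum>k<r. sC (C.struct_const (\<pi> i) (\<pi> j) k) (c k))"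
      by (rule C.basis_product)
    also have "\<dots> = (\<Sum>k<r. sC (C.struct_const (\<pi> i) (\<pi> j) (\<pi> k)) (c (\<pi> k)))"
      by (rule sum.reindex_bij_betw[OF \<pi>(1), symmetric])
    also have "\<dots> = (\<Sum>k<r. sC (A.struct_const i j k) (c (\<pi> k)))"
      by (intro sum.cong) (auto simp: sc that)
    finally show ?thesis
      by (simp add: f_basis that) (simp add: f_def A.struct_const_def)
  qed
  have f_mul: "f (mA x y) = mC (f x) (f y)" for x y
  proof -
    have "f (mA x y) = f (mA (\<Sum>i<r. sA (A.coeff_of x i) (a i)) (\<Sum>i<r. sA (A.coeff_of y i) (a i)))"
      by (simp add: A.basis_expansion)
    also have "\<dots> = (\<Sum>i<r. sC (A.coeff_of y i) (\<Sum>j<r. sC (A.coeff_of x j) (f (mA (a j) (a i)))))"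
      by (simp add: A.mul_sum_left A.mul_sum_right A.mul_scl_left A.mul_scl_right f_sum f_scl)
    also have "\<dots> = (\<Sum>i<r. sC (A.coeff_of y i) (\<Sum>j<r. sC (A.coeff_of x j) (mC (f (a j)) (f (a i)))))"
      by (simp add: f_mul_basis)
    also have "\<dots> = mC (\<Sum>i<r. sC (A.coeff_of x i) (f (a i))) (\<Sum>i<r. sC (A.coeff_of y i) (f (a i)))"
      by (simp add: C.mul_sum_left C.mul_sum_right C.mul_scl_left C.mul_scl_right)
    also have "\<dots> = mC (f x) (f y)"
    proof -
      have "(\<Sum>i<r. sC (A.coeff_of x i) (f (a i))) = f x" for x
        unfolding f_def[of x] by (intro sum.cong) (auto simp: f_basis)
      then show ?thesis by simp
    qed
    finally show ?thesis .
  qed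
  have coeff_f: "C.coeff_of (f x) (\<pi> k) = A.coeff_of x k" if "k < r" for x k
  proof -
    have "C.coeff_of (f x) (\<pi> k) = (\<Sum>i<r. if i = k then A.coeff_of x i else 0)"
      unfolding f_def C.coeff_sum C.coeff_scl
      by (intro sum.cong) (auto simp: C.coeff_basis \<pi>_less \<pi>_eq that)
    then show ?thesis
      using that by simp
  qed
  have gf: "g (f x) = x" for x
    by (simp add: g_def coeff_f A.basis_expansion)
  have fg: "f (g y) = y" for y
  proof -
    have "f (g y) = (\<Sum>i<r. sC (C.coeff_of y (\<pi> i)) (c (\<pi> i)))"
      by (simp add: g_def f_sum f_scl f_basis)
    also have "\<dots> = (\<Sum>i<r. sC (C.coeff_of y i) (c i))"
      by (rule sum.reindex_bij_betw[OF \<pi>(1)])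
    finally show ?thesis
      by (simp add: C.basis_expansion)
  qed
  have bij: "bij f"
    by (rule o_bij[of g]) (auto simp: gf fg)
  have "f ` a ` {..<r} = c ` \<pi> ` {..<r}"
    by (auto simp: f_basis image_image intro!: image_cong)
  then have "f ` a ` {..<r} = c ` {..<r}"
    using \<pi>(1) by (simp add: bij_betw_def)
  then have "bij_betw f (a ` {..<r}) (c ` {..<r})"
    using bij by (auto simp: bij_betw_def bij_def intro: inj_on_subset)
  moreover have "Vector_Spaces.linear sA sC f"
    by unfold_locales (auto simp: f_add f_scl)
  moreover have "f oneA = oneC"
    using f_basis[OF \<open>0 < r\<close>] assms by simp
  ultimately show ?thesis
    unfolding exactly_isomorphic_def using bij f_mul by blast
qed

lemma exists_labelled_split:
  assumes "noncomm_standard_rba6 scl mul ident star b \<delta>" "labelled star b"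
  obtains \<Psi> m\<^sub>\<phi> m\<^sub>\<chi> where "labelled_split_rba6 scl mul ident star b \<delta> \<Psi> m\<^sub>\<phi> m\<^sub>\<chi>"
proof -
  interpret standard_rba scl mul ident star b 6 \<delta>
    using assms(1) by (simp add: noncomm_standard_rba6_def)
  interpret labelled_rba6 scl mul ident star b \<delta>
    using assms by unfold_locales (simp_all add: noncomm_standard_rba6_def)
  obtain \<Psi> m\<^sub>\<phi> m\<^sub>\<chi> where \<Psi>: "split_algebra scl mul ident \<Psi>" "\<And>x. \<Psi> (star x) = split_star (\<Psi> x)"
    "\<And>x. \<Psi> x $ 0 = \<delta> x" "\<And>i a. i < 6 \<Longrightarrow> \<Psi> (b i) $ a \<in> \<real>" "0 < m\<^sub>\<phi>" "0 < m\<^sub>\<chi>"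
    "\<And>x. complex_of_real order * tr x = \<Psi> x $ 0 + complex_of_real m\<^sub>\<phi> * \<Psi> x $ 1
       + 2 * complex_of_real m\<^sub>\<chi> * \<Psi> x $ 2"
    using exists_split by blast
  interpret split_algebra scl mul ident \<Psi>
    by (rule \<Psi>(1))
  have "labelled_split_rba6 scl mul ident star b \<delta> \<Psi> m\<^sub>\<phi> m\<^sub>\<chi>"
    using \<Psi> assms(2) by unfold_locales auto
  then show ?thesis
    by (rule that)
qed

lemma table_determines_algebra:
  fixes sA :: "complex \<Rightarrow> 'a::ab_group_add \<Rightarrow> 'a" and sC :: "complex \<Rightarrow> 'b::ab_group_add \<Rightarrow> 'b"
  assumes A: "noncomm_standard_rba6 sA mA oneA starA bA \<delta>A" "labelled starA bA"
      "is_character_table6 sA mA oneA bA \<delta>A T"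
    and C: "noncomm_standard_rba6 sC mC oneC starC bC \<delta>C" "labelled starC bC"
      "is_character_table6 sC mC oneC bC \<delta>C T"
  shows "exactly_isomorphic sA mA oneA (bA ` {..<6}) sC mC oneC (bC ` {..<6})"
proof -
  obtain \<Psi>A m\<phi>A m\<chi>A where "labelled_split_rba6 sA mA oneA starA bA \<delta>A \<Psi>A m\<phi>A m\<chi>A"
    using exists_labelled_split[OF A(1,2)] by blast
  then interpret A: labelled_split_rba6 sA mA oneA starA bA \<delta>A \<Psi>A m\<phi>A m\<chi>A .
  obtain \<Psi>C m\<phi>C m\<chi>C where "labelled_split_rba6 sC mC oneC starC bC \<delta>C \<Psi>C m\<phi>C m\<chi>C"
    using exists_labelled_split[OF C(1,2)] by blast
  then interpret C: labelled_split_rba6 sC mC oneC starC bC \<delta>C \<Psi>C m\<phi>C m\<chi>C .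
  note TA = A(3)[unfolded A.has_character_table_iff] and TC = C(3)[unfolded C.has_character_table_iff]
  have m: "m\<phi>C = m\<phi>A" "m\<chi>C = m\<chi>A"
    using TA TC by (metis of_real_eq_iff)+
  have deg: "C.deg i = A.deg i" if "i < 6" for i
    using TA TC that unfolding A.deg_def C.deg_def by metis
  have order: "C.order = A.order"
    unfolding A.order_def C.order_def by (intro sum.cong) (auto simp: deg)
  have \<beta>: "C.\<beta> i $ 0 = A.\<beta> i $ 0" "C.\<beta> i $ 1 = A.\<beta> i $ 1" "C.\<beta> i $ 2 = A.\<beta> i $ 2" if "i < 6" for i
  proof -
    show "C.\<beta> i $ 0 = A.\<beta> i $ 0"
      using deg[OF that] by (simp add: A.\<beta>_deg C.\<beta>_deg)
    have "\<Psi>C (bC i) $ 1 = \<Psi>A (bA i) $ 1" "2 * \<Psi>C (bC i) $ 2 = 2 * \<Psi>A (bA i) $ 2"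
      using TA TC that by metis+
    then show "C.\<beta> i $ 1 = A.\<beta> i $ 1" "C.\<beta> i $ 2 = A.\<beta> i $ 2"
      by (simp_all add: A.\<beta>_def C.\<beta>_def)
  qed
  \<comment> \<open>Row orthogonality fixes the full inner products, and the table accounts for the
    columns 0, 1, 2 in them.\<close>
  have gram_eq: "gram A.\<beta> i j + A.\<beta> i $ 5 * A.\<beta> j $ 5 = gram C.\<beta> i j + C.\<beta> i $ 5 * C.\<beta> j $ 5"
    if "i < 6" "j < 6" for i j
  proof -
    have "2 * m\<chi>A * (gram A.\<beta> i j + A.\<beta> i $ 5 * A.\<beta> j $ 5) = 2 * m\<chi>A * (gram C.\<beta> i j + C.\<beta> i $ 5 * C.\<beta> j $ 5)"
      using A.row_orthogonality[OF that] C.row_orthogonality[OF that]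
      by (simp add: sum_6 m deg order that \<beta> gram_def algebra_simps split: if_splits)
    then show ?thesis
      using A.m_pos by simp
  qed
  note rigid = gram_rigidity[OF A.labelled_coordinates C.labelled_coordinates gram_eq]
  have nz: "A.order * A.deg k \<noteq> 0" if "k < 6" for k
    using A.order_pos A.deg_pos[OF that] by simp
  have eqI: "A.struct_const i j k = z" if "k < 6"
    "complex_of_real (A.order * A.deg k) * A.struct_const i j k = complex_of_real (A.order * A.deg k) * z" for i j k z
    using that nz by (metis mult_cancel_left of_real_eq_0_iff)
  from rigid(3) show ?thesis
  proof
    assume "\<forall>i<6. \<forall>j<6. \<forall>k<6. vol A.\<beta> i j k = vol C.\<beta> i j k"
    then have vol: "vol C.\<beta> i j k = vol A.\<beta> i j k" if "i < 6" "j < 6" "k < 6" for i j k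
      using that by simp
    show ?thesis
    proof (rule exactly_isomorphic_if_struct_const_eq[OF A.based_algebra_axioms C.based_algebra_axioms, where \<pi> = id])
      fix i j k :: nat
      assume ijk: "i < 6" "j < 6" "k < 6"
      show "A.struct_const i j k = C.struct_const (id i) (id j) (id k)"
      proof (rule eqI[OF ijk(3)])
        show "complex_of_real (A.order * A.deg k) * A.struct_const i j k
            = complex_of_real (A.order * A.deg k) * C.struct_const (id i) (id j) (id k)"
          by (simp only: id_apply A.struct_const_formula[OF ijk]
              C.struct_const_formula[OF ijk, unfolded order deg[OF ijk(3)]] m \<beta> ijk vol rigid(1,2))
      qed
    qed (simp_all add: A.b_0 C.b_0)
  next
    \<comment> \<open>In the second algebra \<open>star_index\<close> negates all fifth coordinates
      and keeps the others. It reverses each \<open>vol\<close> and preserves \<open>gram\<close>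
      and the products of two fifth coordinates, which compensates the sign.\<close>
    assume vol: "\<forall>i<6. \<forall>j<6. \<forall>k<6. vol A.\<beta> i j k = - vol C.\<beta> i j k"
    let ?s = C.star_index
    have s: "?s i < 6" if "i < 6" for i
      using that by (rule C.star_index_less)
    have vol': "vol C.\<beta> (?s i) (?s j) (?s k) = vol A.\<beta> i j k" if "i < 6" "j < 6" "k < 6" for i j k
      using vol that by (simp add: vol_def C.\<beta>_star)
    have gram': "gram C.\<beta> (?s i) (?s j) = gram C.\<beta> i j" if "i < 6" "j < 6" for i j
      using that by (simp add: gram_def C.\<beta>_star)
    have r': "C.\<beta> (?s i) $ 5 * C.\<beta> (?s j) $ 5 = C.\<beta> i $ 5 * C.\<beta> j $ 5" if "i < 6" "j < 6" for i j
      using that by (simp add: C.\<beta>_star)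
    show ?thesis
    proof (rule exactly_isomorphic_if_struct_const_eq[OF A.based_algebra_axioms C.based_algebra_axioms, where \<pi> = ?s])
      fix i j k :: nat
      assume ijk: "i < 6" "j < 6" "k < 6"
      have dk: "C.deg (?s k) = A.deg k"
        by (simp add: C.deg_star_index ijk deg)
      have \<beta>': "C.\<beta> (?s l) $ 0 = A.\<beta> l $ 0" "C.\<beta> (?s l) $ 1 = A.\<beta> l $ 1" "C.\<beta> (?s l) $ 2 = A.\<beta> l $ 2" if "l < 6" for l
        using that by (simp_all add: C.\<beta>_star \<beta>)
      show "A.struct_const i j k = C.struct_const (?s i) (?s j) (?s k)"
      proof (rule eqI[OF ijk(3)])
        show "complex_of_real (A.order * A.deg k) * A.struct_const i j k
            = complex_of_real (A.order * A.deg k) * C.struct_const (?s i) (?s j) (?s k)"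
          by (simp only: A.struct_const_formula[OF ijk]
              C.struct_const_formula[OF s[OF ijk(1)] s[OF ijk(2)] s[OF ijk(3)], unfolded order dk]
              m \<beta>' ijk vol' gram' r' rigid(1,2))
      qed
    qed (simp_all add: A.b_0 C.b_0 C.bij_betw_star_index C.star_index_0)
  qed
qed

section \<open>Relabelling the basis\<close>

lemma noncomm_standard_rba6_relabel:
  assumes rba: "noncomm_standard_rba6 scl mul ident star b \<delta>" and p: "p permutes {..<6}" "p 0 = 0"
  shows "noncomm_standard_rba6 scl mul ident star (b \<circ> p) \<delta>"
proof -
  interpret standard_rba scl mul ident star b 6 \<delta>
    using rba by (simp add: noncomm_standard_rba6_def)
  have image: "(b \<circ> p) ` {..<6} = b ` {..<6}"
    using permutes_image[OF p(1)] by (metis image_comp)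
  have p_less: "p i < 6" if "i < 6" for i
    using permutes_in_image[OF p(1), of i] that by simp
  have inj: "inj_on (b \<circ> p) {..<6}"
    using b_inj permutes_image[OF p(1)] permutes_inj[OF p(1)] by (auto intro!: comp_inj_on intro: inj_on_subset)
  interpret relabelled: based_algebra scl mul ident "b \<circ> p" 6
    using inj b_independent b_span by unfold_locales (simp_all only: image not_False_eq_True)
  \<comment> \<open>Coefficients refer to the basis only through its image, which is unchanged, so
    the structure constants are merely permuted.\<close>
  have sc: "relabelled.struct_const i j k = struct_const (p i) (p j) (p k)" for i j k
    by (simp only: relabelled.struct_const_def relabelled.coeff_of_def struct_const_def coeff_of_def image comp_apply)
  have inv: "j = the_inv_into {..<6} (b \<circ> p) (star ((b \<circ> p) i)) \<longleftrightarrow> j < 6 \<and> p j = star_index (p i)"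
    if i: "i < 6" for i j
  proof -
    obtain l where l: "l < 6" "p l = star_index (p i)"
      using permutes_image[OF p(1)] star_index_less[OF p_less[OF i]] by (metis imageE lessThan_iff)
    have "(b \<circ> p) l = star ((b \<circ> p) i)"
      by (simp add: l star_basis_index p_less i)
    then have eq: "the_inv_into {..<6} (b \<circ> p) (star ((b \<circ> p) i)) = l"
      using l(1) by (intro the_inv_into_f_eq inj) simp_all
    have "p j = p l \<longleftrightarrow> j = l"
      by (rule inj_eq[OF permutes_inj[OF p(1)]])
    then show ?thesis
      unfolding eq l(2)[symmetric] using l(1) by blast
  qed
  have sc0: "struct_const i j 0 = (if j = star_index i then \<delta> (b i) else 0)" if "i < 6" "j < 6" for i j
    using tr_basis_mul[OF that] that by (simp add: tr_def struct_const_def degree_basis)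
  interpret relabelled: reality_based_algebra scl mul ident star "b \<circ> p" 6
  proof
    show "star (star x) = x" "star (x + y) = star x + star y" "star (scl c x) = scl (cnj c) (star x)"
      "star (mul x y) = mul (star y) (star x)" for x y c
      by (simp_all add: star_star star_add star_scl star_mul)
    show "(b \<circ> p) 0 = ident"
      by (simp add: p b_0)
    show "relabelled.struct_const i j k \<in> \<real>" if "i < 6" "j < 6" "k < 6" for i j k
      unfolding sc using that p_less by (intro struct_const_real)
    show "star ` (b \<circ> p) ` {..<6} = (b \<circ> p) ` {..<6}"
      unfolding image by (rule star_basis)
    show "relabelled.struct_const i j 0 \<noteq> 0 \<longleftrightarrow> j = the_inv_into {..<6} (b \<circ> p) (star ((b \<circ> p) i))"
      if "i < 6" "j < 6" for i j
      using that deg_pos[OF p_less[OF that(1)]] by (simp only: sc inv p(2)) (simp add: sc0 p_less degree_basis)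
    show "relabelled.struct_const i j 0 = relabelled.struct_const j i 0" "0 < Re (relabelled.struct_const i j 0)"
      if "i < 6" "j = the_inv_into {..<6} (b \<circ> p) (star ((b \<circ> p) i))" for i j
    proof -
      have j: "j < 6" "p j = star_index (p i)"
        using that inv by auto
      then show "relabelled.struct_const i j 0 = relabelled.struct_const j i 0" "0 < Re (relabelled.struct_const i j 0)"
        using that(1) deg_pos[OF p_less[OF that(1)]]
        by (simp_all add: sc p(2) sc0 p_less star_index_less star_index_star_index degree_basis deg_star_index)
    qed
  qed simp
  have "standard_rba scl mul ident star (b \<circ> p) 6 \<delta>"
  proof
    show "relabelled.positive_degree_map \<delta>"
      using degree_map p_less unfolding relabelled.positive_degree_map_def positive_degree_map_def by simp
    show "\<delta> ((b \<circ> p) i) = relabelled.struct_const i (relabelled.star_index i) 0" if "i < 6" for i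
    proof -
      have "p (relabelled.star_index i) = star_index (p i)"
        using inv[OF that] unfolding relabelled.star_index_def by blast
      then show ?thesis
        using that by (simp add: sc p(2) sc0 p_less star_index_less)
    qed
  qed
  then show ?thesis
    using rba by (simp add: noncomm_standard_rba6_def)
qed

lemma permutation_of_enumeration:
  assumes "{a1, a2, a3, a4, a5} = {1..5::nat}"
  obtains p where "p permutes {..<6::nat}" "p 0 = 0" "p 1 = a1" "p 2 = a2" "p 3 = a3" "p 4 = a4" "p 5 = a5"
proof -
  define p where "p i = (if i = 1 then a1 else if i = 2 then a2 else if i = 3 then a3 else if i = 4 then a4
    else if i = 5 then a5 else i)" for i :: nat
  have six: "{..<6::nat} = {0, 1, 2, 3, 4, 5}" "{..<6::nat} = insert 0 {1..5}"
    by auto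
  have "p ` {..<6} = insert 0 {a1, a2, a3, a4, a5}"
    unfolding six(1) by (auto simp: p_def)
  then have image: "p ` {..<6} = {..<6}"
    by (simp only: assms six(2))
  then have "inj_on p {..<6}"
    by (intro finite_surj_inj) auto
  then have "p permutes {..<6}"
    using image by (intro bij_imp_permutes) (auto simp: bij_betw_def p_def)
  then show ?thesis
    using that[of p] by (simp add: p_def)
qed

text \<open>The complement of one swapped pair in \<open>{1..5}\<close> is closed under
  \<open>\<sigma>\<close> and has three elements, so it contains a fixed point and at most one
  further pair.\<close>

lemma involution_normal_form:
  fixes \<sigma> :: "nat \<Rightarrow> nat"
  assumes less: "\<And>i. i < 6 \<Longrightarrow> \<sigma> i < 6" and inv: "\<And>i. i < 6 \<Longrightarrow> \<sigma> (\<sigma> i) = i" and "\<sigma> 0 = 0"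
    and "\<exists>i<6. \<sigma> i \<noteq> i"
  obtains p where "p permutes {..<6}" "p 0 = 0" "\<sigma> (p 1) = p 1" "\<sigma> (p 4) = p 5"
    "\<sigma> (p 2) = p 2 \<and> \<sigma> (p 3) = p 3 \<or> \<sigma> (p 2) = p 3"
proof -
  obtain i where i: "i < 6" "\<sigma> i \<noteq> i"
    using assms by blast
  have range: "\<sigma> j \<in> {1..5}" if "j \<in> {1..5}" for j
    using that less[of j] inv[of j] \<open>\<sigma> 0 = 0\<close> by (cases "\<sigma> j = 0") auto
  have i15: "i \<in> {1..5}" "\<sigma> i \<in> {1..5}"
    using i range[of i] \<open>\<sigma> 0 = 0\<close> by (cases "i = 0"; auto)+
  define R where "R = {1..5} - {i, \<sigma> i}"
  have cardR: "card R = 3"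
    unfolding R_def using i15 i by (subst card_Diff_subset) auto
  have R_closed: "\<sigma> j \<in> R" if "j \<in> R" for j
    using that range[of j] inv[of j] inv[OF i(1)] unfolding R_def by auto
  have R_less: "j < 6" if "j \<in> R" for j
    using that by (auto simp: R_def)
  have full: "R \<union> {i, \<sigma> i} = {1..5}"
    using i15 by (auto simp: R_def)
  show ?thesis
  proof (cases "\<forall>j\<in>R. \<sigma> j = j")
    case True
    obtain a1 a2 a3 where R: "R = {a1, a2, a3}"
      using cardR by (auto simp: card_3_iff)
    then have "{a1, a2, a3, i, \<sigma> i} = {1..5}"
      using full by auto
    then obtain p where "p permutes {..<6::nat}" "p 0 = 0" "p 1 = a1" "p 2 = a2" "p 3 = a3" "p 4 = i" "p 5 = \<sigma> i"
      by (rule permutation_of_enumeration)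
    then show ?thesis
      using that[of p] True R by auto
  next
    case False
    then obtain j where j: "j \<in> R" "\<sigma> j \<noteq> j" by blast
    have "card (R - {j, \<sigma> j}) = 1"
      using cardR j R_closed[OF j(1)] by (subst card_Diff_subset) auto
    then obtain a1 where a1: "R - {j, \<sigma> j} = {a1}"
      by (auto simp: card_1_singleton_iff)
    then have "{a1, j, \<sigma> j, i, \<sigma> i} = {1..5}"
      using full j R_closed[OF j(1)] by blast
    then obtain p where p: "p permutes {..<6::nat}" "p 0 = 0" "p 1 = a1" "p 2 = j" "p 3 = \<sigma> j" "p 4 = i" "p 5 = \<sigma> i"
      by (rule permutation_of_enumeration)
    have "\<sigma> a1 \<in> R - {j, \<sigma> j}"
      using a1 R_closed[of a1] inv[of a1] inv[of j] R_less[of a1] R_less[OF j(1)] by (metis Diff_iff insert_iff singletonD singletonI)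
    then have "\<sigma> a1 = a1"
      using a1 by blast
    then show ?thesis
      using that[of p] p by auto
  qed
qed

text \<open>In the normal form the indices 2 and 3 are either both fixed, which is the desired
  labelling, or swapped, which \<open>not_two_swapped_pairs\<close> excludes.\<close>

lemma exists_labelling:
  assumes rba: "noncomm_standard_rba6 scl mul ident star b \<delta>"
  shows "\<exists>p. p permutes {..<6} \<and> p 0 = 0 \<and>
           noncomm_standard_rba6 scl mul ident star (b \<circ> p) \<delta> \<and> labelled star (b \<circ> p)"
proof -
  interpret noncomm_rba6 scl mul ident star b \<delta>
    using rba by (auto simp: noncomm_standard_rba6_def noncomm_rba6_def noncomm_rba6_axioms_def)
  obtain p where p: "p permutes {..<6}" "p 0 = 0" "star_index (p 1) = p 1" "star_index (p 4) = p 5"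
    "star_index (p 2) = p 2 \<and> star_index (p 3) = p 3 \<or> star_index (p 2) = p 3"
    using involution_normal_form[of star_index] star_index_less star_index_star_index star_index_0
      star_index_not_trivial by blast
  have rba': "noncomm_standard_rba6 scl mul ident star (b \<circ> p) \<delta>"
    using rba p(1,2) by (rule noncomm_standard_rba6_relabel)
  interpret relabelled: noncomm_rba6 scl mul ident star "b \<circ> p" \<delta>
    using rba' by (auto simp: noncomm_standard_rba6_def noncomm_rba6_def noncomm_rba6_axioms_def)
  have p_less: "p i < 6" if "i < 6" for i
    using permutes_in_image[OF p(1), of i] that by simp
  have star: "star ((b \<circ> p) i) = (b \<circ> p) j" if "star_index (p i) = p j" "i < 6" for i j
    using that by (simp add: star_basis_index p_less)
  have "\<not> star_index (p 2) = p 3"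
  proof
    assume "star_index (p 2) = p 3"
    then have "relabelled.star_index 1 = 1" "relabelled.star_index 2 = 3" "relabelled.star_index 4 = 5"
      using star[OF p(3)] star[OF p(4)] star[of 2 3] by (auto intro!: relabelled.star_index_eq)
    then show False
      by (rule relabelled.not_two_swapped_pairs)
  qed
  then have "star_index (p 2) = p 2" "star_index (p 3) = p 3"
    using p(5) by auto
  moreover have "{1..3} = {1, 2, 3::nat}"
    by auto
  ultimately have "labelled star (b \<circ> p)"
    unfolding labelled_def using star[OF p(3)] star[OF p(4)] star[of 2 2] star[of 3 3] by auto
  then show ?thesis
    using p(1,2) rba' by blast
qed

text \<open>The clauses on tables presuppose a labelling, hence the first clause. Existence of a
  table keeps the admissibility statement from being vacuous. Realisation and uniqueness are
  separate, since the former names a carrier and the latter compares algebras on arbitrary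
  carriers.\<close>

theorem corollary4:
  fixes sA :: "complex \<Rightarrow> 'a::ab_group_add \<Rightarrow> 'a" and mA oneA starA bA \<delta>A
    and sC :: "complex \<Rightarrow> 'b::ab_group_add \<Rightarrow> 'b" and mC oneC starC bC \<delta>C
  shows
    "(noncomm_standard_rba6 sA mA oneA starA bA \<delta>A \<longrightarrow>
        (\<exists>p. p permutes {..<6} \<and> p 0 = 0 \<and>
           noncomm_standard_rba6 sA mA oneA starA (bA \<circ> p) \<delta>A \<and> labelled starA (bA \<circ> p))) \<and>
     (noncomm_standard_rba6 sA mA oneA starA bA \<delta>A \<and> labelled starA bA \<longrightarrow>
        (\<exists>T. is_character_table6 sA mA oneA bA \<delta>A T) \<and>
        (\<forall>T. is_character_table6 sA mA oneA bA \<delta>A T \<longrightarrow> admissible_table T)) \<and>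
     (\<forall>T. admissible_table T \<longrightarrow>
        (\<exists>(m :: complex^6 \<Rightarrow> complex^6 \<Rightarrow> complex^6) one star b \<delta>.
           noncomm_standard_rba6 (*s) m one star b \<delta> \<and> labelled star b \<and>
           is_character_table6 (*s) m one b \<delta> T)) \<and>
     (\<forall>T. noncomm_standard_rba6 sA mA oneA starA bA \<delta>A \<and> labelled starA bA \<and>
          is_character_table6 sA mA oneA bA \<delta>A T \<and>
          noncomm_standard_rba6 sC mC oneC starC bC \<delta>C \<and> labelled starC bC \<and>
          is_character_table6 sC mC oneC bC \<delta>C T \<longrightarrow>
          exactly_isomorphic sA mA oneA (bA ` {..<6}) sC mC oneC (bC ` {..<6}))"
proof (intro conjI impI allI)
  assume "noncomm_standard_rba6 sA mA oneA starA bA \<delta>A"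
  then show "\<exists>p. p permutes {..<6} \<and> p 0 = 0 \<and>
      noncomm_standard_rba6 sA mA oneA starA (bA \<circ> p) \<delta>A \<and> labelled starA (bA \<circ> p)"
    by (rule exists_labelling)
next
  assume "noncomm_standard_rba6 sA mA oneA starA bA \<delta>A \<and> labelled starA bA"
  then obtain \<Psi> m\<^sub>\<phi> m\<^sub>\<chi> where "labelled_split_rba6 sA mA oneA starA bA \<delta>A \<Psi> m\<^sub>\<phi> m\<^sub>\<chi>"
    using exists_labelled_split by blast
  then interpret labelled_split_rba6 sA mA oneA starA bA \<delta>A \<Psi> m\<^sub>\<phi> m\<^sub>\<chi> .
  show "\<exists>T. is_character_table6 sA mA oneA bA \<delta>A T"
    unfolding has_character_table_iff
    by (rule exI[of _ "\<lparr>row_\<delta> = \<lambda>i. \<delta>A (bA i), row_\<phi> = \<lambda>i. \<Psi> (bA i) $ 1, row_\<chi> = \<lambda>i. 2 * \<Psi> (bA i) $ 2,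
          mult_\<delta> = 1, mult_\<phi> = complex_of_real m\<^sub>\<phi>, mult_\<chi> = complex_of_real m\<^sub>\<chi>\<rparr>"]) simp
  show "admissible_table T" if "is_character_table6 sA mA oneA bA \<delta>A T" for T
    using that by (rule table_admissible)
next
  fix T
  assume "admissible_table T"
  then show "\<exists>(m :: complex^6 \<Rightarrow> complex^6 \<Rightarrow> complex^6) one star b \<delta>.
      noncomm_standard_rba6 (*s) m one star b \<delta> \<and> labelled star b \<and> is_character_table6 (*s) m one b \<delta> T"
    by (rule admissible_table_realised)
qed (use table_determines_algebra in blast)

end
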